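(* Let $n\geq 1$ and $r\geq 1$. Let $G'$ be a clique-sum of $r$ cycles of length $2n+1$, say $C_1,\dots,C_r$, and let $G$ be a graph obtained by taking the clique-sum of $G'$ and some bipartite graphs. Let $I=I(G)$ be the edge ideal of $G$. If $N_G(C_i)=V(G)$ for every odd cycle $C_i$, $1\le i\le r$, in $G$, then $\operatorname{reg}\left(I^{(s)}\right)=\operatorname{reg}\left(I^{s}\right)$ for all $s\geq 1$.
   Context: All graphs are finite and simple. For a graph $G$ with vertex set $V(G)=\{x_1,\dots,x_N\}$ and a field $\mathsf{k}$, let $S=\mathsf{k}[x_1,\dots,x_N]$ and let $I(G)\subset S$ be the edge ideal, generated by the monomials $x_ix_j$ with $\{x_i,x_j\}$ an edge of $G$. The $s$-th symbolic power of $I=I(G)$ is $I^{(s)}=\bigcap_{\mathfrak p\in\operatorname{Ass}(I)}\mathfrak p^s$. $\operatorname{reg}$ denotes Castelnuovo-Mumford regularity. For a cycle $C$ in $G$, $N_G(C)=\bigcup_{x\in V(C)}N_G(x)$, where $N_G(x)$ is the set of neighbors of $x$ (so $V(C)\subset N_G(C)$). Clique-sum: if $G_1,G_2$ are graphs with $G_1\cap G_2=K_t$ a complete graph and $G_1\neq K_t$, $G_2\neq K_t$, then $G_1\cup G_2$ is called the clique-sum of $G_1$ and $G_2$. A clique-sum of several graphs is obtained by successively taking clique-sums. *)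

theory Defs
  imports
    "HOL-Library.Poly_Mapping"
    "HOL-Algebra.Ideal_Product"
    "Jordan_Normal_Form.Matrix"
begin

section \<open>Graphs and clique-sums\<close>

record 'v sgraph =
  verts :: "'v set"
  edges :: "'v set set"

definition simple_graph :: "'v sgraph \<Rightarrow> bool" where
  "simple_graph G \<longleftrightarrow> finite (verts G) \<and> (\<forall>e\<in>edges G. e \<subseteq> verts G \<and> card e = 2)"

definition graph_union :: "'v sgraph \<Rightarrow> 'v sgraph \<Rightarrow> 'v sgraph" where
  "graph_union G H = \<lparr>verts = verts G \<union> verts H, edges = edges G \<union> edges H\<rparr>"

definition graph_inter :: "'v sgraph \<Rightarrow> 'v sgraph \<Rightarrow> 'v sgraph" where
  "graph_inter G H = \<lparr>verts = verts G \<inter> verts H, edges = edges G \<inter> edges H\<rparr>"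

text \<open>A complete graph \<open>K\<^sub>t\<close> has \<open>t \<ge> 1\<close> vertices.\<close>

definition complete_graph :: "'v sgraph \<Rightarrow> bool" where
  "complete_graph K \<longleftrightarrow> finite (verts K) \<and> verts K \<noteq> {} \<and>
     edges K = {{u, v} | u v. u \<in> verts K \<and> v \<in> verts K \<and> u \<noteq> v}"

definition cycle_graph :: "nat \<Rightarrow> 'v sgraph \<Rightarrow> bool" where
  "cycle_graph m C \<longleftrightarrow> 3 \<le> m \<and>
     (\<exists>xs. distinct xs \<and> length xs = m \<and> verts C = set xs \<and>
        edges C = {{xs ! i, xs ! (Suc i mod m)} | i. i < m})"

definition bipartite_graph :: "'v sgraph \<Rightarrow> bool" where
  "bipartite_graph G \<longleftrightarrow> simple_graph G \<and>
     (\<exists>A B. A \<union> B = verts G \<and> A \<inter> B = {} \<and> (\<forall>e\<in>edges G. \<exists>a\<in>A. \<exists>b\<in>B. e = {a, b}))"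

definition neighbors :: "'v sgraph \<Rightarrow> 'v \<Rightarrow> 'v set" where
  "neighbors G x = {y. {x, y} \<in> edges G}"

text \<open>The neighbourhood in \<open>G\<close> of a subgraph \<open>C\<close>: no vertices of \<open>C\<close> are removed from the union.\<close>

definition graph_nbhd :: "'v sgraph \<Rightarrow> 'v sgraph \<Rightarrow> 'v set" where
  "graph_nbhd G C = (\<Union>x\<in>verts C. neighbors G x)"

text \<open>The pieces live on subsets of one vertex type, so \<open>G\<^sub>1 \<inter> G\<^sub>2\<close> and \<open>G\<^sub>1 \<union> G\<^sub>2\<close> are literal.\<close>

definition clique_sum :: "'v sgraph \<Rightarrow> 'v sgraph \<Rightarrow> 'v sgraph \<Rightarrow> bool" where
  "clique_sum G1 G2 G \<longleftrightarrow>
     complete_graph (graph_inter G1 G2) \<and>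
     G1 \<noteq> graph_inter G1 G2 \<and> G2 \<noteq> graph_inter G1 G2 \<and>
     G = graph_union G1 G2"

inductive clique_sum_list :: "'v sgraph list \<Rightarrow> 'v sgraph \<Rightarrow> bool" where
  single: "clique_sum_list [H] H"
| step: "clique_sum_list Hs G \<Longrightarrow> clique_sum G H G' \<Longrightarrow> clique_sum_list (Hs @ [H]) G'"

section \<open>Polynomial rings\<close>

type_synonym ('v, 'k) mpoly = "('v \<Rightarrow>\<^sub>0 nat) \<Rightarrow>\<^sub>0 'k"

text \<open>The ring \<open>k[x\<^sub>v : v \<in> V]\<close>: the polynomials in which only variables indexed by \<open>V\<close> occur.\<close>

definition poly_ring :: "'v set \<Rightarrow> ('v, 'k::field) mpoly ring" where
  "poly_ring V = \<lparr>carrier = {p. \<forall>m\<in>Poly_Mapping.keys p. Poly_Mapping.keys m \<subseteq> V},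
                  monoid.mult = (*), one = 1, zero = 0, add = (+)\<rparr>"

lemma cring_poly_ring: "cring (poly_ring V :: ('v, 'k::field) mpoly ring)"
proof (rule cringI)
  show "abelian_group (poly_ring V :: ('v, 'k) mpoly ring)"
  proof (rule abelian_groupI)
    fix x :: "('v, 'k) mpoly"
    assume "x \<in> carrier (poly_ring V)"
    then show "\<exists>y\<in>carrier (poly_ring V). y \<oplus>\<^bsub>poly_ring V\<^esub> x = \<zero>\<^bsub>poly_ring V\<^esub>"
      by (intro bexI[of _ "- x"]) (auto simp: poly_ring_def in_keys_iff)
  qed (use Poly_Mapping.keys_add in \<open>fastforce simp: poly_ring_def ac_simps\<close>)+
  show "comm_monoid (poly_ring V :: ('v, 'k) mpoly ring)"
  proof (rule comm_monoidI)
    fix x y :: "('v, 'k) mpoly"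
    assume xy: "x \<in> carrier (poly_ring V)" "y \<in> carrier (poly_ring V)"
    have "Poly_Mapping.keys m \<subseteq> V" if m: "m \<in> Poly_Mapping.keys (x * y)" for m
    proof -
      obtain a b where "m = a + b" "a \<in> Poly_Mapping.keys x" "b \<in> Poly_Mapping.keys y"
        using keys_mult[of x y] m by blast
      then show ?thesis
        using xy Poly_Mapping.keys_add[of a b] by (fastforce simp: poly_ring_def)
    qed
    then show "x \<otimes>\<^bsub>poly_ring V\<^esub> y \<in> carrier (poly_ring V)"
      by (auto simp: poly_ring_def)
  qed (auto simp: poly_ring_def ac_simps)
qed (auto simp: poly_ring_def distrib_right)

definition pvar :: "'v \<Rightarrow> ('v, 'k::field) mpoly" where
  "pvar v = Poly_Mapping.single (Poly_Mapping.single v 1) 1"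

definition mon_deg :: "('v \<Rightarrow>\<^sub>0 nat) \<Rightarrow> nat" where
  "mon_deg m = (\<Sum>v\<in>Poly_Mapping.keys m. Poly_Mapping.lookup m v)"

text \<open>The zero polynomial is homogeneous of every degree, and only it in negative degrees.\<close>

definition homogeneous :: "int \<Rightarrow> ('v, 'k::field) mpoly \<Rightarrow> bool" where
  "homogeneous d p \<longleftrightarrow> (\<forall>m\<in>Poly_Mapping.keys p. int (mon_deg m) = d)"

section \<open>Edge ideals, ordinary and symbolic powers\<close>

definition edge_ideal :: "'v sgraph \<Rightarrow> ('v, 'k::field) mpoly set" where
  "edge_ideal G = genideal (poly_ring (verts G)) {pvar u * pvar v | u v. {u, v} \<in> edges G}"

text \<open>The monoid \<open>ideals_set R\<close> has multiplication \<open>ideal_prod R\<close> and unit \<open>carrier R\<close>.\<close>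

definition ideal_power :: "('a, 'b) ring_scheme \<Rightarrow> 'a set \<Rightarrow> nat \<Rightarrow> 'a set" where
  "ideal_power R I s = I [^]\<^bsub>ideals_set R\<^esub> s"

definition assoc_primes :: "('a, 'b) ring_scheme \<Rightarrow> 'a set \<Rightarrow> 'a set set" where
  "assoc_primes R I =
     {P. primeideal P R \<and> (\<exists>f\<in>carrier R. P = {g \<in> carrier R. g \<otimes>\<^bsub>R\<^esub> f \<in> I})}"

definition symbolic_power :: "('a, 'b) ring_scheme \<Rightarrow> 'a set \<Rightarrow> nat \<Rightarrow> 'a set" where
  "symbolic_power R I s = carrier R \<inter> (\<Inter>P\<in>assoc_primes R I. ideal_power R P s)"

section \<open>Castelnuovo--Mumford regularity\<close>

definition free_module :: "'v set \<Rightarrow> nat \<Rightarrow> ('v, 'k::field) mpoly vec set" where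
  "free_module V b = {w \<in> carrier_vec b. \<forall>i<b. w $ i \<in> carrier (poly_ring V)}"

text \<open>
  A list \<open>ds\<close> of integers stands for the graded free module \<open>\<Oplus>\<^sub>j S(-ds!j)\<close>, whose \<open>j\<close>-th basis
  vector has degree \<open>ds!j\<close>. A matrix \<open>A\<close> represents a degree-preserving map
  \<open>\<Oplus>\<^sub>j S(-cs!j) \<rightarrow> \<Oplus>\<^sub>i S(-rs!i)\<close>.
\<close>

definition graded_matrix :: "'v set \<Rightarrow> int list \<Rightarrow> int list \<Rightarrow> ('v, 'k::field) mpoly mat \<Rightarrow> bool" where
  "graded_matrix V rs cs A \<longleftrightarrow>
     A \<in> carrier_mat (length rs) (length cs) \<and>
     (\<forall>i<length rs. \<forall>j<length cs.
        A $$ (i, j) \<in> carrier (poly_ring V) \<and> homogeneous (cs ! j - rs ! i) (A $$ (i, j)))"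

text \<open>
  A graded free resolution \<open>\<cdots> \<rightarrow> F\<^sub>1 \<rightarrow> F\<^sub>0 \<rightarrow> I \<rightarrow> 0\<close> of an ideal \<open>I\<close> by free modules of
  finite rank, where \<open>F\<^sub>i\<close> has generator degrees \<open>sh i\<close>, the augmentation \<open>F\<^sub>0 \<rightarrow> I \<subseteq> S = S(0)\<close>
  is \<open>phi 0\<close>, and \<open>phi (Suc i)\<close> is the differential \<open>F\<^sub>i\<^sub>+\<^sub>1 \<rightarrow> F\<^sub>i\<close>.
  Modules \<open>F\<^sub>i\<close> with \<open>sh i = []\<close> are zero.
\<close>

definition graded_free_resolution ::
  "'v set \<Rightarrow> ('v, 'k::field) mpoly set \<Rightarrow> (nat \<Rightarrow> int list) \<Rightarrow> (nat \<Rightarrow> ('v, 'k) mpoly mat) \<Rightarrow> bool" where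
  "graded_free_resolution V I sh phi \<longleftrightarrow>
     graded_matrix V [0] (sh 0) (phi 0) \<and>
     (\<forall>i. graded_matrix V (sh i) (sh (Suc i)) (phi (Suc i))) \<and>
     I = (\<lambda>w. (phi 0 *\<^sub>v w) $ 0) ` free_module V (length (sh 0)) \<and>
     (\<forall>i. {w \<in> free_module V (length (sh i)). phi i *\<^sub>v w = 0\<^sub>v (dim_row (phi i))} =
          (\<lambda>w. phi (Suc i) *\<^sub>v w) ` free_module V (length (sh (Suc i))))"

text \<open>
  Minimality: each differential maps \<open>F\<^sub>i\<^sub>+\<^sub>1\<close> into \<open>\<mm> F\<^sub>i\<close>, where \<open>\<mm>\<close> is the ideal generated by
  the variables, i.e. no matrix entry has a constant term.
\<close>

definition minimal_graded_free_resolution ::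
  "'v set \<Rightarrow> ('v, 'k::field) mpoly set \<Rightarrow> (nat \<Rightarrow> int list) \<Rightarrow> (nat \<Rightarrow> ('v, 'k) mpoly mat) \<Rightarrow> bool" where
  "minimal_graded_free_resolution V I sh phi \<longleftrightarrow>
     graded_free_resolution V I sh phi \<and>
     (\<forall>i. \<forall>a<length (sh i). \<forall>b<length (sh (Suc i)).
        Poly_Mapping.lookup (phi (Suc i) $$ (a, b)) 0 = 0)"

text \<open>
  A minimal graded free resolution of a homogeneous ideal exists and is unique up to
  isomorphism when \<open>V\<close> is finite, so the choice below does not matter.
\<close>

definition min_res_shifts :: "'v set \<Rightarrow> ('v, 'k::field) mpoly set \<Rightarrow> nat \<Rightarrow> int list" where
  "min_res_shifts V I = (SOME sh. \<exists>phi. minimal_graded_free_resolution V I sh phi)"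

definition graded_betti :: "'v set \<Rightarrow> ('v, 'k::field) mpoly set \<Rightarrow> nat \<Rightarrow> int \<Rightarrow> nat" where
  "graded_betti V I i j = count_list (min_res_shifts V I i) j"

text \<open>
  The regularity of a nonzero homogeneous ideal, viewed as a graded module; only finitely many
  graded Betti numbers are nonzero, by Hilbert's syzygy theorem.
\<close>

definition regularity :: "'v set \<Rightarrow> ('v, 'k::field) mpoly set \<Rightarrow> int" where
  "regularity V I = Max {j - int i | i j. graded_betti V I i j \<noteq> 0}"

end

theory Submission
  imports Defs "HOL-Computational_Algebra.Primes"
begin

text \<open>
  Both powers are monomial ideals. A monomial \<open>m\<close> lies in \<open>I\<^sup>(\<^sup>s\<^sup>)\<close> iff every vertex cover of \<open>G\<close> has
  \<open>m\<close>-weight at least \<open>s\<close>, and in \<open>I\<^sup>s\<close> iff \<open>m\<close> is divisible by a product of \<open>s\<close> edges. Bipartite graphs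
  and odd cycles satisfy a weighted min-max theorem: the minimum weight of a cover is attained by a
  packing of edges (value 1) and odd cycles of length \<open>2n + 1\<close> (value \<open>n + 1\<close>), and this property
  passes to clique-sums. If every vertex is adjacent to every one of the odd cycles, a cycle of the
  packing together with any further vertex contains \<open>n + 1\<close> edges. Counting degrees, \<open>I\<^sup>s\<close> is the
  truncation of \<open>I\<^sup>(\<^sup>s\<^sup>)\<close> in degrees at least \<open>2s\<close>. As \<open>(uv)\<^sup>s\<close> is a minimal generator of \<open>I\<^sup>(\<^sup>s\<^sup>)\<close>
  of degree \<open>2s\<close> for every edge \<open>uv\<close>, the truncation has the same regularity, as is seen from
  Koszul homology.
\<close>

section \<open>Packings and vertex covers\<close>

text \<open>The number n + 1 is the least size of a vertex cover of a cycle of length 2n + 1. That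
  many edges use 2n + 2 units of weight while the cycle supplies only 2n + 1, so trading a cycle for
  edges needs one unit from elsewhere. The degree bound 2s provides exactly this spare unit, and the
  neighbourhood hypothesis joins its vertex to the cycle, whichever vertex it is.

  The min-max statement has to be integral, so linear programming duality does not suffice: packings
  are either built one edge at a time, keeping all covers heavy enough, or written down explicitly.

  Regularity is defined through an arbitrarily chosen minimal resolution. Existence has to be proved
  before anything can be said about the chosen one, and comparing two ideals calls for a description
  independent of the choice. Vanishing of Koszul homology is enough for that: a maximum over the
  nonzero Betti numbers depends only on where they are nonzero, not on their values.\<close>

definition vertex_cover :: "'v sgraph \<Rightarrow> 'v set \<Rightarrow> bool" where
  "vertex_cover G c \<longleftrightarrow> c \<subseteq> verts G \<and> (\<forall>e\<in>edges G. e \<inter> c \<noteq> {})"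

inductive packs :: "('v set \<times> nat) set \<Rightarrow> ('v \<Rightarrow> nat) \<Rightarrow> nat \<Rightarrow> bool" for X where
  base: "packs X m 0"
| item: "\<lbrakk>packs X m t; (S, k) \<in> X; t' \<le> t + k\<rbrakk> \<Longrightarrow> packs X (\<lambda>x. m x + of_bool (x \<in> S)) t'"

definition edge_items :: "'v sgraph \<Rightarrow> ('v set \<times> nat) set" where
  "edge_items G = edges G \<times> {1}"

lemma packs_le: "packs X m t \<Longrightarrow> t' \<le> t \<Longrightarrow> packs X m t'"
  by (cases rule: packs.cases) (auto intro: packs.intros)

lemma packs_add_left: "packs X m t \<Longrightarrow> packs X (\<lambda>x. m x + r x) t"
proof (induction rule: packs.induct)
  case (item m t S k t')
  from packs.item[OF item(4,2,3)] show ?case by (simp add: ac_simps)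
qed (rule packs.base)

lemma packs_mono_weight: "packs X m t \<Longrightarrow> (\<And>x. m x \<le> m' x) \<Longrightarrow> packs X m' t"
  using packs_add_left[of X m t "\<lambda>x. m' x - m x"] by simp

lemma packs_add: "packs X m t \<Longrightarrow> packs X m' t' \<Longrightarrow> packs X (\<lambda>x. m x + m' x) (t + t')"
proof (induction rule: packs.induct)
  case (base m)
  then show ?case using packs_add_left[of X m' t' m] by (simp add: ac_simps)
next
  case (item m t S k t1)
  from packs.item[OF item(4)[OF item(5)] item(2), of "t1 + t'"] item(3) show ?case
    by (simp add: ac_simps)
qed

lemma packs_mono: "packs X m t \<Longrightarrow> X \<subseteq> Y \<Longrightarrow> packs Y m t"
  by (induction rule: packs.induct) (auto intro: packs.intros)

lemma packs_multiple:
  assumes "(S, k) \<in> X"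
  shows "packs X (\<lambda>x. y * of_bool (x \<in> S)) (y * k)"
proof (induction y)
  case 0
  show ?case using packs.base[of X "\<lambda>_. 0"] by simp
next
  case (Suc y)
  from packs.item[OF Suc assms order.refl] show ?case by (simp add: ac_simps)
qed

lemma packs_sum:
  assumes "finite J" "\<And>j. j \<in> J \<Longrightarrow> (S j, k j) \<in> X"
  shows "packs X (\<lambda>x. \<Sum>j\<in>J. y j * of_bool (x \<in> S j)) (\<Sum>j\<in>J. y j * k j)"
  using assms
proof (induction J rule: finite_induct)
  case empty
  show ?case using packs.base[of X "\<lambda>_. 0"] by simp
next
  case (insert j J)
  have "packs X (\<lambda>x. \<Sum>j\<in>J. y j * of_bool (x \<in> S j)) (\<Sum>j\<in>J. y j * k j)"
    using insert by blast
  from packs_add[OF packs_multiple[of "S j" "k j" X "y j"] this] insert.hyps insert.prems[of j]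
  show ?case by (simp only: sum.insert insertI1 not_False_eq_True)
qed

text \<open>The hard half of an integral min-max theorem. Quantifying over all lower bounds
  \<open>t\<close> avoids naming the minimum weight of a cover.\<close>

definition weighted_duality :: "'v sgraph \<Rightarrow> ('v set \<times> nat) set \<Rightarrow> bool" where
  "weighted_duality G X \<longleftrightarrow> (\<forall>m t. (\<forall>c. vertex_cover G c \<longrightarrow> t \<le> sum m c) \<longrightarrow> packs X m t)"

lemma vertex_cover_finite: "simple_graph G \<Longrightarrow> vertex_cover G c \<Longrightarrow> finite c"
  unfolding simple_graph_def vertex_cover_def using finite_subset by blast

lemma vertex_cover_mono:
  "vertex_cover G c \<Longrightarrow> c \<subseteq> d \<Longrightarrow> d \<subseteq> verts G \<Longrightarrow> vertex_cover G d"
  unfolding vertex_cover_def by blast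

lemma vertex_cover_minus:
  assumes "simple_graph G"
  shows "vertex_cover G (verts G - {v})"
  unfolding vertex_cover_def
proof (intro conjI ballI)
  fix e assume "e \<in> edges G"
  then have e: "e \<subseteq> verts G" "card e = 2" using assms by (auto simp: simple_graph_def)
  then obtain a b where "e = {a, b}" "a \<noteq> b" by (auto simp: card_2_iff)
  then show "e \<inter> (verts G - {v}) \<noteq> {}" using e by auto
qed auto

lemma vertex_cover_verts: "simple_graph G \<Longrightarrow> vertex_cover G (verts G)"
  using vertex_cover_mono[OF vertex_cover_minus[of G undefined], of "verts G"] by blast

text \<open>Vertices of weight 0 join a cover at no cost. So a set that misses only edges with an
  end of weight 0 obeys the same lower bounds as a cover.\<close>

lemma cover_zero:
  assumes "simple_graph G" "\<And>e. e \<in> edges G \<Longrightarrow> \<exists>v\<in>e. v \<notin> c \<longrightarrow> m v = 0" "c \<subseteq> verts G"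
  shows "vertex_cover G (c \<union> {v\<in>verts G. m v = (0::nat)})" and
    "sum m (c \<union> {v\<in>verts G. m v = (0::nat)}) = sum m c"
proof -
  show "vertex_cover G (c \<union> {v\<in>verts G. m v = (0::nat)})"
    unfolding vertex_cover_def
  proof (intro conjI ballI)
    fix e assume e: "e \<in> edges G"
    then obtain v where v: "v \<in> e" "v \<notin> c \<longrightarrow> m v = 0" using assms(2) by blast
    have "v \<in> verts G" using v(1) e assms(1) by (auto simp: simple_graph_def)
    then have "v \<in> c \<union> {v \<in> verts G. m v = 0}" using v(2) by blast
    then show "e \<inter> (c \<union> {v \<in> verts G. m v = 0}) \<noteq> {}" using v(1) by blast
  qed (use assms(3) in auto)
  have "finite (verts G)" using assms(1) by (simp add: simple_graph_def)
  then show "sum m (c \<union> {v\<in>verts G. m v = (0::nat)}) = sum m c"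
    using assms(3) by (intro sum.mono_neutral_right) (auto intro: finite_subset)
qed

lemma min_cover_exists:
  fixes m :: "'v \<Rightarrow> nat"
  assumes "simple_graph G"
  obtains c where "vertex_cover G c" "\<And>d. vertex_cover G d \<Longrightarrow> sum m c \<le> sum m d"
  using ex_has_least_nat[of "vertex_cover G" "verts G" "sum m"] vertex_cover_verts[OF assms]
  by blast

section \<open>Splitting off an edge, and bipartite graphs\<close>

lemma edge_subtract:
  fixes m :: "'v \<Rightarrow> nat"
  assumes "finite c" "card e = 2" "\<And>v. v \<in> e \<Longrightarrow> 0 < m v"
  shows "sum (\<lambda>v. m v - of_bool (v \<in> e)) c + card (e \<inter> c) = sum m c"
proof -
  have "sum m c = (\<Sum>v\<in>c. (m v - of_bool (v \<in> e)) + of_bool (v \<in> e))"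
    using assms(3) by (intro sum.cong) (auto simp: of_bool_def Suc_leI)
  also have "\<dots> = sum (\<lambda>v. m v - of_bool (v \<in> e)) c + card (e \<inter> c)"
    using assms(1) by (simp add: sum.distrib Int_commute)
  finally show ?thesis by simp
qed

lemma packs_edge_step:
  assumes "packs X (\<lambda>v. m v - of_bool (v \<in> e)) t" "(e, 1) \<in> X" "\<And>v. v \<in> e \<Longrightarrow> 0 < m v"
  shows "packs X m (Suc t)"
proof -
  have "packs X (\<lambda>v. (m v - of_bool (v \<in> e)) + of_bool (v \<in> e)) (Suc t)"
    using packs.item[OF assms(1,2)] by simp
  also have "(\<lambda>v. (m v - of_bool (v \<in> e)) + of_bool (v \<in> e)) = m"
    using assms(3) by (auto simp: fun_eq_iff of_bool_def Suc_leI)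
  finally show ?thesis .
qed

text \<open>Lowering the weight by 1 at both ends of \<open>e\<close> costs a cover at most 2, and 2
  only if it contains both ends. Hence an edge contained in no cover of weight exactly
  \<open>Suc t\<close> can be split off; finding such an edge is the whole problem in the inductions
  on \<open>t\<close>.\<close>

lemma edge_subtract_covers:
  fixes m :: "'v \<Rightarrow> nat"
  assumes "simple_graph G" "e \<in> edges G" "\<And>v. v \<in> e \<Longrightarrow> 0 < m v"
    and t: "\<And>c. vertex_cover G c \<Longrightarrow> Suc t \<le> sum m c"
    and nt: "\<And>c. vertex_cover G c \<Longrightarrow> e \<subseteq> c \<Longrightarrow> sum m c \<noteq> Suc t"
    and c: "vertex_cover G c"
  shows "t \<le> sum (\<lambda>v. m v - of_bool (v \<in> e)) c"
proof -
  have e2: "card e = 2" using assms(1,2) by (auto simp: simple_graph_def)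
  have fe: "finite e" using e2 card.infinite by fastforce
  have eq: "sum (\<lambda>v. m v - of_bool (v \<in> e)) c + card (e \<inter> c) = sum m c"
    using vertex_cover_finite[OF assms(1) c] e2 assms(3) by (rule edge_subtract)
  show ?thesis
  proof (cases "e \<subseteq> c")
    case True
    then have "card (e \<inter> c) = 2" using e2 by (simp add: Int_absorb2)
    then show ?thesis using eq t[OF c] nt[OF c True] by linarith
  next
    case False
    then have "card (e \<inter> c) < card e" using fe by (intro psubset_card_mono) auto
    then show ?thesis using eq t[OF c] e2 by linarith
  qed
qed

text \<open>Minimum-weight covers are closed under the two uncrossing operations on their traces in \<open>A\<close>
  and \<open>B\<close>; the edge is found at a minimum cover whose positive weight in \<open>A\<close> is least.\<close>

lemma bipartite_good_edge:
  fixes m :: "'v \<Rightarrow> nat"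
  assumes G: "simple_graph G" and AB: "A \<union> B = verts G" "A \<inter> B = {}"
    and E: "\<And>e. e \<in> edges G \<Longrightarrow> \<exists>a\<in>A. \<exists>b\<in>B. e = {a, b}"
    and t: "\<And>c. vertex_cover G c \<Longrightarrow> t \<le> sum m c"
    and c0: "vertex_cover G c0" "sum m c0 = t" "0 < sum m (c0 \<inter> A)"
  shows "\<exists>e\<in>edges G. (\<forall>v\<in>e. 0 < m v) \<and> (\<forall>c. vertex_cover G c \<longrightarrow> e \<subseteq> c \<longrightarrow> sum m c \<noteq> t)"
proof -
  let ?P = "\<lambda>c. vertex_cover G c \<and> sum m c = t \<and> 0 < sum m (c \<inter> A)"
  obtain c where c: "?P c" and cmin: "\<And>d. ?P d \<Longrightarrow> sum m (c \<inter> A) \<le> sum m (d \<inter> A)"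
    using ex_has_least_nat[of ?P c0 "\<lambda>c. sum m (c \<inter> A)"] c0 by blast
  have fin: "finite (verts G)" using G by (simp add: simple_graph_def)
  have fAB: "finite A" "finite B" using fin AB by (metis finite_Un)+
  have split: "sum m d = sum m (d \<inter> A) + sum m (d \<inter> B)" if "d \<subseteq> verts G" for d
  proof -
    have "d = (d \<inter> A) \<union> (d \<inter> B)" using that AB by blast
    moreover have "sum m ((d \<inter> A) \<union> (d \<inter> B)) = sum m (d \<inter> A) + sum m (d \<inter> B)"
      using fAB AB by (intro sum.union_disjoint) auto
    ultimately show ?thesis by simp
  qed
  obtain u where u: "u \<in> c" "u \<in> A" "0 < m u"
    using c by (metis IntE gr0I less_irrefl sum.neutral)
  \<comment> \<open>Otherwise dropping \<open>u\<close> from \<open>c\<close> and adding the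
    vertices of weight 0 would give a cover lighter than \<open>t\<close>.\<close>
  have "\<exists>v. {u, v} \<in> edges G \<and> v \<notin> c \<and> 0 < m v"
  proof (rule ccontr)
    assume no: "\<not> ?thesis"
    have cs: "c \<subseteq> verts G" using c by (simp add: vertex_cover_def)
    have 1: "\<exists>v\<in>e. v \<notin> c - {u} \<longrightarrow> m v = 0" if e: "e \<in> edges G" for e
    proof (cases "u \<in> e")
      case True
      then obtain v where v: "e = {u, v}" using E[OF e] by blast
      show ?thesis
      proof (cases "v \<in> c \<and> v \<noteq> u")
        case False
        moreover have "v \<noteq> u" using E[OF e] v AB by (auto simp: doubleton_eq_iff)
        ultimately show ?thesis using no e v by auto
      qed (use v in blast)
    next
      case False
      obtain v where "v \<in> e" "v \<in> c" using c e by (auto simp: vertex_cover_def)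
      then show ?thesis using False by blast
    qed
    have "t \<le> sum m (c - {u})"
      using t[OF cover_zero(1)[OF G 1]] cover_zero(2)[OF G 1] cs by auto
    also have "\<dots> < sum m c"
      using u finite_subset[OF cs fin] by (metis add_less_same_cancel2 sum.remove less_add_same_cancel2)
    finally show False using c by simp
  qed
  then obtain v where v: "{u, v} \<in> edges G" "v \<notin> c" "0 < m v" by blast
  have vB: "v \<in> B" using E[OF v(1)] u AB by (auto simp: doubleton_eq_iff)
  have False if d: "vertex_cover G d" "{u, v} \<subseteq> d" "sum m d = t" for d
  proof -
    let ?d1 = "(c \<inter> d \<inter> A) \<union> ((c \<union> d) \<inter> B)" and ?d2 = "((c \<union> d) \<inter> A) \<union> (c \<inter> d \<inter> B)"
    have cov: "vertex_cover G ?d1" "vertex_cover G ?d2"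
    proof -
      have "e \<inter> ?d1 \<noteq> {} \<and> e \<inter> ?d2 \<noteq> {}" if e: "e \<in> edges G" for e
      proof -
        obtain a b where ab: "a \<in> A" "b \<in> B" "e = {a, b}" using E[OF e] by blast
        have "e \<inter> c \<noteq> {}" "e \<inter> d \<noteq> {}" using e c d by (auto simp: vertex_cover_def)
        then show ?thesis using ab by auto
      qed
      moreover have "?d1 \<subseteq> verts G" "?d2 \<subseteq> verts G" using AB by auto
      ultimately show "vertex_cover G ?d1" "vertex_cover G ?d2"
        unfolding vertex_cover_def by auto
    qed
    have i: "?d1 \<inter> A = c \<inter> d \<inter> A" "?d1 \<inter> B = (c \<union> d) \<inter> B"
      "?d2 \<inter> A = (c \<union> d) \<inter> A" "?d2 \<inter> B = c \<inter> d \<inter> B" using AB by auto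
    have s: "sum m ((c \<union> d) \<inter> Y) + sum m (c \<inter> d \<inter> Y) = sum m (c \<inter> Y) + sum m (d \<inter> Y)"
      if "finite Y" for Y
      using sum.union_inter[of "c \<inter> Y" "d \<inter> Y" m] that
      by (simp add: Int_ac Int_Un_distrib2[symmetric] Int_Un_distrib)
    have cd: "c \<subseteq> verts G" "d \<subseteq> verts G" using c d by (auto simp: vertex_cover_def)
    have d12: "?d1 \<subseteq> verts G" "?d2 \<subseteq> verts G" using cov by (auto simp: vertex_cover_def)
    have t1: "t \<le> sum m ?d1" "t \<le> sum m ?d2" using t cov by auto
    have e1: "sum m ?d1 = sum m (c \<inter> d \<inter> A) + sum m ((c \<union> d) \<inter> B)"
      using split[OF d12(1)] i by simp
    have e2: "sum m ?d2 = sum m ((c \<union> d) \<inter> A) + sum m (c \<inter> d \<inter> B)"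
      using split[OF d12(2)] i by simp
    \<comment> \<open>\<open>?d1\<close> and \<open>?d2\<close> together weigh as much as
      \<open>c\<close> and \<open>d\<close>, namely 2t, and each weighs at least t.\<close>
    have tight: "sum m ?d1 = t"
      using t1 e1 e2 s[OF fAB(1)] s[OF fAB(2)] split[OF cd(1)] split[OF cd(2)] c d(3) by linarith
    have pos: "0 < sum m (?d1 \<inter> A)"
      unfolding i using u d(2) fAB by (intro sum_pos2[of _ u]) auto
    \<comment> \<open>By minimality of \<open>c\<close>, passing to \<open>?d1\<close> loses no
      weight in \<open>A\<close>, while it gains the vertex \<open>v\<close> of positive weight in
      \<open>B\<close>; so \<open>?d1\<close> would weigh more than t.\<close>
    have "sum m (c \<inter> A) \<le> sum m (c \<inter> d \<inter> A)" using cmin[of ?d1] cov tight pos i by auto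
    moreover have "sum m ((c \<union> d) \<inter> B) \<ge> sum m (insert v (c \<inter> B))"
      using d(2) vB fAB by (intro sum_mono2) auto
    moreover have "sum m (insert v (c \<inter> B)) = m v + sum m (c \<inter> B)"
      using v fAB by (intro sum.insert) auto
    ultimately show False using e1 tight split[OF cd(1)] c v(3) by linarith
  qed
  then show ?thesis using v(1) u(3) v(3) by (intro bexI[of _ "{u, v}"]) auto
qed

text \<open>The weighted Koenig theorem. A cover of weight \<open>Suc t\<close> has positive weight
  in one of the two colour classes, and their roles can be exchanged.\<close>

lemma dual_bipartite:
  assumes "bipartite_graph G"
  shows "weighted_duality G (edge_items G)"
proof -
  have G: "simple_graph G" using assms by (simp add: bipartite_graph_def)
  obtain A B where AB: "A \<union> B = verts G" "A \<inter> B = {}"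
    and E: "\<And>e. e \<in> edges G \<Longrightarrow> \<exists>a\<in>A. \<exists>b\<in>B. e = {a, b}"
    using assms unfolding bipartite_graph_def by metis
  have "packs (edge_items G) m t" if "\<And>c. vertex_cover G c \<Longrightarrow> t \<le> sum m c" for m t
    using that
  proof (induction t arbitrary: m)
    case 0
    show ?case by (rule packs.base)
  next
    case (Suc t)
    have "\<exists>e\<in>edges G. (\<forall>v\<in>e. 0 < m v) \<and> (\<forall>c. vertex_cover G c \<longrightarrow> e \<subseteq> c \<longrightarrow> sum m c \<noteq> Suc t)"
    proof (cases "\<exists>c. vertex_cover G c \<and> sum m c = Suc t")
      case True
      then obtain c where c: "vertex_cover G c" "sum m c = Suc t" by blast
      have "sum m c = sum m ((c \<inter> A) \<union> (c \<inter> B))"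
        using c AB by (intro arg_cong[of _ _ "sum m"]) (auto simp: vertex_cover_def)
      moreover have "sum m ((c \<inter> A) \<union> (c \<inter> B)) = sum m (c \<inter> A) + sum m (c \<inter> B)"
        using vertex_cover_finite[OF G c(1)] AB by (intro sum.union_disjoint) auto
      ultimately have "0 < sum m (c \<inter> A) \<or> 0 < sum m (c \<inter> B)"
        using c(2) by linarith
      then show ?thesis
      proof
        assume "0 < sum m (c \<inter> A)"
        then show ?thesis using bipartite_good_edge[OF G AB E Suc.prems c] by blast
      next
        assume *: "0 < sum m (c \<inter> B)"
        have "\<exists>a\<in>B. \<exists>b\<in>A. e = {a, b}" if "e \<in> edges G" for e using E[OF that] by blast
        then show ?thesis
          using bipartite_good_edge[of G B A "Suc t" m c, OF G _ _ _ Suc.prems c *] AB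
          by (auto simp: Un_commute Int_commute)
      qed
    next
      case False
      \<comment> \<open>With no tight cover, any edge with positive weight at both ends will do. One
        exists, for otherwise the vertices of weight 0 would form a cover.\<close>
      have "\<exists>e\<in>edges G. \<forall>v\<in>e. 0 < m v"
      proof (rule ccontr)
        assume no: "\<not> ?thesis"
        then have "\<exists>v\<in>e. v \<notin> {} \<longrightarrow> m v = 0" if "e \<in> edges G" for e using that by auto
        from Suc.prems[OF cover_zero(1)[OF G this]] cover_zero(2)[OF G this] show False by simp
      qed
      then show ?thesis using False by blast
    qed
    then obtain e where e: "e \<in> edges G" "\<And>v. v \<in> e \<Longrightarrow> 0 < m v"
      "\<And>c. vertex_cover G c \<Longrightarrow> e \<subseteq> c \<Longrightarrow> sum m c \<noteq> Suc t" by blast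
    have "packs (edge_items G) (\<lambda>v. m v - of_bool (v \<in> e)) t"
      using edge_subtract_covers[OF G e(1,2) Suc.prems e(3)] by (intro Suc.IH) auto
    then show ?case using packs_edge_step[of "edge_items G" m e t] e by (simp add: edge_items_def)
  qed
  then show ?thesis unfolding weighted_duality_def by blast
qed

section \<open>Clique-sums\<close>

lemma clique_sum_simple:
  assumes "clique_sum G1 G2 G" "simple_graph G1" "simple_graph G2"
  shows "simple_graph G"
  using assms by (auto simp: clique_sum_def simple_graph_def graph_union_def)

lemma vertex_cover_clique:
  assumes "vertex_cover G c" "u \<notin> c" "v \<notin> c" "u \<noteq> v" "u \<in> K" "v \<in> K"
    "\<And>u v. u \<in> K \<Longrightarrow> v \<in> K \<Longrightarrow> u \<noteq> v \<Longrightarrow> {u, v} \<in> edges G"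
  shows False
proof -
  have "{u, v} \<inter> c \<noteq> {}"
    using assms(1) assms(7)[OF assms(5,6,4)] unfolding vertex_cover_def by (metis (lifting))
  then show False using assms(2,3) by blast
qed

text \<open>A cover misses at most one vertex of the clique \<open>K\<close>. The weight of \<open>k \<in> K\<close> is split so
  that, for its share, a cheapest cover of the second graph containing \<open>K\<close> is a cheapest cover
  of it altogether.\<close>

lemma dual_clique_sum:
  assumes cs: "clique_sum G1 G2 G" and G1: "simple_graph G1" and G2: "simple_graph G2"
    and d1: "weighted_duality G1 X1" and d2: "weighted_duality G2 X2"
  shows "weighted_duality G (X1 \<union> X2)"
proof -
  define K where "K = verts G1 \<inter> verts G2"
  have KE: "{u, v} \<in> edges G1" "{u, v} \<in> edges G2" if "u \<in> K" "v \<in> K" "u \<noteq> v" for u v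
    using cs that unfolding clique_sum_def complete_graph_def graph_inter_def K_def by auto
  have VG: "verts G = verts G1 \<union> verts G2" and EG: "edges G = edges G1 \<union> edges G2"
    using cs by (auto simp: clique_sum_def graph_union_def)
  have fin: "finite (verts G1)" "finite (verts G2)" "finite K"
    using G1 G2 by (auto simp: simple_graph_def K_def)
  have "packs (X1 \<union> X2) m t" if t: "\<And>c. vertex_cover G c \<Longrightarrow> t \<le> sum m c" for m t
  proof -
    let ?cost = "\<lambda>d. sum m (d - K)"
    have "\<exists>d0. (vertex_cover G2 d0 \<and> K \<subseteq> d0) \<and>
        (\<forall>d. vertex_cover G2 d \<and> K \<subseteq> d \<longrightarrow> ?cost d0 \<le> ?cost d)"
      using ex_has_least_nat[of "\<lambda>d. vertex_cover G2 d \<and> K \<subseteq> d" "verts G2" ?cost]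
        vertex_cover_verts[OF G2] by (auto simp: K_def)
    then obtain d0 where d0: "vertex_cover G2 d0" "K \<subseteq> d0"
      and d0min: "\<And>d. vertex_cover G2 d \<Longrightarrow> K \<subseteq> d \<Longrightarrow> ?cost d0 \<le> ?cost d" by blast
    have "\<exists>d. (vertex_cover G2 d \<and> K - {k} \<subseteq> d \<and> k \<notin> d) \<and>
        (\<forall>d'. vertex_cover G2 d' \<and> K - {k} \<subseteq> d' \<and> k \<notin> d' \<longrightarrow> ?cost d \<le> ?cost d')" for k
      using ex_has_least_nat[of "\<lambda>d. vertex_cover G2 d \<and> K - {k} \<subseteq> d \<and> k \<notin> d" "verts G2 - {k}" ?cost]
        vertex_cover_minus[OF G2, of k] by (auto simp: K_def)
    then obtain dk where dk: "\<And>k. vertex_cover G2 (dk k)" "\<And>k. K - {k} \<subseteq> dk k" "\<And>k. k \<notin> dk k"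
      and dkmin: "\<And>k d'. vertex_cover G2 d' \<Longrightarrow> K - {k} \<subseteq> d' \<Longrightarrow> k \<notin> d' \<Longrightarrow> ?cost (dk k) \<le> ?cost d'"
      by metis
    have d0k: "?cost d0 \<le> ?cost (dk k)" if "k \<in> K" for k
    proof -
      have "vertex_cover G2 (insert k (dk k))"
        using vertex_cover_mono[OF dk(1)] dk(1) that by (auto simp: vertex_cover_def K_def)
      moreover have "K \<subseteq> insert k (dk k)" using dk(2)[of k] by auto
      ultimately have "?cost d0 \<le> ?cost (insert k (dk k))" by (rule d0min)
      also have "insert k (dk k) - K = dk k - K" using that by auto
      finally show ?thesis .
    qed
    \<comment> \<open>The difference is the price, paid outside K, of omitting \<open>k\<close> from
      a cover of the second graph. The cap at \<open>m k\<close> keeps the share left to the first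
      graph from being truncated at 0.\<close>
    define \<beta> where "\<beta> k = min (m k) (?cost (dk k) - ?cost d0)" for k
    define m1 where "m1 x = (if x \<in> verts G1 then if x \<in> K then m x - \<beta> x else m x else 0)" for x
    define m2 where "m2 x = (if x \<in> K then \<beta> x else if x \<in> verts G2 then m x else 0)" for x
    have \<beta>m: "\<beta> k \<le> m k" for k by (simp add: \<beta>_def)
    obtain c1 where c1: "vertex_cover G1 c1"
      and c1min: "\<And>d. vertex_cover G1 d \<Longrightarrow> sum m1 c1 \<le> sum m1 d"
      using min_cover_exists[OF G1, of m1] by blast
    obtain c2 where c2: "vertex_cover G2 c2"
      and c2min: "\<And>d. vertex_cover G2 d \<Longrightarrow> sum m2 c2 \<le> sum m2 d"
      using min_cover_exists[OF G2, of m2] by blast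
    have fc1: "finite c1" using c1 G1 vertex_cover_finite by blast
    have s1: "sum m1 c = ?cost c + sum m1 (c \<inter> K)" if "vertex_cover G1 c" for c
    proof -
      have "sum m1 c = sum m1 (c \<inter> K) + sum m1 (c - K)"
        using vertex_cover_finite[OF G1 that] by (rule sum.Int_Diff)
      moreover have "sum m1 (c - K) = ?cost c"
        using that by (intro sum.cong) (auto simp: m1_def vertex_cover_def)
      ultimately show ?thesis by simp
    qed
    have s2: "sum m2 c = ?cost c + sum \<beta> (c \<inter> K)" if "vertex_cover G2 c" for c
    proof -
      have "sum m2 c = sum m2 (c \<inter> K) + sum m2 (c - K)"
        using vertex_cover_finite[OF G2 that] by (rule sum.Int_Diff)
      moreover have "sum m2 (c - K) = ?cost c" "sum m2 (c \<inter> K) = sum \<beta> (c \<inter> K)"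
        using that by (auto simp: m2_def vertex_cover_def intro!: sum.cong)
      ultimately show ?thesis by simp
    qed
    have inter: "c \<inter> K = K \<or> (\<exists>k\<in>K. k \<notin> c \<and> c \<inter> K = K - {k})"
      if "\<And>u v. u \<in> K \<Longrightarrow> v \<in> K \<Longrightarrow> u \<noteq> v \<Longrightarrow> {u, v} \<in> edges H" "vertex_cover H c"
      for c :: "'a set" and H
      using vertex_cover_clique[OF that(2) _ _ _ _ _ that(1)] by blast
    have rem: "sum f (K - {k}) + f k = sum f K" if "k \<in> K" for k and f :: "'a \<Rightarrow> nat"
      using that fin(3) by (simp add: sum.remove)
    have cov: "vertex_cover G (c \<union> d)" if "vertex_cover G1 c" "vertex_cover G2 d" for c d
      using that by (fastforce simp: vertex_cover_def VG EG)
    have cu: "sum m (c \<union> d) = ?cost c + ?cost d + sum m ((c \<union> d) \<inter> K)"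
      if "vertex_cover G1 c" "vertex_cover G2 d" for c d
    proof -
      have f: "finite c" "finite d" using that G1 G2 vertex_cover_finite by blast+
      have "sum m (c \<union> d) = sum m ((c \<union> d) \<inter> K) + sum m ((c \<union> d) - K)"
        using f by (intro sum.Int_Diff) simp
      also have "(c \<union> d) - K = (c - K) \<union> (d - K)" by blast
      also have "sum m \<dots> = ?cost c + ?cost d"
        using f that by (intro sum.union_disjoint) (auto simp: vertex_cover_def K_def)
      finally show ?thesis by simp
    qed
    have m1K: "sum m1 K + sum \<beta> K = sum m K"
      unfolding sum.distrib[symmetric] using \<beta>m by (intro sum.cong) (auto simp: m1_def K_def)
    have m1k: "m1 k + \<beta> k = m k" if "k \<in> K" for k
      using \<beta>m that by (auto simp: m1_def K_def)
    \<comment> \<open>Omitting \<open>k\<close> saves \<open>\<beta> k\<close> on K and costs at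
      least \<open>\<beta> k\<close> outside it.\<close>
    have c2ge: "?cost d0 + sum \<beta> K \<le> sum m2 c2"
    proof -
      consider "c2 \<inter> K = K" | k where "k \<in> K" "k \<notin> c2" "c2 \<inter> K = K - {k}"
        using inter[OF KE(2) c2] by blast
      then show ?thesis
      proof cases
        case 1
        then have "?cost d0 \<le> ?cost c2" by (intro d0min[OF c2]) blast
        then show ?thesis using s2[OF c2] 1 by simp
      next
        case 2
        have "?cost (dk k) \<le> ?cost c2" using dkmin[OF c2, of k] 2 by blast
        then show ?thesis
          using s2[OF c2] 2 rem[OF 2(1), of \<beta>] d0k[OF 2(1)] by (simp add: \<beta>_def)
      qed
    qed
    have "t \<le> sum m1 c1 + (?cost d0 + sum \<beta> K)"
    proof -
      consider "c1 \<inter> K = K" | k where "k \<in> K" "k \<notin> c1" "c1 \<inter> K = K - {k}"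
        using inter[OF KE(1) c1] by blast
      then show ?thesis
      proof cases
        case 1
        then have "(c1 \<union> d0) \<inter> K = K" by blast
        then show ?thesis
          using t[OF cov[OF c1 d0(1)]] cu[OF c1 d0(1)] s1[OF c1] 1 m1K by simp
      next
        case 2
        show ?thesis
        \<comment> \<open>If the cap is active, \<open>k\<close> is free for the first graph and
          \<open>d0\<close> can put it back into the cover. Otherwise \<open>\<beta> k\<close>
          equals the difference of the costs, and \<open>dk k\<close> extends \<open>c1\<close>
          without \<open>k\<close> at the same price.\<close>
        proof (cases "m k \<le> ?cost (dk k) - ?cost d0")
          case True
          then have b: "m1 k = 0" using m1k[OF 2(1)] by (simp add: \<beta>_def)
          have "(c1 \<union> d0) \<inter> K = K" using d0(2) by blast
          then show ?thesis
            using t[OF cov[OF c1 d0(1)]] cu[OF c1 d0(1)] s1[OF c1] 2 m1K b rem[OF 2(1), of m1] by simp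
        next
          case False
          then have b: "\<beta> k + ?cost d0 = ?cost (dk k)"
            using d0k[OF 2(1)] by (simp add: \<beta>_def)
          have "(c1 \<union> dk k) \<inter> K = K - {k}" using dk(2,3)[of k] 2 by blast
          then show ?thesis
            using t[OF cov[OF c1 dk(1)[of k]]] cu[OF c1 dk(1)[of k]] s1[OF c1] 2(3) m1K b
              rem[OF 2(1), of m1] rem[OF 2(1), of m] m1k[OF 2(1)] by simp
        qed
      qed
    qed
    then have tt: "t \<le> sum m1 c1 + sum m2 c2" using c2ge by simp
    have "packs X1 m1 (sum m1 c1)" "packs X2 m2 (sum m2 c2)"
      using d1[unfolded weighted_duality_def, rule_format, OF c1min] d2[unfolded weighted_duality_def, rule_format, OF c2min]
      by blast+
    then have "packs (X1 \<union> X2) (\<lambda>x. m1 x + m2 x) (sum m1 c1 + sum m2 c2)"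
      by (intro packs_add) (auto elim: packs_mono)
    then have "packs (X1 \<union> X2) (\<lambda>x. m1 x + m2 x) t" using tt by (rule packs_le)
    moreover have "m1 x + m2 x \<le> m x" for x
      using \<beta>m[of x] by (simp add: m1_def m2_def K_def)
    ultimately show ?thesis by (rule packs_mono_weight)
  qed
  then show ?thesis unfolding weighted_duality_def by blast
qed

lemma dual_clique_sum_list:
  assumes "clique_sum_list Hs G" "\<And>H. H \<in> set Hs \<Longrightarrow> simple_graph H \<and> weighted_duality H (X H)"
  shows "simple_graph G \<and> weighted_duality G (\<Union>H\<in>set Hs. X H) \<and> (\<forall>H\<in>set Hs. verts H \<subseteq> verts G \<and> edges H \<subseteq> edges G)"
  using assms
proof (induction rule: clique_sum_list.induct)
  case (single H)
  then show ?case by auto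
next
  case (step Hs G H G')
  have IH: "simple_graph G" "weighted_duality G (\<Union>H\<in>set Hs. X H)"
    "\<forall>H\<in>set Hs. verts H \<subseteq> verts G \<and> edges H \<subseteq> edges G" and H: "simple_graph H" "weighted_duality H (X H)"
    using step.IH step.prems by auto
  have "verts G' = verts G \<union> verts H" "edges G' = edges G \<union> edges H"
    using step.hyps(2) by (auto simp: clique_sum_def graph_union_def)
  moreover have "(\<Union>H\<in>set (Hs @ [H]). X H) = (\<Union>H\<in>set Hs. X H) \<union> X H" by auto
  moreover have "weighted_duality G' ((\<Union>H\<in>set Hs. X H) \<union> X H)"
    by (rule dual_clique_sum[OF step.hyps(2) IH(1) H(1) IH(2) H(2)])
  ultimately show ?case
    using clique_sum_simple[OF step.hyps(2) IH(1) H(1)] IH(3) by (simp add: le_supI1)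
qed

section \<open>Odd cycles\<close>

text \<open>A periodic enumeration by all natural numbers: a rotation is a shift of the index, and
  neighbours are \<open>x i\<close> and \<open>x (Suc i)\<close> without reduction modulo
  \<open>L\<close>.\<close>

definition cyclic_list :: "nat \<Rightarrow> (nat \<Rightarrow> 'v) \<Rightarrow> 'v sgraph \<Rightarrow> bool" where
  "cyclic_list L x C \<longleftrightarrow> (\<forall>i j. x i = x j \<longleftrightarrow> i mod L = j mod L) \<and>
     verts C = range x \<and> edges C = range (\<lambda>i. {x i, x (Suc i)})"

lemma cycle_graph_cyclic_list:
  assumes "cycle_graph L C"
  obtains x where "cyclic_list L x C"
proof -
  obtain xs where xs: "distinct xs" "length xs = L" "verts C = set xs"
    "edges C = {{xs ! i, xs ! (Suc i mod L)} | i. i < L}" and L: "3 \<le> L"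
    using assms by (auto simp: cycle_graph_def)
  let ?x = "\<lambda>i. xs ! (i mod L)"
  have "?x i = ?x j \<longleftrightarrow> i mod L = j mod L" for i j
    using xs L by (intro nth_eq_iff_index_eq) auto
  moreover have "verts C = range ?x"
  proof (intro equalityI subsetI)
    fix v assume "v \<in> verts C"
    then obtain i where "i < L" "v = xs ! i" using xs by (metis in_set_conv_nth)
    then show "v \<in> range ?x" by (intro image_eqI[of _ _ i]) auto
  qed (use xs L in \<open>auto intro!: nth_mem mod_less_divisor\<close>)
  moreover have "edges C = range (\<lambda>i. {?x i, ?x (Suc i)})"
  proof (intro equalityI subsetI)
    fix e assume "e \<in> edges C"
    then obtain i where "i < L" "e = {xs ! i, xs ! (Suc i mod L)}" using xs by blast
    then show "e \<in> range (\<lambda>i. {?x i, ?x (Suc i)})" by (intro image_eqI[of _ _ i]) auto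
  next
    fix e assume "e \<in> range (\<lambda>i. {?x i, ?x (Suc i)})"
    then obtain i where "e = {?x i, ?x (Suc i)}" by blast
    then have "e = {xs ! (i mod L), xs ! (Suc (i mod L) mod L)}" by (simp add: mod_Suc_eq)
    moreover have "i mod L < L" using L by simp
    ultimately show "e \<in> edges C" unfolding xs(4) by blast
  qed
  ultimately show ?thesis using that[of ?x] unfolding cyclic_list_def by blast
qed

lemma cyclic_list_periodic:
  assumes "cyclic_list L x C" shows "x (i + k * L) = x i"
  using assms unfolding cyclic_list_def by (metis mod_mult_self1)

lemma cyclic_list_shift:
  assumes c: "cyclic_list L x C" and "L > 0"
  shows "cyclic_list L (\<lambda>i. x (i + k)) C"
proof -
  \<comment> \<open>Adding k(L - 1) inverts the shift by k up to a multiple of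
    \<open>L\<close>.\<close>
  have eq: "x i = x (i + k * (L - 1) + k)" for i
  proof -
    have "i + k * (L - 1) + k = i + k * L" using \<open>L > 0\<close> by (cases L) auto
    then show ?thesis by (simp only: cyclic_list_periodic[OF c])
  qed
  have inv: "((i + k) mod L + k * (L - 1)) mod L = i mod L" for i
  proof -
    have "i + k + k * (L - 1) = i + k * L" using \<open>L > 0\<close> by (cases L) auto
    then show ?thesis by (simp only: mod_add_left_eq mod_mult_self1)
  qed
  have "(i + k) mod L = (j + k) mod L \<longleftrightarrow> i mod L = j mod L" for i j
    using inv[of i] inv[of j] by (metis mod_add_left_eq)
  moreover have "range x = range (\<lambda>i. x (i + k))"
    using eq by (auto intro!: image_eqI)
  moreover have "range (\<lambda>i. {x i, x (Suc i)}) = range (\<lambda>i. {x (i + k), x (Suc i + k)})"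
  proof (intro equalityI subsetI)
    fix e assume "e \<in> range (\<lambda>i. {x i, x (Suc i)})"
    then obtain i where "e = {x i, x (Suc i)}" by blast
    then have "e = {x (i + k * (L - 1) + k), x (Suc (i + k * (L - 1)) + k)}"
      using eq[of i] eq[of "Suc i"] by simp
    then show "e \<in> range (\<lambda>i. {x (i + k), x (Suc i + k)})" by blast
  qed auto
  ultimately show ?thesis using c unfolding cyclic_list_def by simp
qed

lemma cyclic_list_verts:
  assumes c: "cyclic_list L x C" and "L > 0"
  shows "verts C = x ` {..<L}" "inj_on x {..<L}"
proof -
  have "x i \<in> x ` {..<L}" for i
    using c \<open>L > 0\<close> unfolding cyclic_list_def by (intro image_eqI[of _ _ "i mod L"]) auto
  then show "verts C = x ` {..<L}" using c unfolding cyclic_list_def by auto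
  show "inj_on x {..<L}" using c unfolding cyclic_list_def inj_on_def by auto
qed

lemma cyclic_list_edge:
  assumes c: "cyclic_list L x C" and "L > 0" and "e \<in> edges C"
  obtains r where "r < L" "e = {x r, x (Suc r)}"
proof -
  have "e \<in> range (\<lambda>i. {x i, x (Suc i)})" using assms by (simp add: cyclic_list_def)
  then obtain i where i: "e = {x i, x (Suc i)}" by blast
  have "x i = x (i mod L)" "x (Suc i) = x (Suc (i mod L))"
    using c unfolding cyclic_list_def by (auto simp: mod_Suc_eq)
  then show ?thesis using that[of "i mod L"] i \<open>L > 0\<close> by simp
qed

lemma cyclic_list_edgeI: "cyclic_list L x C \<Longrightarrow> {x i, x (Suc i)} \<in> edges C"
  by (simp add: cyclic_list_def)

lemma cyclic_list_sum:
  assumes c: "cyclic_list L x C" and "L > 0"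
  shows "(\<Sum>i<L. f (x (i + k))) = sum f (verts C)"
proof -
  note s = cyclic_list_verts[OF cyclic_list_shift[OF c \<open>L > 0\<close>, of k] \<open>L > 0\<close>]
  show ?thesis unfolding s(1) by (simp add: sum.reindex[OF s(2)])
qed

lemma cycle_simple_graph:
  assumes "cycle_graph L C" shows "simple_graph C"
proof -
  obtain x where x: "cyclic_list L x C" using cycle_graph_cyclic_list[OF assms] .
  have L: "3 \<le> L" using assms by (simp add: cycle_graph_def)
  have "x i \<noteq> x (Suc i)" for i
  proof -
    have "Suc i mod L \<noteq> i mod L"
      using L by (simp add: mod_Suc)
    then show ?thesis using x unfolding cyclic_list_def by metis
  qed
  then have "card {x i, x (Suc i)} = 2" for i by simp
  moreover have "finite (verts C)" using cyclic_list_verts[OF x] L by simp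
  ultimately show ?thesis using x by (auto simp: simple_graph_def cyclic_list_def)
qed

lemma sum_lessThan_odd:
  fixes f :: "nat \<Rightarrow> nat"
  shows "(\<Sum>l<2 * n + 1. f l) = (\<Sum>l<n. f (2 * l) + f (2 * l + 1)) + f (2 * n)"
  by (induction n) auto

text \<open>The optimal packing is explicit: the cycle has multiplicity \<open>2t - m(C)\<close> and an edge \<open>e\<close> has
  multiplicity \<open>m(c\<^sub>e) - t\<close>, where \<open>c\<^sub>e\<close> is the cover by \<open>n + 1\<close> vertices that contains both ends of \<open>e\<close>.\<close>

lemma odd_cycle_heavy_covers:
  fixes m :: "'v \<Rightarrow> nat"
  assumes x: "cyclic_list L x C" and L: "L = 2 * n + 1"
    and t: "\<And>c. vertex_cover C c \<Longrightarrow> t \<le> sum m c" and M: "sum m (verts C) \<le> 2 * t"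
  shows "packs (edge_items C \<union> {(verts C, n + 1)}) m t"
proof -
  \<comment> \<open>\<open>w i\<close> is the weight of the cover made of \<open>x i\<close> and
    every second vertex from \<open>x (i + 1)\<close> on, the one that contains both ends of the
    edge \<open>?S i\<close>.\<close>
  define w where "w i = m (x i) + (\<Sum>j<n. m (x (i + 1 + 2 * j)))" for i
  define p where "p = 2 * t - sum m (verts C)"
  let ?M = "sum m (verts C)"
  let ?S = "\<lambda>i. {x i, x (Suc i)}"
  have L0: "L > 0" using L by simp
  have xeq: "x i = x j \<longleftrightarrow> i mod L = j mod L" for i j using x unfolding cyclic_list_def by blast
  have wt: "t \<le> w i" for i
  proof -
    let ?c = "insert (x i) ((\<lambda>j. x (i + 1 + 2 * j)) ` {..<n})"
    let ?x = "\<lambda>j. x (j + i)"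
    have x': "cyclic_list L ?x C" by (rule cyclic_list_shift[OF x L0])
    have "vertex_cover C ?c"
      unfolding vertex_cover_def
    proof (intro conjI ballI)
      show "?c \<subseteq> verts C" using x by (auto simp: cyclic_list_def)
      fix e assume "e \<in> edges C"
      then obtain r where r: "r < L" "e = {?x r, ?x (Suc r)}" using cyclic_list_edge[OF x' L0] by blast
      consider "r = 0" | j where "r = 2 * j + 1" | j where "r = 2 * j + 2"
        by (metis One_nat_def add_2_eq_Suc' add.right_neutral add_Suc_right mult_Suc_right nat.exhaust odd_two_times_div_two_succ evenE Suc_1 mult_0_right)
      then show "e \<inter> ?c \<noteq> {}"
      proof cases
        case 1 then show ?thesis using r by auto
      next
        case 2
        then have "?x r \<in> ?c" using r L by (auto simp: ac_simps)
        then show ?thesis using r by blast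
      next
        case 3
        show ?thesis
        proof (cases "r = 2 * n")
          case True
          then have "Suc r + i = i + 1 * L" using L by simp
          then have "?x (Suc r) = x i" using cyclic_list_periodic[OF x, of i 1] by metis
          then show ?thesis using r by auto
        next
          case False
          then have "j + 1 < n" using 3 r(1) L by simp
          then have "x (i + 1 + 2 * (j + 1)) \<in> ?c" by (intro insertI2 image_eqI[of _ _ "j + 1"]) auto
          moreover have "x (i + 1 + 2 * (j + 1)) = ?x (Suc r)" using 3 by (simp add: ac_simps)
          ultimately show ?thesis using r by auto
        qed
      qed
    qed
    then have "t \<le> sum m ?c" by (rule t)
    also have "\<dots> \<le> m (x i) + sum m ((\<lambda>j. x (i + 1 + 2 * j)) ` {..<n})"
      by (simp add: sum.insert_if)
    also have "sum m ((\<lambda>j. x (i + 1 + 2 * j)) ` {..<n}) \<le> (\<Sum>j<n. m (x (i + 1 + 2 * j)))"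
      using sum_image_le[of "{..<n}" m "\<lambda>j. x (i + 1 + 2 * j)"] by (simp add: comp_def)
    finally show ?thesis by (simp add: w_def)
  qed
  have wper: "w (i mod L) = w i" for i
  proof -
    have "x (i mod L + k) = x (i + k)" for k by (simp add: xeq mod_add_left_eq)
    from this[of 0] this show ?thesis by (simp add: w_def add.assoc del: One_nat_def)
  qed
  \<comment> \<open>The edges with indices j and j + 2n are the two edges at \<open>x j\<close>.
    Their covers together contain every vertex once, and \<open>x j\<close> twice.\<close>
  have ww: "w j + w (j + 2 * n) = ?M + m (x j)" for j
  proof -
    have "x (j + 2 * n + 1 + 2 * l) = x (2 * l + j)" for l
      using cyclic_list_periodic[OF x, of "2 * l + j" 1] L by (simp add: ac_simps)
    then have "w (j + 2 * n) = m (x (2 * n + j)) + (\<Sum>l<n. m (x (2 * l + j)))"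
      by (simp add: w_def ac_simps)
    moreover have "w j = m (x j) + (\<Sum>l<n. m (x (2 * l + 1 + j)))"
      by (simp add: w_def ac_simps)
    moreover have "?M = (\<Sum>l<2*n+1. m (x (l + j)))"
      using cyclic_list_sum[OF x L0, of m j] L by simp
    ultimately show ?thesis
      unfolding sum_lessThan_odd by (simp add: sum.distrib)
  qed
  have "packs (edge_items C) (\<lambda>v. \<Sum>i<L. (w i - t) * of_bool (v \<in> ?S i)) (\<Sum>i<L. (w i - t) * 1)"
    using cyclic_list_edgeI[OF x] by (intro packs_sum) (auto simp: edge_items_def)
  then have "packs (edge_items C \<union> {(verts C, n + 1)})
      (\<lambda>v. (\<Sum>i<L. (w i - t) * of_bool (v \<in> ?S i)) + p * of_bool (v \<in> verts C))
      ((\<Sum>i<L. (w i - t) * 1) + p * (n + 1))"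
    by (intro packs_add packs_multiple) (auto elim: packs_mono)
  \<comment> \<open>Each vertex lies in n + 1 of the L covers, so the \<open>w i\<close> add up to
    (n + 1)M, where M is the total weight, and (n + 1)M - (2n + 1)t + (n + 1)(2t - M) = t.\<close>
  moreover have "(\<Sum>i<L. (w i - t) * 1) + p * (n + 1) = t"
  proof -
    have "(\<Sum>i<L. w i) = (\<Sum>i<L. m (x (i + 0))) + (\<Sum>j<n. \<Sum>i<L. m (x (i + (1 + 2 * j))))"
      unfolding w_def sum.distrib by (subst sum.swap) (simp add: ac_simps)
    also have "\<dots> = ?M + n * ?M"
      unfolding cyclic_list_sum[OF x L0, of m] by simp
    finally have "(\<Sum>i<L. w i) = ?M + n * ?M" .
    moreover have "(\<Sum>i<L. w i) = (\<Sum>i<L. w i - t) + L * t"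
    proof -
      have "(\<Sum>i<L. w i) = (\<Sum>i<L. (w i - t) + t)" using wt by (intro sum.cong) auto
      then show ?thesis by (simp add: sum.distrib)
    qed
    moreover have "?M + p = 2 * t" using M by (simp add: p_def)
    then have "n * (?M + p) = n * (2 * t)" by simp
    ultimately show ?thesis using L M \<open>?M + p = 2 * t\<close>
      by (simp add: algebra_simps)
  qed
  moreover have "(\<Sum>i<L. (w i - t) * of_bool (v \<in> ?S i)) + p * of_bool (v \<in> verts C) \<le> m v" for v
  proof (cases "v \<in> verts C")
    case False
    then have "v \<notin> ?S i" for i using x by (auto simp: cyclic_list_def)
    then show ?thesis using False by simp
  next
    case True
    then obtain j where j: "j < L" "v = x j" using cyclic_list_verts[OF x L0] by auto
    \<comment> \<open>The edges at \<open>x j\<close> have the indices \<open>j\<close> and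
      \<open>?k\<close>, the residue of j - 1. By \<open>ww\<close> their multiplicities and
      \<open>p\<close> add up to exactly \<open>m (x j)\<close>.\<close>
    let ?k = "(j + 2 * n) mod L"
    have "(w i - t) * of_bool (v \<in> ?S i) \<le> (w i - t) * of_bool (i = j) + (w i - t) * of_bool (i = ?k)"
      if "i < L" for i
    proof -
      have "i = ?k" if "x j = x (Suc i)"
      proof -
        have "j = Suc i mod L" using that j(1) by (simp add: xeq)
        then have "?k = (Suc i + 2 * n) mod L" by (simp add: mod_add_left_eq)
        also have "Suc i + 2 * n = i + L" using L by simp
        finally show ?thesis using \<open>i < L\<close> by simp
      qed
      moreover have "i = j" if "x j = x i" using that j(1) \<open>i < L\<close> by (simp add: xeq)
      ultimately show ?thesis using j(2) by (auto simp: of_bool_def)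
    qed
    then have "(\<Sum>i<L. (w i - t) * of_bool (v \<in> ?S i))
        \<le> (\<Sum>i<L. (w i - t) * of_bool (i = j) + (w i - t) * of_bool (i = ?k))"
      by (intro sum_mono) auto
    also have "\<dots> = (w j - t) + (w ?k - t)"
    proof -
      have "(\<Sum>i<L. (w i - t) * of_bool (i = k)) = w k - t" if "k < L" for k
      proof -
        have "(\<Sum>i<L. (w i - t) * of_bool (i = k)) = (\<Sum>i<L. if i = k then w k - t else 0)"
          by (intro sum.cong) auto
        then show ?thesis using that by simp
      qed
      from this[of j] this[of ?k] show ?thesis using j(1) L0 by (simp add: sum.distrib)
    qed
    finally have "(\<Sum>i<L. (w i - t) * of_bool (v \<in> ?S i)) \<le> (w j - t) + (w ?k - t)" .
    then show ?thesis
      using True wt[of j] wt[of "j + 2 * n"] ww[of j] wper[of "j + 2 * n"] j(2) M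
      by (simp add: p_def)
  qed
  ultimately show ?thesis by (metis (no_types, lifting) packs_mono_weight)
qed

text \<open>Start at an edge contained in a minimum cover \<open>c\<close> and let \<open>F i\<close> be the weight of \<open>c\<close> minus the
  weight of its complement from position \<open>i\<close> on. At the last position of \<open>c\<close> with \<open>F i \<le> 0\<close>, another
  minimum cover containing the next edge could be improved by switching to \<open>c\<close> on the stretch
  where the two differ.\<close>

lemma odd_cycle_good_edge:
  fixes m :: "'v \<Rightarrow> nat"
  assumes x0: "cyclic_list L x0 C" and L: "L = 2 * n + 1" and n: "n \<ge> 1" and G: "simple_graph C"
    and t: "\<And>c. vertex_cover C c \<Longrightarrow> t \<le> sum m c" and M: "2 * t < sum m (verts C)"
    and pos: "\<And>v. v \<in> verts C \<Longrightarrow> 0 < m v"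
  shows "\<exists>e\<in>edges C. \<forall>c. vertex_cover C c \<longrightarrow> e \<subseteq> c \<longrightarrow> sum m c \<noteq> t"
proof (rule ccontr)
  assume "\<not> ?thesis"
  then have tight: "\<exists>c. vertex_cover C c \<and> e \<subseteq> c \<and> sum m c = t" if "e \<in> edges C" for e
    using that by blast
  have L0: "L > 0" using L by simp
  obtain c where c: "vertex_cover C c" "{x0 0, x0 1} \<subseteq> c" "sum m c = t"
    using tight[OF cyclic_list_edgeI[OF x0, of 0]] by auto
  \<comment> \<open>The rotation moves the doubly covered edge to the seam: \<open>x (2 * n)\<close>
    and \<open>x 0\<close> both lie in \<open>c\<close>, and the switch below takes place on an
    interval of the indices 0, ..., 2n.\<close>
  define x where "x i = x0 (i + 1)" for i
  have x: "cyclic_list L x C" unfolding x_def by (rule cyclic_list_shift[OF x0 L0])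
  have xeq: "x i = x j \<longleftrightarrow> i mod L = j mod L" for i j using x unfolding cyclic_list_def by blast
  have xV: "x i \<in> verts C" for i using x unfolding cyclic_list_def by blast
  have xL: "x (Suc (2 * n)) = x 0" using L by (simp add: xeq)
  have "x0 (2 * n + 1) = x0 0" using x0 L unfolding cyclic_list_def by simp
  then have c0: "x 0 \<in> c" and c2n: "x (2 * n) \<in> c" using c(2) by (auto simp: x_def)
  note V = cyclic_list_verts[OF x L0]
  have fin: "finite (verts C)" using G by (simp add: simple_graph_def)
  have cov: "x k \<in> d \<or> x (Suc k) \<in> d" if "vertex_cover C d" for d k
  proof -
    have "{x k, x (Suc k)} \<inter> d \<noteq> {}"
      using cyclic_list_edgeI[OF x, of k] that unfolding vertex_cover_def by (metis (lifting))
    then show ?thesis by blast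
  qed
  define a where "a v = (if v \<in> c then int (m v) else - int (m v))" for v
  define F where "F i = (\<Sum>j\<in>{i..<L}. a (x j))" for i
  have Fstep: "F i = a (x i) + F (Suc i)" if "i < L" for i
    unfolding F_def using that by (simp add: sum.atLeast_Suc_lessThan)
  have FL: "F L = 0" by (simp add: F_def)
  have "F 0 = sum a (verts C)"
    unfolding F_def V(1) by (simp add: sum.reindex[OF V(2)] atLeast0LessThan)
  also have "\<dots> = sum a c + sum a (verts C - c)"
    using sum.subset_diff[of c "verts C" a] c(1) fin unfolding vertex_cover_def
    by (metis (lifting) add.commute)
  also have "sum a c = int t" unfolding c(3)[symmetric] by (simp add: a_def)
  also have "sum a (verts C - c) = - int (sum m (verts C - c))"
    unfolding of_nat_sum sum_negf[symmetric] by (intro sum.cong) (auto simp: a_def)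
  also have "int (sum m (verts C - c)) = int (sum m (verts C)) - int t"
    using sum.subset_diff[of c "verts C" m] c(1,3) fin by (simp add: vertex_cover_def)
  \<comment> \<open>\<open>F 0\<close> is t minus the weight of the complement of \<open>c\<close>,
    that is 2t - m(C).\<close>
  finally have F0: "F 0 < 0" using M by linarith
  let ?P = "\<lambda>i. i < L \<and> x i \<in> c \<and> F i \<le> 0"
  define i where "i = Max {i. ?P i}"
  have finP: "finite {i. ?P i}" by (rule finite_subset[of _ "{..<L}"]) auto
  have "0 \<in> {i. ?P i}" using c0 F0 L0 by simp
  then have "i \<in> {i. ?P i}" unfolding i_def using finP by (intro Max_in) auto
  then have i: "i < L" "x i \<in> c" "F i \<le> 0" by auto
  have imax: "\<not> ?P j" if "i < j" for j
  proof
    assume "?P j"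
    then have "j \<in> {i. ?P i}" by (rule CollectI)
    from Max_ge[OF finP this] that show False unfolding i_def[symmetric] by simp
  qed
  have Fi1: "F (Suc i) < 0"
    using Fstep[OF i(1)] i(2,3) pos[OF xV[of i]] by (simp add: a_def)
  have i2n: "i < 2 * n"
  proof (rule ccontr)
    assume "\<not> i < 2 * n"
    then have "Suc i = L" using i(1) L by simp
    then show False using Fi1 FL by simp
  qed
  have xi1: "x (Suc i) \<notin> c" using imax[of "Suc i"] Fi1 i2n L by auto
  obtain c' where c': "vertex_cover C c'" "{x i, x (Suc i)} \<subseteq> c'" "sum m c' = t"
    using tight[OF cyclic_list_edgeI[OF x, of i]] by auto
  let ?Q = "\<lambda>q. Suc i \<le> q \<and> q < L \<and> (\<forall>k\<in>{Suc i..q}. x k \<in> c' \<longleftrightarrow> x k \<notin> c)"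
  define q where "q = Max {q. ?Q q}"
  have finQ: "finite {q. ?Q q}" by (rule finite_subset[of _ "{..<L}"]) auto
  have "Suc i \<in> {q. ?Q q}" using xi1 c'(2) i2n L by auto
  then have "q \<in> {q. ?Q q}" unfolding q_def using finQ by (intro Max_in) auto
  then have q: "Suc i \<le> q" "q < L" and dis: "\<And>k. Suc i \<le> k \<Longrightarrow> k \<le> q \<Longrightarrow> x k \<in> c' \<longleftrightarrow> x k \<notin> c"
    by auto
  have agree: "x (Suc q) \<in> c' \<longleftrightarrow> x (Suc q) \<in> c" if "Suc q < L"
  proof (rule ccontr)
    assume "\<not> ?thesis"
    then have "Suc q \<in> {q. ?Q q}" using q dis that by (auto simp: le_Suc_eq)
    from Max_ge[OF finQ this] show False unfolding q_def[symmetric] by simp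
  qed
  define T where "T = x ` {Suc i..q}"
  have T: "x k \<in> T \<longleftrightarrow> Suc i \<le> k \<and> k \<le> q" if "k < L" for k
    unfolding T_def using that q by (auto simp: xeq)
  have Tdis: "v \<in> c' \<longleftrightarrow> v \<notin> c" if "v \<in> T" for v using that dis by (auto simp: T_def)
  let ?d = "(c' - T) \<union> (c \<inter> T)"
  have "vertex_cover C ?d"
    unfolding vertex_cover_def
  proof (intro conjI ballI)
    show "?d \<subseteq> verts C" using c(1) c'(1) by (auto simp: vertex_cover_def)
    fix e assume "e \<in> edges C"
    then obtain r where r: "r < L" "e = {x r, x (Suc r)}" using cyclic_list_edge[OF x L0] by blast
    have x0T: "x 0 \<notin> T" using T[OF L0] by simp
    \<comment> \<open>Only the edges at the ends of the stretch mix the two covers. On the left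
      \<open>x i\<close> lies in \<open>c'\<close>; on the right the covers agree, unless the
      stretch ends at the seam, where \<open>x (2 * n)\<close> lies in \<open>c\<close>.\<close>
    consider "r = i" | "Suc i \<le> r" "r < q" | "r = q" "Suc q < L" | "r = q" "Suc q = L"
      | "r < i" | "r > q" using r(1) q by linarith
    then have "x r \<in> ?d \<or> x (Suc r) \<in> ?d"
    proof cases
      case 1 then show ?thesis using c'(2) T[OF i(1)] by auto
    next
      case 2
      then have "x r \<in> T" "x (Suc r) \<in> T" using T[of r] T[of "Suc r"] r(1) q by auto
      then show ?thesis using cov[OF c(1), of r] by blast
    next
      case 3
      then have "x r \<in> T" "x (Suc r) \<notin> T" using T[of r] T[of "Suc r"] q by auto
      then show ?thesis using cov[OF c(1), of r] agree 3 by blast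
    next
      case 4
      then have "q = 2 * n" "x r \<in> T" using L q T[of r] by auto
      then show ?thesis using c2n 4 by blast
    next
      case 5
      then have "x r \<notin> T" "x (Suc r) \<notin> T" using T[of r] T[of "Suc r"] i(1) by auto
      then show ?thesis using cov[OF c'(1), of r] by blast
    next
      case 6
      have "x (Suc r) \<notin> T"
      proof (cases "Suc r < L")
        case False
        then have "Suc r = Suc (2 * n)" using r(1) L by simp
        then show ?thesis using x0T xL by metis
      qed (use 6 T in auto)
      moreover have "x r \<notin> T" using 6 T[OF r(1)] by auto
      ultimately show ?thesis using cov[OF c'(1), of r] by blast
    qed
    then show "e \<inter> ?d \<noteq> {}" using r(2) by blast
  qed
  then have "t \<le> sum m ?d" by (rule t)
  also have "sum m ?d = sum m (c' - T) + sum m (c \<inter> T)"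
    using vertex_cover_finite[OF G] c(1) c'(1) by (intro sum.union_disjoint) auto
  also have "t = sum m (c' \<inter> T) + sum m (c' - T)"
    unfolding c'(3)[symmetric] using vertex_cover_finite[OF G c'(1)] by (rule sum.Int_Diff)
  finally have le: "sum m (c' \<inter> T) \<le> sum m (c \<inter> T)" by simp
  have fT: "finite T" by (simp add: T_def)
  have "F (Suc i) = (\<Sum>j\<in>{Suc i..q}. a (x j)) + F (Suc q)"
    unfolding F_def using q sum.atLeastLessThan_concat[of "Suc i" "Suc q" L "\<lambda>j. a (x j)"]
    by (simp add: atLeastLessThanSuc_atLeastAtMost)
  also have "(\<Sum>j\<in>{Suc i..q}. a (x j)) = sum a T"
    unfolding T_def using q by (subst sum.reindex) (auto intro: inj_on_subset[OF V(2)])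
  also have "sum a T = sum a (T \<inter> c) + sum a (T - c)" using fT by (rule sum.Int_Diff)
  also have "T - c = c' \<inter> T" using Tdis by blast
  also have "sum a (T \<inter> c) = int (sum m (c \<inter> T))"
    by (simp add: a_def Int_commute)
  also have "sum a (c' \<inter> T) = - int (sum m (c' \<inter> T))"
    unfolding of_nat_sum sum_negf[symmetric] using Tdis by (intro sum.cong) (auto simp: a_def)
  \<comment> \<open>As \<open>c'\<close> has minimum weight, the switch cannot lower it: on the
    stretch \<open>c\<close> is at least as heavy as \<open>c'\<close>, which there is its
    complement. So the stretch contributes a nonnegative amount to \<open>F (Suc i)\<close>, and the
    rest stays negative.\<close>
  finally have Fq: "F (Suc q) < 0" using le Fi1 by linarith
  show False
  proof (cases "Suc q = L")
    case True
    then show False using Fq FL by simp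
  next
    case False
    then have q': "Suc q < L" using q by simp
    \<comment> \<open>By the choice of \<open>i\<close> the vertex after the stretch is missing from
      \<open>c\<close>, hence from \<open>c'\<close>. Both covers then contain \<open>x q\<close>,
      although they differ there.\<close>
    have "x (Suc q) \<notin> c" using imax[of "Suc q"] q q' Fq by auto
    then have "x q \<in> c" "x q \<in> c'" using cov[OF c(1), of q] cov[OF c'(1), of q] agree[OF q'] by auto
    then show False using dis[of q] q by auto
  qed
qed

text \<open>\<open>x 0\<close> stays as an isolated vertex, so covers live on the same vertex set.
  The remaining edges form a path, coloured by the parity of the index.\<close>

lemma cycle_delete_vertex_bipartite:
  assumes x: "cyclic_list L x C" and L: "L > 0" and G: "simple_graph C"
  shows "bipartite_graph \<lparr>verts = verts C, edges = {e \<in> edges C. x 0 \<notin> e}\<rparr>"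
proof -
  let ?A = "x ` {i. i < L \<and> even i}" and ?B = "x ` {i. i < L \<and> odd i}"
  have "?A \<union> ?B = verts C" using cyclic_list_verts(1)[OF x L] by auto
  moreover have "?A \<inter> ?B = {}" using cyclic_list_verts(2)[OF x L] by (auto simp: inj_on_def)
  moreover have "\<exists>a\<in>?A. \<exists>b\<in>?B. e = {a, b}" if e: "e \<in> edges C" "x 0 \<notin> e" for e
  proof -
    obtain r where r: "r < L" "e = {x r, x (Suc r)}" using cyclic_list_edge[OF x L e(1)] .
    have "Suc r < L"
    proof (rule ccontr)
      assume "\<not> Suc r < L"
      then have "Suc r = L" using r by simp
      then have "x (Suc r) = x 0" using x by (simp add: cyclic_list_def)
      then show False using e r by simp
    qed
    then show ?thesis
    proof (cases "even r")
      case True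
      then show ?thesis using r \<open>Suc r < L\<close> by (intro bexI[of _ "x r"] bexI[of _ "x (Suc r)"]) auto
    next
      case False
      then show ?thesis using r \<open>Suc r < L\<close> by (intro bexI[of _ "x (Suc r)"] bexI[of _ "x r"]) auto
    qed
  qed
  ultimately show ?thesis
    using G unfolding bipartite_graph_def simple_graph_def
    by (intro conjI exI[of _ ?A] exI[of _ ?B]) auto
qed

text \<open>A vertex of weight 0 joins any cover at no cost, so its edges may be deleted and the
  bipartite case applies. Otherwise the total weight is either small enough for the explicit packing
  or large enough for an edge to be split off.\<close>

lemma dual_odd_cycle:
  assumes "cycle_graph (2 * n + 1) C"
  shows "weighted_duality C (edge_items C \<union> {(verts C, n + 1)})"
proof -
  let ?L = "2 * n + 1" and ?X = "edge_items C \<union> {(verts C, n + 1)}"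
  have G: "simple_graph C" using cycle_simple_graph[OF assms] .
  have n: "n \<ge> 1" using assms by (simp add: cycle_graph_def)
  obtain x where x: "cyclic_list ?L x C" using cycle_graph_cyclic_list[OF assms] .
  have "packs ?X m t" if "\<And>c. vertex_cover C c \<Longrightarrow> t \<le> sum m c" for m t
    using that
  proof (induction t arbitrary: m)
    case 0
    show ?case by (rule packs.base)
  next
    case (Suc t)
    consider v where "v \<in> verts C" "m v = 0" | "sum m (verts C) \<le> 2 * Suc t"
      | "2 * Suc t < sum m (verts C)" "\<And>v. v \<in> verts C \<Longrightarrow> 0 < m v"
      by (meson gr0I not_le)
    then show ?case
    proof cases
      case 1
      obtain k where k: "v = x k" using 1 x by (auto simp: cyclic_list_def)
      let ?H = "\<lparr>verts = verts C, edges = {e \<in> edges C. v \<notin> e}\<rparr>"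
      have H: "bipartite_graph ?H"
        using cycle_delete_vertex_bipartite[OF cyclic_list_shift[OF x, of k] _ G] k by simp
      have "Suc t \<le> sum m c" if "vertex_cover ?H c" for c
      proof -
        have fc: "finite c" using vertex_cover_finite[OF _ that] H by (simp add: bipartite_graph_def)
        have "vertex_cover C (insert v c)" using that 1(1) by (auto simp: vertex_cover_def)
        from Suc.prems[OF this] show ?thesis using 1(2) fc by (simp add: sum.insert_if split: if_splits)
      qed
      then have "packs (edge_items ?H) m (Suc t)" using dual_bipartite[OF H] unfolding weighted_duality_def by blast
      then show ?thesis by (rule packs_mono) (auto simp: edge_items_def)
    next
      case 2
      then show ?thesis using odd_cycle_heavy_covers[OF x refl Suc.prems] by simp
    next
      case 3
      obtain e where e: "e \<in> edges C" "\<And>c. vertex_cover C c \<Longrightarrow> e \<subseteq> c \<Longrightarrow> sum m c \<noteq> Suc t"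
        using odd_cycle_good_edge[OF x refl n G Suc.prems 3] by blast
      have pos: "0 < m v" if "v \<in> e" for v using 3(2) e(1) G that by (auto simp: simple_graph_def)
      have "packs ?X (\<lambda>v. m v - of_bool (v \<in> e)) t"
        using edge_subtract_covers[OF G e(1) pos Suc.prems e(2)] by (intro Suc.IH) auto
      then show ?thesis using packs_edge_step[of ?X m e t] e(1) pos by (simp add: edge_items_def)
    qed
  qed
  then show ?thesis unfolding weighted_duality_def by blast
qed

section \<open>Trading the odd cycles of a packing for edges\<close>

lemma sum_of_bool_subset:
  assumes "finite V" "S \<subseteq> V"
  shows "(\<Sum>v\<in>V. m v + of_bool (v \<in> S)) = sum m V + card S"
proof -
  have "V \<inter> S = S" using assms by blast
  then show ?thesis using assms(1) by (simp add: sum.distrib)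
qed

text \<open>Edges of total value t need only 2t units of weight, so at least one unit is left
  over.\<close>

lemma packs_leftover:
  assumes G: "simple_graph G" and p: "packs (edge_items G) m t" "2 * t < sum m (verts G)"
  shows "\<exists>y\<in>verts G. 0 < m y \<and> packs (edge_items G) (m(y := m y - 1)) t"
  using p
proof (induction rule: packs.induct)
  case (base m)
  then obtain y where "y \<in> verts G" "0 < m y" by (metis gr0I less_irrefl mult_0_right sum.neutral)
  then show ?case using packs.base by blast
next
  case (item m t S k t')
  have S: "S \<subseteq> verts G" "card S = 2" and k: "k = 1"
    using item.hyps(2) G by (auto simp: edge_items_def simple_graph_def)
  have fin: "finite (verts G)" using G by (simp add: simple_graph_def)
  have sm: "(\<Sum>v\<in>verts G. m v + of_bool (v \<in> S)) = sum m (verts G) + 2"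
    using sum_of_bool_subset[OF fin S(1)] S(2) by simp
  show ?case
  proof (cases "2 * t < sum m (verts G)")
    case True
    then obtain y where y: "y \<in> verts G" "0 < m y" "packs (edge_items G) (m(y := m y - 1)) t"
      using item.IH by blast
    have "(\<lambda>x. (m(y := m y - 1)) x + of_bool (x \<in> S)) =
        (\<lambda>x. m x + of_bool (x \<in> S))(y := m y + of_bool (y \<in> S) - 1)"
      using y(2) by (auto simp: fun_eq_iff)
    with packs.item[OF y(3) item.hyps(2,3)] have P: "packs (edge_items G)
        ((\<lambda>x. m x + of_bool (x \<in> S))(y := m y + of_bool (y \<in> S) - 1)) t'" by metis
    have "0 < m y + of_bool (y \<in> S)" using y(2) by simp
    with P y(1) show ?thesis by (rule_tac bexI[of _ y], rule_tac conjI)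
  next
    case False
    \<comment> \<open>The weight before the last edge is at most 2t, which forces
      \<open>t' \<le> t\<close>: the last edge only adds slack, and either end of it is
      spare.\<close>
    then have "t' \<le> t" using sm item.prems item.hyps(3) k by linarith
    then have "packs (edge_items G) m t'" using item.hyps(1) by (rule packs_le[rotated])
    moreover obtain y where y: "y \<in> S" using S(2) by fastforce
    ultimately show ?thesis using S(1)
      by (intro bexI[of _ y]) (auto elim!: packs_mono_weight)
  qed
qed

text \<open>Without \<open>x 0\<close> the cycle is a path on 2n vertices, and every second edge of
  the path gives a perfect matching.\<close>

lemma odd_cycle_minus_vertex_matching:
  assumes x: "cyclic_list L x C" and L: "L = 2 * n + 1" and E: "edges C \<subseteq> edges G"
  shows "packs (edge_items G) (\<lambda>v. of_bool (v \<in> verts C - {x 0})) n"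
proof -
  have L0: "L > 0" using L by simp
  let ?S = "\<lambda>j. {x (2 * j + 1), x (2 * j + 2)}"
  have inj: "x i = x j \<longleftrightarrow> i = j" if "i < L" "j < L" for i j
    using x that unfolding cyclic_list_def by simp
  have "packs (edge_items G) (\<lambda>v. \<Sum>j<n. 1 * of_bool (v \<in> ?S j)) (\<Sum>j<n. 1 * 1)"
    using cyclic_list_edgeI[OF x] E by (intro packs_sum) (auto simp: edge_items_def)
  moreover have "(\<Sum>j<n. 1 * of_bool (v \<in> ?S j)) \<le> (of_bool (v \<in> verts C - {x 0}) :: nat)" for v
  proof (cases "\<exists>j<n. v \<in> ?S j")
    case True
    then obtain j where j: "j < n" "v \<in> ?S j" by blast
    have "v \<in> verts C" using j x by (auto simp: cyclic_list_def)
    moreover have "v \<noteq> x 0" using j L inj by auto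
    moreover have u: "i = j" if "i < n" "v \<in> ?S i" for i
      using j that L inj by auto
    have "1 * of_bool (v \<in> ?S i) = (if i = j then 1 else (0::nat))" if "i < n" for i
      using u[OF that] j(2) by (cases "i = j") (simp_all only: of_bool_def mult_1, simp_all, blast?)
    then have "(\<Sum>j<n. 1 * of_bool (v \<in> ?S j)) = (\<Sum>i<n. if i = j then 1 else (0::nat))"
      by (intro sum.cong) auto
    ultimately show ?thesis using j(1) by simp
  next
    case False
    then show ?thesis by simp
  qed
  ultimately show ?thesis using packs_mono_weight[of "edge_items G" _ n] by force
qed

lemma packs_cycles_to_edges:
  assumes G: "simple_graph G"
    and Cs: "\<And>C. C \<in> Cs \<Longrightarrow> cycle_graph (2 * n + 1) C \<and> edges C \<subseteq> edges G \<and> verts C \<subseteq> verts G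
      \<and> graph_nbhd G C = verts G"
    and p: "packs (edge_items G \<union> {(verts C, n + 1) | C. C \<in> Cs}) m t" "s \<le> t" "2 * s \<le> sum m (verts G)"
  shows "packs (edge_items G) m s"
  using p
proof (induction arbitrary: s rule: packs.induct)
  case (base m)
  then show ?case using packs.base by simp
next
  case (item m t S k t')
  have fin: "finite (verts G)" using G by (simp add: simple_graph_def)
  consider (edge) "S \<in> edges G" "k = 1" | (cyc) C where "C \<in> Cs" "S = verts C" "k = n + 1"
    using item.hyps(2) by (auto simp: edge_items_def)
  then show ?case
  proof cases
    case edge
    show ?thesis
    proof (cases s)
      case 0
      then show ?thesis using packs.base by simp
    next
      case (Suc s0)
      have "S \<subseteq> verts G" "card S = 2" using edge G by (auto simp: simple_graph_def)
      from sum_of_bool_subset[OF fin this(1), of m] this(2)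
      have "packs (edge_items G) m s0" using item.prems item.hyps(3) Suc edge by (intro item.IH) auto
      from packs.item[OF this, of S 1 s] show ?thesis using edge Suc by (simp add: edge_items_def)
    qed
  next
    case cyc
    note C = Cs[OF cyc(1)]
    obtain x where x: "cyclic_list (2 * n + 1) x C" using cycle_graph_cyclic_list C by blast
    have "card (verts C) = 2 * n + 1"
      using cyclic_list_verts[OF x] by (simp add: card_image)
    then have sm: "(\<Sum>v\<in>verts G. m v + of_bool (v \<in> S)) = sum m (verts G) + (2 * n + 1)"
      using sum_of_bool_subset[OF fin, of S m] C cyc(2) by simp
    have match: "packs (edge_items G) (\<lambda>v. of_bool (v \<in> verts C - {x k})) n" for k
      using odd_cycle_minus_vertex_matching[OF cyclic_list_shift[OF x, of k]] C by simp
    show ?thesis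
    proof (cases "s \<le> n")
      case True
      show ?thesis using packs_le[OF match[of 0] True] cyc(2)
        by (elim packs_mono_weight) auto
    next
      case False
      define s0 where "s0 = s - (n + 1)"
      have s: "s = s0 + (n + 1)" using False by (simp add: s0_def)
      \<comment> \<open>The inequality becomes strict because n + 1 edges account for 2n + 2 units
        and the cycle removes only 2n + 1. This is the spare unit found at \<open>y\<close>.\<close>
      have s0: "s0 \<le> t" "2 * s0 < sum m (verts G)"
        using item.prems item.hyps(3) cyc(3) sm s by auto
      have "packs (edge_items G) m s0" using s0 by (intro item.IH) auto
      then obtain y where y: "y \<in> verts G" "0 < m y" "packs (edge_items G) (m(y := m y - 1)) s0"
        using packs_leftover[OF G _ s0(2)] by blast
      have "y \<in> graph_nbhd G C" using C y(1) by blast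
      then obtain z where z: "z \<in> verts C" "{z, y} \<in> edges G"
        by (auto simp: graph_nbhd_def neighbors_def)
      then obtain k where k: "z = x k" using x by (auto simp: cyclic_list_def)
      have zy: "z \<noteq> y" using z(2) G by (auto simp: simple_graph_def)
      have "packs (edge_items G) (\<lambda>v. of_bool (v \<in> verts C - {x k}) + of_bool (v \<in> {z, y})) (n + 1)"
        using packs.item[OF match, of "{z, y}" 1 "n + 1"] z(2) by (simp add: edge_items_def)
      from packs_add[OF y(3) this]
      have "packs (edge_items G) (\<lambda>v. (m(y := m y - 1)) v +
          (of_bool (v \<in> verts C - {x k}) + of_bool (v \<in> {z, y}))) s" using s by simp
      then show ?thesis
        by (rule packs_mono_weight) (use y(2) k z(1) zy cyc(2) in \<open>auto simp: of_bool_def\<close>)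
    qed
  qed
qed

lemma clique_sum_list_dual:
  assumes Cs: "\<forall>C\<in>set Cs. cycle_graph (2 * n + 1) C" and G': "clique_sum_list Cs G'"
    and Bs: "\<forall>B\<in>set Bs. bipartite_graph B" and G: "clique_sum_list (G' # Bs) G"
  shows "simple_graph G"
    and "C \<in> set Cs \<Longrightarrow> verts C \<subseteq> verts G \<and> edges C \<subseteq> edges G"
    and "weighted_duality G (edge_items G \<union> {(verts C, n + 1) | C. C \<in> set Cs})"
proof -
  define X where "X C = edge_items C \<union> {(verts C, n + 1)}" for C :: "'a sgraph"
  have *: "simple_graph G' \<and> weighted_duality G' (\<Union>H\<in>set Cs. X H) \<and>
      (\<forall>H\<in>set Cs. verts H \<subseteq> verts G' \<and> edges H \<subseteq> edges G')"
    using dual_clique_sum_list[OF G', of X] Cs cycle_simple_graph dual_odd_cycle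
    unfolding X_def by blast
  \<comment> \<open>Items are to be a function of the summand. Attaching the cycle items to every
    summand lets the head \<open>G'\<close> be treated like the bipartite graphs.\<close>
  define Y where "Y H = edge_items H \<union> {(verts C, n + 1) | C. C \<in> set Cs}" for H :: "'a sgraph"
  have sub: "(\<Union>H\<in>set Cs. X H) \<subseteq> Y G'" using * by (auto simp: X_def Y_def edge_items_def)
  have dm: "weighted_duality H A \<Longrightarrow> A \<subseteq> B \<Longrightarrow> weighted_duality H B" for H :: "'a sgraph" and A B
    unfolding weighted_duality_def using packs_mono by blast
  have "simple_graph H \<and> weighted_duality H (Y H)" if "H \<in> set (G' # Bs)" for H
  proof (cases "H = G'")
    case True
    then show ?thesis using * sub dm by blast
  next
    case False
    then have "bipartite_graph H" using that Bs by simp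
    moreover have "edge_items H \<subseteq> Y H" by (simp add: Y_def)
    moreover have "simple_graph H" using calculation(1) by (simp add: bipartite_graph_def)
    ultimately show ?thesis using dm[OF dual_bipartite] by blast
  qed
  from dual_clique_sum_list[OF G this]
  have **: "simple_graph G" "weighted_duality G (\<Union>H\<in>set (G' # Bs). Y H)"
    "\<forall>H\<in>set (G' # Bs). verts H \<subseteq> verts G \<and> edges H \<subseteq> edges G" by auto
  show "simple_graph G" by (rule **(1))
  show "C \<in> set Cs \<Longrightarrow> verts C \<subseteq> verts G \<and> edges C \<subseteq> edges G"
    using * **(3) by (meson list.set_intros(1) order_trans)
  have "(\<Union>H\<in>set (G' # Bs). Y H) \<subseteq> Y G" using **(3) by (fastforce simp: Y_def edge_items_def)
  with **(2) show "weighted_duality G (edge_items G \<union> {(verts C, n + 1) | C. C \<in> set Cs})"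
    unfolding Y_def[of G, symmetric] by (rule dm)
qed

lemma cover_weight_packs_edges:
  assumes Cs: "\<forall>C\<in>set Cs. cycle_graph (2 * n + 1) C" and G': "clique_sum_list Cs G'"
    and Bs: "\<forall>B\<in>set Bs. bipartite_graph B" and G: "clique_sum_list (G' # Bs) G"
    and nb: "\<forall>C\<in>set Cs. graph_nbhd G C = verts G"
    and s: "\<And>c. vertex_cover G c \<Longrightarrow> s \<le> sum m c" "2 * s \<le> sum m (verts G)"
  shows "packs (edge_items G) m s"
proof -
  note d = clique_sum_list_dual[OF Cs G' Bs G]
  have "packs (edge_items G \<union> {(verts C, n + 1) | C. C \<in> set Cs}) m s"
    using d(3) s(1) unfolding weighted_duality_def by blast
  then show ?thesis
    using d(2) Cs nb s(2) by (intro packs_cycles_to_edges[OF d(1), of "set Cs" n m s]) auto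
qed

section \<open>Monomial ideals\<close>

abbreviation "keys \<equiv> Poly_Mapping.keys"
abbreviation "lookup \<equiv> Poly_Mapping.lookup"
abbreviation "single \<equiv> Poly_Mapping.single"

lemma poly_ring_simps [simp]:
  "monoid.mult (poly_ring V) = (*)" "ring.add (poly_ring V) = (+)" "monoid.one (poly_ring V) = 1" "ring.zero (poly_ring V) = 0"
  by (simp_all add: poly_ring_def)

text \<open>The span of the monomials in the variables \<open>V\<close> whose exponents satisfy
  \<open>A\<close>. Upward closure of \<open>A\<close> is what makes it an ideal and enters as a
  hypothesis where that is claimed.\<close>

definition mon_ideal :: "'v set \<Rightarrow> (('v \<Rightarrow>\<^sub>0 nat) \<Rightarrow> bool) \<Rightarrow> ('v, 'k::field) mpoly set" where
  "mon_ideal V A = {p. \<forall>m\<in>keys p. keys m \<subseteq> V \<and> A m}"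

lemma carrier_poly_ring: "carrier (poly_ring V) = mon_ideal V (\<lambda>_. True)"
  by (simp add: poly_ring_def mon_ideal_def)

lemma mon_ideal_mono: "(\<And>m. A m \<Longrightarrow> B m) \<Longrightarrow> mon_ideal V A \<subseteq> mon_ideal V B"
  by (auto simp: mon_ideal_def)

lemma mon_ideal_cong: "(\<And>m. keys m \<subseteq> V \<Longrightarrow> A m = B m) \<Longrightarrow> mon_ideal V A = mon_ideal V B"
  by (auto simp: mon_ideal_def)

lemma mon_ideal_carrier: "mon_ideal V A \<subseteq> carrier (poly_ring V)"
  unfolding carrier_poly_ring by (rule mon_ideal_mono) simp

lemma keys_add_nat: "keys (a + b :: 'v \<Rightarrow>\<^sub>0 nat) = keys a \<union> keys b"
  by (auto simp: in_keys_iff lookup_add)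

lemma mon_ideal_0: "0 \<in> mon_ideal V A"
  by (simp add: mon_ideal_def)

lemma mon_ideal_add: "p \<in> mon_ideal V A \<Longrightarrow> q \<in> mon_ideal V A \<Longrightarrow> p + q \<in> mon_ideal V A"
  using Poly_Mapping.keys_add[of p q] by (auto simp: mon_ideal_def)

lemma mon_ideal_uminus: "p \<in> mon_ideal V A \<Longrightarrow> - p \<in> mon_ideal V A"
  by (auto simp: mon_ideal_def in_keys_iff)

lemma mon_ideal_mult:
  assumes "p \<in> mon_ideal V A" "q \<in> mon_ideal V B"
  shows "p * q \<in> mon_ideal V (\<lambda>m. \<exists>a b. m = a + b \<and> A a \<and> B b)"
proof -
  have "keys m \<subseteq> V \<and> (\<exists>a b. m = a + b \<and> A a \<and> B b)" if "m \<in> keys (p * q)" for m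
  proof -
    obtain a b where "m = a + b" "a \<in> keys p" "b \<in> keys q"
      using keys_mult[of p q] \<open>m \<in> _\<close> by blast
    then show ?thesis using assms by (fastforce simp: mon_ideal_def keys_add_nat)
  qed
  then show ?thesis by (simp add: mon_ideal_def)
qed

lemma mon_ideal_single: "keys m \<subseteq> V \<Longrightarrow> A m \<Longrightarrow> single m c \<in> mon_ideal V A"
  by (auto simp: mon_ideal_def)

lemma poly_eq_sum_single:
  "p = (\<Sum>m\<in>keys p. single m (lookup p m))"
proof (rule poly_mapping_eqI)
  fix n
  have "(\<Sum>m\<in>keys p. lookup (single m (lookup p m)) n)
      = (\<Sum>m\<in>keys p. if m = n then lookup p n else 0)"
    by (intro sum.cong) (auto simp: lookup_single when_def)
  then show "lookup p n =
      lookup (\<Sum>m\<in>keys p. single m (lookup p m)) n"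
    by (simp add: lookup_sum in_keys_iff)
qed

lemma sum_closed:
  assumes "(0::'a::comm_monoid_add) \<in> J" "\<And>p q. p \<in> J \<Longrightarrow> q \<in> J \<Longrightarrow> p + q \<in> J" "\<And>i. i \<in> S \<Longrightarrow> f i \<in> J"
  shows "sum f S \<in> J"
  using assms by (induction S rule: infinite_finite_induct) auto

lemma mon_ideal_subsetI:
  fixes J :: "('a, 'b::field) mpoly set"
  assumes "0 \<in> J" "\<And>p q. p \<in> J \<Longrightarrow> q \<in> J \<Longrightarrow> p + q \<in> J"
    and "\<And>m c. keys m \<subseteq> V \<Longrightarrow> A m \<Longrightarrow> single m c \<in> J"
  shows "mon_ideal V A \<subseteq> J"
proof
  fix p :: "('a, 'b) mpoly" assume p: "p \<in> mon_ideal V A"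
  have "(\<Sum>m\<in>keys p. single m (lookup p m)) \<in> J"
    using p by (intro sum_closed assms) (auto simp: mon_ideal_def)
  then show "p \<in> J" using poly_eq_sum_single[of p] by simp
qed

lemma ideal_mon_ideal:
  assumes "\<And>m n. A m \<Longrightarrow> A (m + n)"
  shows "ideal (mon_ideal V A) (poly_ring V :: ('v, 'k::field) mpoly ring)"
proof -
  interpret R: cring "poly_ring V :: ('v, 'k) mpoly ring" by (rule cring_poly_ring)
  let ?R = "poly_ring V :: ('v, 'k) mpoly ring"
  have sub: "mon_ideal V A \<subseteq> carrier ?R" by (rule mon_ideal_carrier)
  have inv: "inv\<^bsub>add_monoid ?R\<^esub> x = - x" if "x \<in> mon_ideal V A" for x
  proof -
    have "- x \<in> carrier ?R" using mon_ideal_uminus[OF that] sub by blast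
    then have "\<ominus>\<^bsub>?R\<^esub> x = - x" using R.minus_equality[of "- x" x] that sub by auto
    then show ?thesis by (simp add: a_inv_def)
  qed
  show ?thesis
  proof (rule idealI)
    show "subgroup (mon_ideal V A) (add_monoid ?R)"
    proof (rule subgroup.intro)
      fix x :: "('v, 'k) mpoly" assume "x \<in> mon_ideal V A"
      then show "inv\<^bsub>add_monoid ?R\<^esub> x \<in> mon_ideal V A" using inv mon_ideal_uminus by metis
    qed (use sub in \<open>auto simp: mon_ideal_0 mon_ideal_add\<close>)
  next
    fix a x :: "('v, 'k) mpoly" assume a: "a \<in> mon_ideal V A" and x: "x \<in> carrier ?R"
    have "a * x \<in> mon_ideal V (\<lambda>m. \<exists>a b. m = a + b \<and> A a \<and> True)"
      using mon_ideal_mult[OF a x[unfolded carrier_poly_ring]] .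
    also have "\<dots> \<subseteq> mon_ideal V A" by (rule mon_ideal_mono) (use assms in auto)
    finally show "a \<otimes>\<^bsub>?R\<^esub> x \<in> mon_ideal V A" "x \<otimes>\<^bsub>?R\<^esub> a \<in> mon_ideal V A" by (simp_all add: mult.commute)
  qed (rule R.ring_axioms)
qed

lemma ideal_prod_mon_ideal:
  "ideal_prod (poly_ring V) (mon_ideal V A) (mon_ideal V B) =
    (mon_ideal V (\<lambda>m. \<exists>a b. m = a + b \<and> A a \<and> B b) :: ('v, 'k::field) mpoly set)" (is "?L = ?R")
proof
  show "?L \<subseteq> ?R"
  proof
    fix p assume "p \<in> ?L"
    then show "p \<in> ?R"
      by (induction rule: ideal_prod.induct) (auto intro: mon_ideal_mult mon_ideal_add)
  qed
  show "?R \<subseteq> ?L"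
  proof (rule mon_ideal_subsetI)
    show "0 \<in> ?L" using ideal_prod.prod[OF mon_ideal_0 mon_ideal_0, of "poly_ring V"] by simp
    show "p + q \<in> ?L" if "p \<in> ?L" "q \<in> ?L" for p q using ideal_prod.sum[OF that] by simp
    fix m :: "'v \<Rightarrow>\<^sub>0 nat" and c :: 'k
    assume m: "keys m \<subseteq> V" "\<exists>a b. m = a + b \<and> A a \<and> B b"
    then obtain a b where ab: "m = a + b" "A a" "B b" by blast
    then have "single a c \<otimes>\<^bsub>poly_ring V\<^esub> single b 1 \<in> ?L"
      using m(1) by (intro ideal_prod.prod mon_ideal_single) (auto simp: keys_add_nat)
    then show "single m c \<in> ?L" by (simp add: mult_single ab)
  qed
qed

text \<open>These are the exponents in the s-th power: s exponents satisfying \<open>A\<close> and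
  an arbitrary remainder. The remainder comes from the case 0, the 0-th power being the whole
  ring.\<close>

primrec sum_power :: "(('v \<Rightarrow>\<^sub>0 nat) \<Rightarrow> bool) \<Rightarrow> nat \<Rightarrow> ('v \<Rightarrow>\<^sub>0 nat) \<Rightarrow> bool" where
  "sum_power A 0 = (\<lambda>_. True)"
| "sum_power A (Suc s) = (\<lambda>m. \<exists>a b. m = a + b \<and> sum_power A s a \<and> A b)"

lemma ideal_power_mon_ideal:
  "ideal_power (poly_ring V) (mon_ideal V A) s = (mon_ideal V (sum_power A s) :: ('v, 'k::field) mpoly set)"
proof (induction s)
  case 0
  show ?case by (simp add: ideal_power_def nat_pow_def ideals_set_def carrier_poly_ring)
next
  case (Suc s)
  have "ideal_power (poly_ring V) (mon_ideal V A :: ('v, 'k) mpoly set) (Suc s) =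
      ideal_prod (poly_ring V) (ideal_power (poly_ring V) (mon_ideal V A) s) (mon_ideal V A)"
    by (simp add: ideal_power_def nat_pow_def ideals_set_def)
  then show ?case by (simp add: Suc ideal_prod_mon_ideal)
qed

lemma sum_power_add: "(\<And>m n. A m \<Longrightarrow> A (m + n)) \<Longrightarrow> sum_power A s m \<Longrightarrow> sum_power A s (m + n)"
  by (induction s arbitrary: m n) (auto, metis add.assoc)

lemma lookup_le_imp_add:
  fixes m n :: "'v \<Rightarrow>\<^sub>0 nat"
  assumes "\<And>v. lookup n v \<le> lookup m v"
  shows "m = n + (m - n)"
  using assms by (intro poly_mapping_eqI) (simp add: lookup_add lookup_minus)

section \<open>The edge ideal and its powers\<close>

lemma edge_pair_lookup:
  assumes "u \<noteq> v"
  shows "lookup (single u 1 + single v (1::nat)) x = of_bool (x \<in> {u, v})"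
  using assms by (auto simp: lookup_add lookup_single when_def)

text \<open>The generators are squarefree, so divisibility by the generator of an edge means that
  the edge lies in the support.\<close>

lemma edge_ideal_mon_ideal:
  assumes G: "simple_graph G"
  shows "(edge_ideal G :: ('v, 'k::field) mpoly set) =
    mon_ideal (verts G) (\<lambda>m. \<exists>e\<in>edges G. e \<subseteq> keys m)" (is "_ = mon_ideal ?V ?A")
proof
  let ?S = "{pvar u * pvar v | u v. {u, v} \<in> edges G} :: ('v, 'k) mpoly set"
  interpret R: cring "poly_ring ?V :: ('v, 'k) mpoly ring" by (rule cring_poly_ring)
  have pv: "pvar u * pvar v = (single (single u 1 + single v 1) 1 :: ('v, 'k) mpoly)" for u v
    by (simp add: pvar_def mult_single)
  have uv: "u \<noteq> v \<and> u \<in> ?V \<and> v \<in> ?V" if "{u, v} \<in> edges G" for u v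
    using G that by (auto simp: simple_graph_def)
  have S: "?S \<subseteq> mon_ideal ?V ?A"
  proof clarify
    fix u v assume e: "{u, v} \<in> edges G"
    show "pvar u * pvar v \<in> (mon_ideal ?V ?A :: ('v, 'k) mpoly set)"
      unfolding pv using uv[OF e] e
      by (intro mon_ideal_single bexI[of _ "{u, v}"]) (auto simp: keys_add_nat)
  qed
  have "ideal (mon_ideal ?V ?A) (poly_ring ?V :: ('v, 'k) mpoly ring)"
    by (rule ideal_mon_ideal) (auto simp: keys_add_nat)
  then show "edge_ideal G \<subseteq> (mon_ideal ?V ?A :: ('v, 'k) mpoly set)"
    unfolding edge_ideal_def using S by (rule R.genideal_minimal)
  have Sc: "?S \<subseteq> carrier (poly_ring ?V)" using S mon_ideal_carrier by blast
  interpret J: ideal "edge_ideal G :: ('v, 'k) mpoly set" "poly_ring ?V"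
    unfolding edge_ideal_def by (rule R.genideal_ideal[OF Sc])
  have SJ: "?S \<subseteq> edge_ideal G" unfolding edge_ideal_def by (rule R.genideal_self[OF Sc])
  show "mon_ideal ?V ?A \<subseteq> (edge_ideal G :: ('v, 'k) mpoly set)"
  proof (rule mon_ideal_subsetI)
    show "(0 :: ('v, 'k) mpoly) \<in> edge_ideal G" using J.zero_closed by simp
    show "p + q \<in> edge_ideal G" if "p \<in> edge_ideal G" "q \<in> edge_ideal G" for p q :: "('v, 'k) mpoly"
      using J.a_closed[OF that] by simp
    fix m :: "'v \<Rightarrow>\<^sub>0 nat" and c :: 'k
    assume m: "keys m \<subseteq> ?V" "?A m"
    then obtain e where e: "e \<in> edges G" "e \<subseteq> keys m" by blast
    then obtain u v where "e = {u, v}" using G by (auto simp: simple_graph_def card_2_iff)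
    note uve = uv[of u v] e this
    let ?n = "single u 1 + single v (1::nat)"
    have m_eq: "m = ?n + (m - ?n)"
    proof (rule lookup_le_imp_add)
      have "u \<noteq> v" using uve by simp
      then show "lookup ?n x \<le> lookup m x" for x
        using uve unfolding edge_pair_lookup[OF \<open>u \<noteq> v\<close>]
        by (auto simp: in_keys_iff of_bool_def Suc_le_eq)
    qed
    have "keys (m - ?n) \<subseteq> ?V"
      using m(1) keys_add_nat[of ?n "m - ?n"] m_eq by auto
    then have "single (m - ?n) c \<in> carrier (poly_ring ?V)"
      unfolding carrier_poly_ring by (rule mon_ideal_single) simp
    moreover have "pvar u * pvar v \<in> (edge_ideal G :: ('v, 'k) mpoly set)"
    proof (rule subsetD[OF SJ])
      have "{u, v} \<in> edges G" using uve by simp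
      then show "pvar u * pvar v \<in> ?S" by blast
    qed
    ultimately have "pvar u * pvar v * single (m - ?n) c \<in> edge_ideal G"
      using J.I_r_closed by fastforce
    then show "single m c \<in> edge_ideal G"
      unfolding pv mult_single m_eq[symmetric] by simp
  qed
qed

lemma sum_power_edges:
  assumes G: "simple_graph G"
  shows "sum_power (\<lambda>m. \<exists>e\<in>edges G. e \<subseteq> keys m) s m \<longleftrightarrow>
    packs (edge_items G) (lookup m) s" (is "sum_power ?A s m \<longleftrightarrow> _")
proof
  show "sum_power ?A s m \<Longrightarrow> packs (edge_items G) (lookup m) s"
  proof (induction s arbitrary: m)
    case 0
    show ?case by (rule packs.base)
  next
    case (Suc s)
    then obtain a b e where ab: "m = a + b" "sum_power ?A s a" "e \<in> edges G" "e \<subseteq> keys b" by auto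
    have "packs (edge_items G) (\<lambda>x. lookup a x + of_bool (x \<in> e)) (Suc s)"
      using packs.item[OF Suc.IH[OF ab(2)], of e 1] ab(3) by (simp add: edge_items_def)
    then show ?case
      by (rule packs_mono_weight) (use ab in \<open>auto simp: lookup_add of_bool_def in_keys_iff Suc_le_eq\<close>)
  qed
  \<comment> \<open>A packing may understate its value, so it must be possible to descend in the
    number of factors.\<close>
  have anti: "sum_power ?A s m" if "sum_power ?A t m" "s \<le> t" for s t m
  proof -
    have "sum_power ?A t m" if suc: "sum_power ?A (Suc t) m" for t m
    proof -
      obtain a b where "m = a + b" "sum_power ?A t a" using suc by auto
      moreover have "\<exists>e\<in>edges G. e \<subseteq> keys (m + n)"
        if "\<exists>e\<in>edges G. e \<subseteq> keys m" for m n :: "'a \<Rightarrow>\<^sub>0 nat"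
        using that unfolding keys_add_nat by blast
      ultimately show ?thesis using sum_power_add[of ?A t a b] by blast
    qed
    note down = this
    have "sum_power ?A (s + k) m \<longrightarrow> sum_power ?A s m" for k
    proof (induction k)
      case (Suc k)
      then show ?case using down[of "s + k" m] unfolding add_Suc_right by blast
    qed simp
    from this[of "t - s"] show ?thesis using that by simp
  qed
  \<comment> \<open>Weights in a packing are arbitrary functions while exponents have finite
    support; the induction therefore runs over all weights \<open>f\<close> below the exponent
    \<open>m\<close>.\<close>
  have "packs (edge_items G) f s \<Longrightarrow> (\<And>x. f x \<le> lookup m x) \<Longrightarrow> sum_power ?A s m" for f
  proof (induction arbitrary: m rule: packs.induct)
    case (base f)
    show ?case by simp
  next
    case (item f t S k t')
    have S: "S \<in> edges G" "k = 1" using item.hyps by (auto simp: edge_items_def)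
    then obtain u v where uv: "S = {u, v}" "u \<noteq> v" using G by (auto simp: simple_graph_def card_2_iff)
    let ?n = "single u 1 + single v (1::nat)"
    have le: "f x + lookup ?n x \<le> lookup m x" for x
      using item.prems[of x] unfolding edge_pair_lookup[OF uv(2)] uv(1) .
    have "m = ?n + (m - ?n)" using le by (intro lookup_le_imp_add) (metis add_leD2)
    then have "m = (m - ?n) + ?n" by (simp add: add.commute)
    moreover have "sum_power ?A t (m - ?n)"
    proof (rule item.IH)
      fix x show "f x \<le> lookup (m - ?n) x"
        using le[of x] unfolding lookup_minus by linarith
    qed
    moreover have "?A ?n" using S(1) uv by (auto simp: keys_add_nat)
    ultimately have "sum_power ?A (Suc t) m" unfolding sum_power.simps by blast
    then show ?case by (rule anti) (use item.hyps(3) S(2) in simp)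
  qed
  then show "packs (edge_items G) (lookup m) s \<Longrightarrow> sum_power ?A s m" by blast
qed

lemma ideal_power_edge_ideal:
  assumes G: "simple_graph G"
  shows "ideal_power (poly_ring (verts G)) (edge_ideal G) s =
    mon_ideal (verts G) (\<lambda>m. packs (edge_items G) (lookup m) s)"
  unfolding edge_ideal_mon_ideal[OF G] ideal_power_mon_ideal sum_power_edges[OF G] ..

text \<open>Each factor from the prime uses up one unit of the degree in the variables of
  \<open>c\<close>, and any such unit can be split off.\<close>

lemma sum_power_prime:
  assumes "finite c"
  shows "sum_power (\<lambda>m. keys m \<inter> c \<noteq> {}) s m \<longleftrightarrow> s \<le> sum (lookup m) c"
proof (induction s arbitrary: m)
  case 0
  show ?case by simp
next
  case (Suc s)
  show ?case
  proof
    assume "sum_power (\<lambda>m. keys m \<inter> c \<noteq> {}) (Suc s) m"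
    then obtain a b v where ab: "m = a + b" "s \<le> sum (lookup a) c"
      "v \<in> keys b" "v \<in> c" using Suc by auto
    have "0 < sum (lookup b) c"
      using ab assms by (intro sum_pos2[of c v]) (auto simp: in_keys_iff)
    then show "Suc s \<le> sum (lookup m) c" using ab by (simp add: lookup_add sum.distrib)
  next
    assume s: "Suc s \<le> sum (lookup m) c"
    then obtain v where v: "v \<in> c" "0 < lookup m v"
      by (metis Zero_not_Suc gr0I le_zero_eq sum.neutral)
    let ?n = "single v (1::nat)"
    have m: "m = ?n + (m - ?n)"
      using v by (intro lookup_le_imp_add) (auto simp: lookup_single when_def)
    have "sum (lookup m) c = sum (lookup ?n) c + sum (lookup (m - ?n)) c"
      by (subst m) (simp add: lookup_add sum.distrib)
    also have "sum (lookup ?n) c = (\<Sum>x\<in>c. if x = v then 1 else 0)"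
      by (intro sum.cong) (auto simp: lookup_single when_def)
    also have "\<dots> = 1" using v(1) assms by simp
    finally have "s \<le> sum (lookup (m - ?n)) c" using s by simp
    then have "sum_power (\<lambda>m. keys m \<inter> c \<noteq> {}) s (m - ?n)" using Suc by blast
    moreover have "keys ?n \<inter> c \<noteq> {}" using v by simp
    moreover have "m = (m - ?n) + ?n" using m by (simp add: add.commute)
    ultimately show "sum_power (\<lambda>m. keys m \<inter> c \<noteq> {}) (Suc s) m"
      unfolding sum_power.simps by blast
  qed
qed

section \<open>Associated primes and symbolic powers of edge ideals\<close>

text \<open>Encoding exponent vectors as products of powers of distinct primes gives a well-founded
  monomial order.\<close>

lemma monomial_weight_exists:
  assumes fin: "finite (V :: 'v set)"
  obtains W :: "('v \<Rightarrow>\<^sub>0 nat) \<Rightarrow> nat" where "\<And>a b. W (a + b) = W a * W b" "\<And>a. 0 < W a"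
    "\<And>a b. \<lbrakk>keys a \<subseteq> V; keys b \<subseteq> V; W a = W b\<rbrakk> \<Longrightarrow> a = b"
proof -
  obtain h :: "nat \<Rightarrow> nat" where h: "inj h" "range h \<subseteq> {p. Factorial_Ring.prime p}"
    using infinite_countable_subset[OF primes_infinite] by blast
  obtain g :: "'v \<Rightarrow> nat" where g: "inj_on g V"
    using finite_imp_inj_to_nat_seg[OF fin] by blast
  define q where "q = h \<circ> g"
  have q: "inj_on q V" "Factorial_Ring.prime (q v)" for v
    using h g by (auto simp: q_def comp_inj_on inj_on_subset)
  define W where "W m = (\<Prod>v\<in>V. q v ^ lookup m v)" for m :: "'v \<Rightarrow>\<^sub>0 nat"
  have mult: "multiplicity (q v) (W m) = lookup m v" if "v \<in> V" for v m
  proof -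
    have "W m = (\<Prod>p\<in>q ` V. p ^ lookup m (inv_into V q p))"
      unfolding W_def using q(1) by (simp add: prod.reindex)
    also have "multiplicity (q v) \<dots> = lookup m (inv_into V q (q v))"
      using fin q that by (subst multiplicity_prod_prime_powers) auto
    finally show ?thesis using q(1) that by simp
  qed
  show ?thesis
  proof (rule that[of W])
    show "W (a + b) = W a * W b" for a b
      by (simp add: W_def lookup_add power_add prod.distrib)
    show "0 < W a" for a
      unfolding W_def using prime_gt_0_nat[OF q(2)] by (intro prod_pos) auto
    fix a b assume ab: "keys a \<subseteq> V" "keys b \<subseteq> V" "W a = W b"
    show "a = b"
    proof (rule poly_mapping_eqI)
      fix v show "lookup a v = lookup b v"
      proof (cases "v \<in> V")
        case True
        then show ?thesis using mult[OF True, of a] mult[OF True, of b] ab(3) by simp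
      next
        case False
        then have "v \<notin> keys a" "v \<notin> keys b" using ab(1,2) by auto
        then show ?thesis by (simp add: in_keys_iff)
      qed
    qed
  qed
qed

text \<open>The computation behind leading terms: once the terms at \<open>\<alpha>\<close> and
  \<open>\<beta>\<close> are separated, neither remainder can contribute to
  \<open>\<alpha> + \<beta>\<close>.\<close>

lemma lookup_mult_unique:
  fixes p q :: "('v, 'k::field) mpoly"
  assumes u: "\<And>a b. \<lbrakk>a \<in> keys p; b \<in> keys q; a + b = \<alpha> + \<beta>\<rbrakk> \<Longrightarrow> a = \<alpha> \<and> b = \<beta>"
  shows "lookup (p * q) (\<alpha> + \<beta>) = lookup p \<alpha> * lookup q \<beta>"
proof -
  define c d where "c = lookup p \<alpha>" and "d = lookup q \<beta>"
  define p' q' where "p' = p - single \<alpha> c" and "q' = q - single \<beta> d"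
  have p'k: "a \<in> keys p \<and> a \<noteq> \<alpha>" if "a \<in> keys p'" for a
    using that by (auto simp: p'_def c_def in_keys_iff lookup_minus lookup_single when_def split: if_splits)
  have q'k: "b \<in> keys q \<and> b \<noteq> \<beta>" if "b \<in> keys q'" for b
    using that by (auto simp: q'_def d_def in_keys_iff lookup_minus lookup_single when_def split: if_splits)
  have 1: "\<alpha> + \<beta> \<notin> keys (p' * q)"
  proof
    assume "\<alpha> + \<beta> \<in> keys (p' * q)"
    then obtain a b where "\<alpha> + \<beta> = a + b" "a \<in> keys p'" "b \<in> keys q"
      using keys_mult[of p' q] by blast
    then show False using p'k u by metis
  qed
  have 2: "\<alpha> + \<beta> \<notin> keys (single \<alpha> c * q')"
  proof
    assume "\<alpha> + \<beta> \<in> keys (single \<alpha> c * q')"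
    then obtain a b where "\<alpha> + \<beta> = a + b" "a \<in> keys (single \<alpha> c)" "b \<in> keys q'"
      using keys_mult[of "single \<alpha> c" q'] by blast
    then show False using q'k[of b] by (auto split: if_splits)
  qed
  have "p * q = single (\<alpha> + \<beta>) (c * d) + single \<alpha> c * q' + p' * q"
    unfolding p'_def q'_def mult_single[symmetric] by (simp add: algebra_simps)
  then have "lookup (p * q) (\<alpha> + \<beta>) = c * d"
    using 1 2 by (simp add: lookup_add in_keys_iff)
  then show ?thesis by (simp add: c_def d_def)
qed

lemma lookup_mult_single:
  fixes p :: "('v, 'k::field) mpoly"
  shows "lookup (p * single \<beta> c) (\<alpha> + \<beta>) = lookup p \<alpha> * c"
  by (subst lookup_mult_unique) (auto split: if_splits)

lemma mult_eq_mult_le: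
  fixes x y X Y :: nat
  assumes "x \<le> X" "y \<le> Y" "x * y = X * Y" "0 < X" "0 < Y"
  shows "x = X" "y = Y"
proof -
  have "\<not> x < X"
  proof
    assume "x < X"
    then have "x * Y < X * Y" using assms(5) by simp
    moreover have "x * y \<le> x * Y" using assms(2) by simp
    ultimately show False using assms(3) by simp
  qed
  then show "x = X" using assms(1) by simp
  with assms show "y = Y" by simp
qed

text \<open>The ideal generated by the variables x_v with v in \<open>c\<close>.\<close>

definition cover_prime :: "'v set \<Rightarrow> 'v set \<Rightarrow> ('v, 'k::field) mpoly set" where
  "cover_prime V c = mon_ideal V (\<lambda>m. keys m \<inter> c \<noteq> {})"

text \<open>Modulo the ideal only exponents avoiding \<open>c\<close> survive. The
  \<open>W\<close>-largest surviving exponents of two factors outside the ideal add up to an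
  exponent of the product that avoids \<open>c\<close> and arises in only one way, so it cannot
  cancel.\<close>

lemma primeideal_cover_prime:
  assumes fin: "finite V" and c: "c \<subseteq> V"
  shows "primeideal (cover_prime V c) (poly_ring V :: ('v, 'k::field) mpoly ring)"
proof (rule primeidealI)
  let ?P = "cover_prime V c :: ('v, 'k) mpoly set" and ?R = "poly_ring V :: ('v, 'k) mpoly ring"
  show "ideal ?P ?R" unfolding cover_prime_def by (rule ideal_mon_ideal) (auto simp: keys_add_nat)
  show "cring ?R" by (rule cring_poly_ring)
  have "(1 :: ('v, 'k) mpoly) \<notin> ?P" by (simp add: cover_prime_def mon_ideal_def)
  moreover have "(1 :: ('v, 'k) mpoly) \<in> carrier ?R" by (simp add: carrier_poly_ring mon_ideal_def)
  ultimately show "carrier ?R \<noteq> ?P" by blast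
  fix p q assume p: "p \<in> carrier ?R" and q: "q \<in> carrier ?R" and pq: "p \<otimes>\<^bsub>?R\<^esub> q \<in> ?P"
  obtain W :: "('v \<Rightarrow>\<^sub>0 nat) \<Rightarrow> nat" where W: "\<And>a b. W (a + b) = W a * W b" "\<And>a. 0 < W a"
    "\<And>a b. \<lbrakk>keys a \<subseteq> V; keys b \<subseteq> V; W a = W b\<rbrakk> \<Longrightarrow> a = b"
    by (rule monomial_weight_exists[OF fin]) blast
  have lead: "\<exists>\<alpha>\<in>keys r. keys \<alpha> \<inter> c = {} \<and>
      (\<forall>a\<in>keys r. keys a \<inter> c = {} \<longrightarrow> W a \<le> W \<alpha>)"
    if "r \<in> carrier ?R" "r \<notin> ?P" for r
  proof -
    let ?K = "{a \<in> keys r. keys a \<inter> c = {}}"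
    have "?K \<noteq> {}" using that by (auto simp: cover_prime_def mon_ideal_def carrier_poly_ring)
    moreover have "finite ?K" by simp
    ultimately have "Max (W ` ?K) \<in> W ` ?K" by (intro Max_in) auto
    then obtain \<alpha> where \<alpha>: "\<alpha> \<in> ?K" "W \<alpha> = Max (W ` ?K)" by auto
    have "W a \<le> W \<alpha>" if "a \<in> ?K" for a unfolding \<alpha>(2) using that by (intro Max_ge) auto
    then show ?thesis using \<alpha>(1) by blast
  qed
  show "p \<in> ?P \<or> q \<in> ?P"
  proof (rule ccontr)
    assume no: "\<not> ?thesis"
    obtain \<alpha> where \<alpha>: "\<alpha> \<in> keys p" "keys \<alpha> \<inter> c = {}"
      "\<And>a. a \<in> keys p \<Longrightarrow> keys a \<inter> c = {} \<Longrightarrow> W a \<le> W \<alpha>"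
      using lead[OF p] no by blast
    obtain \<beta> where \<beta>: "\<beta> \<in> keys q" "keys \<beta> \<inter> c = {}"
      "\<And>a. a \<in> keys q \<Longrightarrow> keys a \<inter> c = {} \<Longrightarrow> W a \<le> W \<beta>"
      using lead[OF q] no by blast
    have "a = \<alpha> \<and> b = \<beta>" if ab: "a \<in> keys p" "b \<in> keys q" "a + b = \<alpha> + \<beta>" for a b
    proof -
      have k: "keys a \<union> keys b = keys \<alpha> \<union> keys \<beta>"
        using ab(3) by (metis keys_add_nat)
      then have "keys a \<inter> c = {}" "keys b \<inter> c = {}"
        using \<alpha>(2) \<beta>(2) by blast+
      then have le: "W a \<le> W \<alpha>" "W b \<le> W \<beta>" using \<alpha>(3)[OF ab(1)] \<beta>(3)[OF ab(2)] by simp_all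
      have eq: "W a * W b = W \<alpha> * W \<beta>" using W(1)[of a b] W(1)[of \<alpha> \<beta>] ab(3) by simp
      have "W a = W \<alpha>" "W b = W \<beta>" by (rule mult_eq_mult_le[OF le eq W(2) W(2)])+
      moreover have "keys a \<subseteq> V" "keys b \<subseteq> V"
        "keys \<alpha> \<subseteq> V" "keys \<beta> \<subseteq> V"
        using p q ab(1,2) \<alpha>(1) \<beta>(1) by (auto simp: carrier_poly_ring mon_ideal_def)
      ultimately show ?thesis using W(3) by blast
    qed
    then have "lookup (p * q) (\<alpha> + \<beta>) = lookup p \<alpha> * lookup q \<beta>"
      by (rule lookup_mult_unique)
    then have "\<alpha> + \<beta> \<in> keys (p * q)" using \<alpha>(1) \<beta>(1) by (simp add: in_keys_iff)
    moreover have "keys m \<inter> c \<noteq> {}" if "m \<in> keys (p * q)" for m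
      using pq that by (simp add: cover_prime_def mon_ideal_def)
    ultimately have "keys (\<alpha> + \<beta>) \<inter> c \<noteq> {}" by blast
    then show False using \<alpha>(2) \<beta>(2) by (simp add: keys_add_nat Int_Un_distrib2)
  qed
qed

section \<open>Minimal vertex covers and associated primes\<close>

definition minimal_cover :: "'v sgraph \<Rightarrow> 'v set \<Rightarrow> bool" where
  "minimal_cover G c \<longleftrightarrow> vertex_cover G c \<and> (\<forall>d. vertex_cover G d \<longrightarrow> d \<subseteq> c \<longrightarrow> d = c)"

lemma minimal_cover_exists:
  assumes "simple_graph G" "vertex_cover G c"
  obtains d where "minimal_cover G d" "d \<subseteq> c"
proof -
  obtain d where d: "vertex_cover G d" "d \<subseteq> c"
    "\<And>d'. vertex_cover G d' \<Longrightarrow> d' \<subseteq> c \<Longrightarrow> card d \<le> card d'"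
    using ex_has_least_nat[of "\<lambda>d. vertex_cover G d \<and> d \<subseteq> c" c card] assms(2) by blast
  have "d' = d" if "vertex_cover G d'" "d' \<subseteq> d" for d'
    using that d card_subset_eq[OF vertex_cover_finite[OF assms(1) d(1)]]
    by (metis card_mono[OF vertex_cover_finite[OF assms(1) d(1)]] dual_order.antisym order_trans)
  then show ?thesis using that d unfolding minimal_cover_def by blast
qed

text \<open>A set contains no edge iff its complement is a cover. This is the decomposition of the
  edge ideal into the primes of minimal covers, read on supports.\<close>

lemma edge_subset_iff_covers:
  assumes G: "simple_graph G" and K: "K \<subseteq> verts G"
  shows "(\<exists>e\<in>edges G. e \<subseteq> K) \<longleftrightarrow> (\<forall>c. minimal_cover G c \<longrightarrow> K \<inter> c \<noteq> {})"
proof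
  assume "\<exists>e\<in>edges G. e \<subseteq> K"
  then obtain e where e: "e \<in> edges G" "e \<subseteq> K" by blast
  have "K \<inter> c \<noteq> {}" if "minimal_cover G c" for c
  proof -
    have "e \<inter> c \<noteq> {}" using that e(1) by (simp add: minimal_cover_def vertex_cover_def)
    then show ?thesis using e(2) by blast
  qed
  then show "\<forall>c. minimal_cover G c \<longrightarrow> K \<inter> c \<noteq> {}" by blast
next
  assume all: "\<forall>c. minimal_cover G c \<longrightarrow> K \<inter> c \<noteq> {}"
  show "\<exists>e\<in>edges G. e \<subseteq> K"
  proof (rule ccontr)
    assume no: "\<not> ?thesis"
    have "vertex_cover G (verts G - K)"
      unfolding vertex_cover_def
    proof (intro conjI ballI)
      fix e assume "e \<in> edges G"
      then have "e \<subseteq> verts G" "\<not> e \<subseteq> K" using G no by (auto simp: simple_graph_def)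
      then show "e \<inter> (verts G - K) \<noteq> {}" by blast
    qed simp
    then obtain d where "minimal_cover G d" "d \<subseteq> verts G - K" using minimal_cover_exists[OF G] by blast
    then show False using all by blast
  qed
qed

lemma edge_ideal_iff_cover_primes:
  fixes p :: "('v, 'k::field) mpoly"
  assumes G: "simple_graph G" and p: "p \<in> carrier (poly_ring (verts G))"
  shows "p \<in> edge_ideal G \<longleftrightarrow> (\<forall>c. minimal_cover G c \<longrightarrow> p \<in> cover_prime (verts G) c)"
proof -
  have "p \<in> edge_ideal G \<longleftrightarrow> (\<forall>m\<in>keys p. \<exists>e\<in>edges G. e \<subseteq> keys m)"
    using p unfolding edge_ideal_mon_ideal[OF G] by (simp add: mon_ideal_def carrier_poly_ring)
  also have "\<dots> \<longleftrightarrow> (\<forall>m\<in>keys p. \<forall>c. minimal_cover G c \<longrightarrow> keys m \<inter> c \<noteq> {})"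
    using p edge_subset_iff_covers[OF G] by (auto simp: mon_ideal_def carrier_poly_ring)
  also have "\<dots> \<longleftrightarrow> (\<forall>c. minimal_cover G c \<longrightarrow> p \<in> cover_prime (verts G) c)"
    using p by (auto simp: mon_ideal_def carrier_poly_ring cover_prime_def)
  finally show ?thesis .
qed

lemma monomial_of_set:
  assumes "finite S"
  shows "keys (\<Sum>v\<in>S. single v (1::nat)) = S"
  using assms by (induction S rule: finite_induct) (auto simp: keys_add_nat)

lemma cover_prime_in_assoc_primes:
  assumes G: "simple_graph G" and c: "minimal_cover G c"
  shows "cover_prime (verts G) c \<in>
    assoc_primes (poly_ring (verts G)) (edge_ideal G :: ('v, 'k::field) mpoly set)"
proof -
  let ?V = "verts G"
  let ?R = "poly_ring ?V :: ('v, 'k) mpoly ring" and ?I = "edge_ideal G :: ('v, 'k) mpoly set"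
  interpret R: cring ?R by (rule cring_poly_ring)
  have fin: "finite ?V" using G by (simp add: simple_graph_def)
  have mc: "vertex_cover G c" "c \<subseteq> ?V" if "minimal_cover G c" for c
    using that by (auto simp: minimal_cover_def vertex_cover_def)
  \<comment> \<open>The witness is the product of the variables outside \<open>c\<close>. By
    minimality every v in \<open>c\<close> has an edge whose other end lies outside
    \<open>c\<close>, so x_v multiplies the witness into the ideal.\<close>
  define \<mu> where "\<mu> = (\<Sum>v\<in>?V - c. single v (1::nat))"
  have \<mu>: "keys \<mu> = ?V - c" unfolding \<mu>_def using fin by (intro monomial_of_set) simp
  let ?f = "single \<mu> 1 :: ('v, 'k) mpoly"
  have f: "?f \<in> carrier ?R" unfolding carrier_poly_ring using \<mu> by (intro mon_ideal_single) auto
  have "p \<in> cover_prime ?V c \<longleftrightarrow> p * ?f \<in> ?I" if p: "p \<in> carrier ?R" for p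
  proof
    assume pc: "p \<in> cover_prime ?V c"
    have "\<exists>e\<in>edges G. e \<subseteq> keys m" if m: "m \<in> keys (p * ?f)" for m
    proof -
      obtain n where n: "m = n + \<mu>" "n \<in> keys p"
        using keys_mult[of p ?f] m by auto
      obtain v where v: "v \<in> keys n" "v \<in> c"
        using pc n(2) by (auto simp: cover_prime_def mon_ideal_def)
      have "\<not> vertex_cover G (c - {v})" using c v(2) by (auto simp: minimal_cover_def)
      then obtain e where e: "e \<in> edges G" "e \<inter> (c - {v}) = {}"
        using mc[OF c] by (auto simp: vertex_cover_def)
      have "e \<subseteq> ?V" using e(1) G by (auto simp: simple_graph_def)
      then have "e \<subseteq> keys m" using e(2) v(1) by (auto simp: n(1) keys_add_nat \<mu>)
      then show ?thesis using e(1) by blast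
    qed
    moreover have "p * ?f \<in> carrier ?R" using R.m_closed[OF p f] by simp
    ultimately show "p * ?f \<in> ?I"
      unfolding edge_ideal_mon_ideal[OF G] by (simp add: mon_ideal_def carrier_poly_ring)
  next
    assume pf: "p * ?f \<in> ?I"
    have "keys n \<inter> c \<noteq> {}" if n: "n \<in> keys p" for n
    proof -
      have "n + \<mu> \<in> keys (p * ?f)" using n by (simp add: in_keys_iff lookup_mult_single)
      then obtain e where e: "e \<in> edges G" "e \<subseteq> keys n \<union> (?V - c)"
        using pf unfolding edge_ideal_mon_ideal[OF G] by (auto simp: mon_ideal_def keys_add_nat \<mu>)
      have "e \<inter> c \<noteq> {}" using e(1) mc[OF c] by (auto simp: vertex_cover_def)
      then show ?thesis using e(2) by blast
    qed
    then show "p \<in> cover_prime ?V c" using p by (simp add: cover_prime_def mon_ideal_def carrier_poly_ring)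
  qed
  moreover have "cover_prime ?V c \<subseteq> carrier ?R" unfolding cover_prime_def by (rule mon_ideal_carrier)
  ultimately have "cover_prime ?V c = {g \<in> carrier ?R. g \<otimes>\<^bsub>?R\<^esub> ?f \<in> ?I}" by auto
  then show ?thesis
    using f primeideal_cover_prime[OF fin mc(2)[OF c]] unfolding assoc_primes_def by blast
qed

text \<open>With P = (I : f), the fact \<open>key\<close> writes P as the intersection of the cover
  primes that do not contain f. By primality the product of all variables outside P is not in P, so
  one of these primes omits it. That prime is generated by variables lying in P, and it contains
  P.\<close>

lemma assoc_prime_is_cover_prime:
  assumes G: "simple_graph G"
    and "P \<in> assoc_primes (poly_ring (verts G)) (edge_ideal G :: ('v, 'k::field) mpoly set)"
  obtains c where "minimal_cover G c" "P = cover_prime (verts G) c"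
proof -
  let ?V = "verts G"
  let ?R = "poly_ring ?V :: ('v, 'k) mpoly ring" and ?I = "edge_ideal G :: ('v, 'k) mpoly set"
  interpret R: cring ?R by (rule cring_poly_ring)
  have fin: "finite ?V" using G by (simp add: simple_graph_def)
  have mc: "vertex_cover G c" "c \<subseteq> ?V" if "minimal_cover G c" for c
    using that by (auto simp: minimal_cover_def vertex_cover_def)
  obtain f where P: "primeideal P ?R" and f: "f \<in> carrier ?R"
    and Pf: "P = {g \<in> carrier ?R. g \<otimes>\<^bsub>?R\<^esub> f \<in> ?I}" using assms unfolding assoc_primes_def by blast
  interpret P: primeideal P ?R by (rule P)
  have key: "g \<in> P \<longleftrightarrow> (\<forall>c. minimal_cover G c \<longrightarrow> f \<notin> cover_prime ?V c \<longrightarrow> g \<in> cover_prime ?V c)"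
    if g: "g \<in> carrier ?R" for g
  proof -
    have gf: "g * f \<in> carrier ?R" using R.m_closed[OF g f] by simp
    have "g * f \<in> cover_prime ?V c \<longleftrightarrow> g \<in> cover_prime ?V c \<or> f \<in> cover_prime ?V c"
      if "minimal_cover G c" for c
    proof -
      interpret Q: primeideal "cover_prime ?V c" ?R
        by (rule primeideal_cover_prime[OF fin mc(2)[OF that]])
      show ?thesis
        using Q.I_prime[OF g f] Q.I_l_closed[OF _ g, of f] Q.I_r_closed[OF _ f, of g] by auto
    qed
    then show ?thesis unfolding Pf using g edge_ideal_iff_cover_primes[OF G gf] by auto
  qed
  define U where "U = {v \<in> ?V. pvar v \<notin> P}"
  have pv: "(pvar v :: ('v, 'k) mpoly) \<in> carrier ?R" if "v \<in> ?V" for v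
    unfolding carrier_poly_ring pvar_def using that by (intro mon_ideal_single) auto
  have "F \<subseteq> U \<Longrightarrow> single (\<Sum>v\<in>F. single v 1) 1 \<in> carrier ?R \<and>
      single (\<Sum>v\<in>F. single v 1) 1 \<notin> P" if "finite F" for F
    using that
  proof (induction F rule: finite_induct)
    case empty
    have "\<one>\<^bsub>?R\<^esub> \<notin> P" using P.one_imp_carrier P.I_notcarr by blast
    then show ?case using R.one_closed by simp
  next
    case (insert v F)
    let ?q = "single (\<Sum>v\<in>F. single v 1) 1 :: ('v, 'k) mpoly"
    have v: "v \<in> ?V" "pvar v \<notin> P" using insert.prems by (auto simp: U_def)
    have eq: "single (\<Sum>v\<in>insert v F. single v 1) 1 = pvar v * ?q"
      using insert.hyps by (simp add: pvar_def mult_single)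
    have "pvar v * ?q \<in> carrier ?R" using R.m_closed[OF pv[OF v(1)]] insert by simp
    moreover have "pvar v * ?q \<notin> P" using P.I_prime[OF pv[OF v(1)]] insert v by auto
    ultimately show ?case unfolding eq by simp
  qed
  from this[of U] fin have "single (\<Sum>v\<in>U. single v 1) 1 \<in> carrier ?R"
    "single (\<Sum>v\<in>U. single v 1) 1 \<notin> P" by (auto simp: U_def)
  then obtain c where c: "minimal_cover G c" "f \<notin> cover_prime ?V c"
    "single (\<Sum>v\<in>U. single v 1) 1 \<notin> (cover_prime ?V c :: ('v, 'k) mpoly set)"
    using key by blast
  have finU: "finite U" using fin by (simp add: U_def)
  have "U \<inter> c = {}"
    using c(3) monomial_of_set[OF finU] unfolding cover_prime_def mon_ideal_def by (auto simp: U_def)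
  then have cP: "pvar v \<in> P" if "v \<in> c" for v using that mc(2)[OF c(1)] by (auto simp: U_def)
  have "cover_prime ?V c \<subseteq> P"
    unfolding cover_prime_def
  proof (rule mon_ideal_subsetI)
    show "0 \<in> P" using P.zero_closed by simp
    show "p + q \<in> P" if "p \<in> P" "q \<in> P" for p q using P.a_closed[OF that] by simp
    fix m :: "'v \<Rightarrow>\<^sub>0 nat" and d :: 'k
    assume m: "keys m \<subseteq> ?V" "keys m \<inter> c \<noteq> {}"
    then obtain v where v: "v \<in> keys m" "v \<in> c" by blast
    let ?n = "single v (1::nat)"
    have m_eq: "m = ?n + (m - ?n)"
      using v by (intro lookup_le_imp_add) (auto simp: lookup_single when_def in_keys_iff)
    have "keys (m - ?n) \<subseteq> ?V" using m(1) keys_add_nat[of ?n "m - ?n"] m_eq by auto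
    then have "single (m - ?n) d \<in> carrier ?R"
      unfolding carrier_poly_ring by (rule mon_ideal_single) simp
    then have "pvar v * single (m - ?n) d \<in> P"
      using P.I_r_closed[OF cP[OF v(2)]] by simp
    then show "single m d \<in> P"
      unfolding pvar_def mult_single m_eq[symmetric] by simp
  qed
  moreover have "P \<subseteq> cover_prime ?V c"
    using key c(1,2) P.Icarr by blast
  ultimately have "P = cover_prime ?V c" by (rule equalityI[rotated])
  then show ?thesis using c(1) that by blast
qed

lemma assoc_primes_edge_ideal:
  assumes G: "simple_graph G"
  shows "assoc_primes (poly_ring (verts G)) (edge_ideal G :: ('v, 'k::field) mpoly set) =
    cover_prime (verts G) ` {c. minimal_cover G c}"
proof (intro equalityI subsetI)
  fix P assume "P \<in> assoc_primes (poly_ring (verts G)) (edge_ideal G :: ('v, 'k) mpoly set)"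
  then obtain c where "minimal_cover G c" "P = cover_prime (verts G) c"
    by (rule assoc_prime_is_cover_prime[OF G])
  then show "P \<in> cover_prime (verts G) ` {c. minimal_cover G c}" by blast
qed (use cover_prime_in_assoc_primes[OF G] in auto)

lemma symbolic_power_edge_ideal:
  assumes G: "simple_graph G"
  shows "symbolic_power (poly_ring (verts G)) (edge_ideal G :: ('v, 'k::field) mpoly set) s =
    mon_ideal (verts G) (\<lambda>m. \<forall>c. vertex_cover G c \<longrightarrow> s \<le> sum (lookup m) c)"
proof -
  have fin: "finite c" if "vertex_cover G c" for c using vertex_cover_finite[OF G that] .
  \<comment> \<open>Enlarging a cover cannot lower its weight, so minimal covers may be replaced by
    all covers.\<close>
  have cov: "(\<forall>c. vertex_cover G c \<longrightarrow> s \<le> sum f c) \<longleftrightarrow> (\<forall>c. minimal_cover G c \<longrightarrow> s \<le> sum f c)" for f :: "'v \<Rightarrow> nat"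
  proof
    assume min: "\<forall>c. minimal_cover G c \<longrightarrow> s \<le> sum f c"
    show "\<forall>c. vertex_cover G c \<longrightarrow> s \<le> sum f c"
    proof (intro allI impI)
      fix c assume c: "vertex_cover G c"
      then obtain d where d: "minimal_cover G d" "d \<subseteq> c" using minimal_cover_exists[OF G] by blast
      then have "s \<le> sum f d" using min by blast
      also have "\<dots> \<le> sum f c" using d(2) fin[OF c] by (intro sum_mono2) auto
      finally show "s \<le> sum f c" .
    qed
  qed (simp add: minimal_cover_def)
  have pw: "ideal_power (poly_ring (verts G)) (cover_prime (verts G) c) s =
      (mon_ideal (verts G) (\<lambda>m. s \<le> sum (lookup m) c) :: ('v, 'k) mpoly set)"
    if "minimal_cover G c" for c
    using that fin unfolding cover_prime_def ideal_power_mon_ideal minimal_cover_def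
    by (intro mon_ideal_cong) (simp add: sum_power_prime)
  have "symbolic_power (poly_ring (verts G)) (edge_ideal G :: ('v, 'k) mpoly set) s =
      carrier (poly_ring (verts G)) \<inter> (\<Inter>c\<in>{c. minimal_cover G c}.
        mon_ideal (verts G) (\<lambda>m. s \<le> sum (lookup m) c))"
    unfolding symbolic_power_def assoc_primes_edge_ideal[OF G] using pw by simp
  also have "\<dots> = mon_ideal (verts G) (\<lambda>m. \<forall>c. vertex_cover G c \<longrightarrow> s \<le> sum (lookup m) c)"
    unfolding cov
  proof (intro equalityI subsetI)
    fix p :: "('v, 'k) mpoly"
    assume p: "p \<in> carrier (poly_ring (verts G)) \<inter> (\<Inter>c\<in>{c. minimal_cover G c}.
        mon_ideal (verts G) (\<lambda>m. s \<le> sum (lookup m) c))"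
    have "s \<le> sum (lookup m) c" if "m \<in> keys p" "minimal_cover G c" for m c
    proof -
      have "p \<in> mon_ideal (verts G) (\<lambda>m. s \<le> sum (lookup m) c)"
        using p that(2) by blast
      then show ?thesis using that(1) by (simp add: mon_ideal_def)
    qed
    with p show "p \<in> mon_ideal (verts G) (\<lambda>m. \<forall>c. minimal_cover G c \<longrightarrow> s \<le> sum (lookup m) c)"
      by (simp add: mon_ideal_def carrier_poly_ring)
  next
    fix p :: "('v, 'k) mpoly"
    assume "p \<in> mon_ideal (verts G) (\<lambda>m. \<forall>c. minimal_cover G c \<longrightarrow> s \<le> sum (lookup m) c)"
    then show "p \<in> carrier (poly_ring (verts G)) \<inter> (\<Inter>c\<in>{c. minimal_cover G c}.
        mon_ideal (verts G) (\<lambda>m. s \<le> sum (lookup m) c))"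
      by (simp add: mon_ideal_def carrier_poly_ring)
  qed
  finally show ?thesis .
qed

section \<open>The Koszul complex\<close>

text \<open>The sign of inserting v into the exterior monomial on \<tau> when the vertices are
  ordered by \<open>h\<close>.\<close>

definition ksign :: "('v \<Rightarrow> nat) \<Rightarrow> 'v \<Rightarrow> 'v set \<Rightarrow> 'r::ring_1" where
  "ksign h v \<tau> = (-1) ^ card {w \<in> \<tau>. h w < h v}"

lemma ksign_square: "ksign h v \<tau> * ksign h v \<tau> = 1"
  by (simp add: ksign_def power_add[symmetric] mult_2[symmetric])

lemma ksign_insert:
  assumes "finite \<tau>" "w \<notin> \<tau>"
  shows "ksign h v (insert w \<tau>) = (if h w < h v then - ksign h v \<tau> else ksign h v \<tau>)"
proof -
  have "{x \<in> insert w \<tau>. h x < h v} = (if h w < h v then insert w {x \<in> \<tau>. h x < h v} else {x \<in> \<tau>. h x < h v})"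
    by auto
  then show ?thesis using assms by (simp add: ksign_def)
qed

lemma ksign_swap:
  assumes "inj_on h V" "v \<in> V" "w \<in> V" "v \<noteq> w" "finite \<tau>" "v \<notin> \<tau>" "w \<notin> \<tau>"
  shows "ksign h v \<tau> * ksign h w (insert v \<tau>) = - (ksign h w \<tau> * ksign h v (insert w \<tau>) :: 'r::comm_ring_1)"
proof -
  have "h v \<noteq> h w" using assms by (auto simp: inj_on_def)
  then show ?thesis using assms by (auto simp: ksign_insert mult.commute)
qed

lemma lookup_ksign_mult:
  "lookup (ksign h v \<tau> * p) a = ksign h v \<tau> * lookup (p :: ('v, 'k::field) mpoly) a"
  by (cases "even (card {w \<in> \<tau>. h w < h v})") (auto simp: ksign_def)

lemma lookup_pvar_mult:
  fixes p :: "('v, 'k::field) mpoly"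
  shows "lookup (pvar v * p) a =
    (if v \<in> keys a then lookup p (a - single v 1) else 0)"
proof (cases "v \<in> keys a")
  case True
  then have a: "a = single v 1 + (a - single v 1)"
    by (intro lookup_le_imp_add) (auto simp: lookup_single when_def in_keys_iff)
  have "lookup (p * pvar v) (a - single v 1 + single v 1) =
      lookup p (a - single v 1) * 1"
    unfolding pvar_def by (rule lookup_mult_single)
  then show ?thesis using True a by (simp add: add.commute mult.commute)
next
  case False
  have "a \<notin> keys (pvar v * p)"
  proof
    assume "a \<in> keys (pvar v * p)"
    then obtain b where "a = single v 1 + b"
      using keys_mult[of "pvar v" p] by (auto simp: pvar_def)
    then show False using False by (simp add: keys_add_nat)
  qed
  then show ?thesis using False by (simp add: in_keys_iff)
qed

type_synonym ('v, 'k) pvec = "nat \<Rightarrow> ('v, 'k) mpoly"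

text \<open>A graded module is represented by the family of its homogeneous components.\<close>

definition graded_module :: "'v set \<Rightarrow> (int \<Rightarrow> ('v, 'k::field) pvec set) \<Rightarrow> bool" where
  "graded_module V M \<longleftrightarrow> (\<forall>j. (\<lambda>_. 0) \<in> M j) \<and>
     (\<forall>j w w'. w \<in> M j \<longrightarrow> w' \<in> M j \<longrightarrow> (\<lambda>i. w i + w' i) \<in> M j) \<and>
     (\<forall>j w. w \<in> M j \<longrightarrow> (\<lambda>i. - w i) \<in> M j) \<and>
     (\<forall>j w. \<forall>v\<in>V. w \<in> M j \<longrightarrow> (\<lambda>i. pvar v * w i) \<in> M (j + 1))"

lemma graded_moduleD:
  assumes "graded_module V M"
  shows "(\<lambda>_. 0) \<in> M j" "w \<in> M j \<Longrightarrow> w' \<in> M j \<Longrightarrow> (\<lambda>i. w i + w' i) \<in> M j"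
    "w \<in> M j \<Longrightarrow> (\<lambda>i. - w i) \<in> M j" "w \<in> M j \<Longrightarrow> w' \<in> M j \<Longrightarrow> (\<lambda>i. w i - w' i) \<in> M j"
    "v \<in> V \<Longrightarrow> w \<in> M j \<Longrightarrow> (\<lambda>i. pvar v * w i) \<in> M (j + 1)"
proof -
  show *: "w \<in> M j \<Longrightarrow> w' \<in> M j \<Longrightarrow> (\<lambda>i. w i + w' i) \<in> M j" "w \<in> M j \<Longrightarrow> (\<lambda>i. - w i) \<in> M j" for w w'
    using assms by (simp_all add: graded_module_def)
  show "w \<in> M j \<Longrightarrow> w' \<in> M j \<Longrightarrow> (\<lambda>i. w i - w' i) \<in> M j"
    using *(1)[of w "\<lambda>i. - w' i"] *(2)[of w'] by simp
qed (use assms in \<open>simp_all add: graded_module_def\<close>)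

lemma graded_module_sum:
  assumes "graded_module V M" "\<And>x. x \<in> S \<Longrightarrow> w x \<in> M j"
  shows "(\<lambda>i. \<Sum>x\<in>S. w x i) \<in> M j"
  using assms(2)
  by (induction S rule: infinite_finite_induct) (auto intro: graded_moduleD[OF assms(1)])

type_synonym ('v, 'k) chain = "'v set \<Rightarrow> ('v, 'k) pvec"

text \<open>Koszul chains of homological degree p and internal degree j: \<open>f \<sigma>\<close>
  is the coefficient of the exterior monomial on \<sigma>, which itself has degree p. Other
  coefficients are 0 so that equal chains are equal functions.\<close>

definition kchains :: "'v set \<Rightarrow> (int \<Rightarrow> ('v, 'k::field) pvec set) \<Rightarrow> nat \<Rightarrow> int \<Rightarrow> ('v, 'k) chain set" where
  "kchains V M p j = {f. \<forall>\<sigma>. if \<sigma> \<subseteq> V \<and> card \<sigma> = p then f \<sigma> \<in> M (j - int p) else f \<sigma> = (\<lambda>_. 0)}"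

text \<open>The Koszul differential, written by its coefficient at the target \<tau>: removing v
  from the larger set contributes x_v up to sign.\<close>

definition koszul_boundary :: "'v set \<Rightarrow> ('v \<Rightarrow> nat) \<Rightarrow> ('v, 'k::field) chain \<Rightarrow> ('v, 'k) chain" where
  "koszul_boundary V h f = (\<lambda>\<tau> i. \<Sum>v\<in>V - \<tau>. ksign h v \<tau> * pvar v * f (insert v \<tau>) i)"

text \<open>In homological terms: the degree-j part of Tor_p(M, k) is zero.\<close>

definition koszul_vanishes :: "'v set \<Rightarrow> ('v \<Rightarrow> nat) \<Rightarrow> (int \<Rightarrow> ('v, 'k::field) pvec set) \<Rightarrow> nat \<Rightarrow> int \<Rightarrow> bool" where
  "koszul_vanishes V h M p j \<longleftrightarrow> (\<forall>f\<in>kchains V M p j. koszul_boundary V h f = (\<lambda>_ _. 0) \<longrightarrow>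
     (\<exists>g\<in>kchains V M (Suc p) j. koszul_boundary V h g = f))"

lemma chainsD:
  assumes "f \<in> kchains V M p j"
  shows "\<sigma> \<subseteq> V \<Longrightarrow> card \<sigma> = p \<Longrightarrow> f \<sigma> \<in> M (j - int p)" "\<not> (\<sigma> \<subseteq> V \<and> card \<sigma> = p) \<Longrightarrow> f \<sigma> = (\<lambda>_. 0)"
proof -
  have "if \<sigma> \<subseteq> V \<and> card \<sigma> = p then f \<sigma> \<in> M (j - int p) else f \<sigma> = (\<lambda>_. 0)"
    using assms by (simp add: kchains_def)
  then show "\<sigma> \<subseteq> V \<Longrightarrow> card \<sigma> = p \<Longrightarrow> f \<sigma> \<in> M (j - int p)" "\<not> (\<sigma> \<subseteq> V \<and> card \<sigma> = p) \<Longrightarrow> f \<sigma> = (\<lambda>_. 0)"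
    by argo+
qed

lemma chainsI:
  assumes "\<And>\<sigma>. \<sigma> \<subseteq> V \<Longrightarrow> card \<sigma> = p \<Longrightarrow> f \<sigma> \<in> M (j - int p)" "\<And>\<sigma>. \<not> (\<sigma> \<subseteq> V \<and> card \<sigma> = p) \<Longrightarrow> f \<sigma> = (\<lambda>_. 0)"
  shows "f \<in> kchains V M p j"
  using assms by (auto simp: kchains_def)

lemma koszul_boundary_chains:
  assumes fin: "finite V" and M: "graded_module V M" and f: "f \<in> kchains V M (Suc p) j"
  shows "koszul_boundary V h f \<in> kchains V M p j"
proof (rule chainsI)
  fix \<sigma> assume \<sigma>: "\<sigma> \<subseteq> V" "card \<sigma> = p"
  define w where "w v = (\<lambda>i. ksign h v \<sigma> * pvar v * f (insert v \<sigma>) i)" for v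
  have "(\<lambda>i. ksign h v \<sigma> * pvar v * f (insert v \<sigma>) i) \<in> M (j - int p)" if v: "v \<in> V - \<sigma>" for v
  proof -
    have "card (insert v \<sigma>) = Suc p" using v \<sigma> finite_subset[OF \<sigma>(1) fin] by simp
    then have "f (insert v \<sigma>) \<in> M (j - int (Suc p))" using chainsD(1)[OF f] v \<sigma> by blast
    then have *: "(\<lambda>i. pvar v * f (insert v \<sigma>) i) \<in> M (j - int p)"
      using graded_moduleD(5)[OF M, of v "f (insert v \<sigma>)" "j - int (Suc p)"] v by simp
    show ?thesis
    proof (cases "even (card {w \<in> \<sigma>. h w < h v})")
      case True
      then show ?thesis using * by (simp add: ksign_def)
    next
      case False
      then show ?thesis using graded_moduleD(3)[OF M *] by (simp add: ksign_def)
    qed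
  qed
  then have "w v \<in> M (j - int p)" if "v \<in> V - \<sigma>" for v using that by (simp add: w_def)
  then have "(\<lambda>i. \<Sum>v\<in>V - \<sigma>. w v i) \<in> M (j - int p)" by (rule graded_module_sum[OF M])
  then show "koszul_boundary V h f \<sigma> \<in> M (j - int p)"
    by (simp add: koszul_boundary_def w_def)
next
  fix \<sigma> assume \<sigma>: "\<not> (\<sigma> \<subseteq> V \<and> card \<sigma> = p)"
  have "f (insert v \<sigma>) = (\<lambda>_. 0)" if v: "v \<in> V - \<sigma>" for v
  proof (rule chainsD(2)[OF f])
    show "\<not> (insert v \<sigma> \<subseteq> V \<and> card (insert v \<sigma>) = Suc p)"
    proof
      assume *: "insert v \<sigma> \<subseteq> V \<and> card (insert v \<sigma>) = Suc p"
      then have "finite \<sigma>" using finite_subset[of \<sigma> V] fin by simp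
      moreover have "v \<notin> \<sigma>" using v by simp
      ultimately show False using * \<sigma> by simp
    qed
  qed
  then show "koszul_boundary V h f \<sigma> = (\<lambda>_. 0)"
    unfolding koszul_boundary_def by simp
qed

lemma koszul_boundary_chains_0:
  assumes fin: "finite V" and f: "f \<in> kchains V M 0 j"
  shows "koszul_boundary V h f = (\<lambda>_ _. 0)"
proof -
  have "f (insert v \<tau>) = (\<lambda>_. 0)" for v \<tau>
  proof (rule chainsD(2)[OF f])
    show "\<not> (insert v \<tau> \<subseteq> V \<and> card (insert v \<tau>) = 0)"
      using fin by (metis card_eq_0_iff finite_subset insert_not_empty)
  qed
  then show ?thesis by (simp add: koszul_boundary_def fun_eq_iff)
qed

text \<open>The terms of \<open>\<partial>\<partial>\<close> for \<open>(v, w)\<close> and \<open>(w, v)\<close> are paired off: in characteristic 2 it would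
  not be enough to compare the double sum with its negative.\<close>

lemma koszul_boundary_boundary:
  assumes fin: "finite V" and h: "inj_on h V" and f: "f \<in> kchains V M p j"
  shows "koszul_boundary V h (koszul_boundary V h f) = (\<lambda>_ _. 0)"
proof (intro ext)
  fix \<tau> i
  show "koszul_boundary V h (koszul_boundary V h f) \<tau> i = 0"
  proof (cases "\<tau> \<subseteq> V")
    case False
    then have "f (insert w (insert v \<tau>)) = (\<lambda>_. 0)" for v w by (intro chainsD(2)[OF f]) auto
    then show ?thesis by (simp add: koszul_boundary_def)
  next
    case True
    define D where "D = V - \<tau>"
    have fD: "finite D" and f\<tau>: "finite \<tau>" using fin True finite_subset by (auto simp: D_def)
    define H where "H v w = ksign h v \<tau> * pvar v * (ksign h w (insert v \<tau>) * pvar w * f (insert w (insert v \<tau>)) i)" for v w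
    have anti: "H w v = - H v w" if "v \<in> D" "w \<in> D" "v \<noteq> w" for v w
    proof -
      have "ksign h w \<tau> * ksign h v (insert w \<tau>) = - (ksign h v \<tau> * ksign h w (insert v \<tau>) :: ('a, 'b) mpoly)"
        using that f\<tau> by (intro ksign_swap[OF h]) (auto simp: D_def)
      moreover have "H w v = (ksign h w \<tau> * ksign h v (insert w \<tau>)) * (pvar v * pvar w * f (insert v (insert w \<tau>)) i)"
        "H v w = (ksign h v \<tau> * ksign h w (insert v \<tau>)) * (pvar v * pvar w * f (insert v (insert w \<tau>)) i)"
        unfolding H_def by (simp_all add: algebra_simps insert_commute)
      ultimately show ?thesis by simp
    qed
    have neq: "h v \<noteq> h w" if "v \<in> D" "w \<in> D" "v \<noteq> w" for v w
      using that h by (auto simp: D_def inj_on_def)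
    have "koszul_boundary V h (koszul_boundary V h f) \<tau> i = (\<Sum>v\<in>D. \<Sum>w\<in>D - {v}. H v w)"
      unfolding koszul_boundary_def H_def D_def
      by (intro sum.cong refl) (auto simp: sum_distrib_left intro!: sum.cong)
    also have "\<dots> = (\<Sum>v\<in>D. \<Sum>w\<in>D. (if h v < h w then H v w else 0) + (if h w < h v then H v w else 0))"
    proof (rule sum.cong[OF refl])
      fix v assume v: "v \<in> D"
      have "(\<Sum>w\<in>D. (if h v < h w then H v w else 0) + (if h w < h v then H v w else 0)) =
          (\<Sum>w\<in>D - {v}. (if h v < h w then H v w else 0) + (if h w < h v then H v w else 0))"
        using fD by (intro sum.mono_neutral_right) auto
      also have "\<dots> = (\<Sum>w\<in>D - {v}. H v w)"
      proof (intro sum.cong refl)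
        fix w assume "w \<in> D - {v}"
        then have "h v \<noteq> h w" using neq[OF v, of w] by blast
        then show "(if h v < h w then H v w else 0) + (if h w < h v then H v w else 0) = H v w" by auto
      qed
      finally show "(\<Sum>w\<in>D - {v}. H v w) =
        (\<Sum>w\<in>D. (if h v < h w then H v w else 0) + (if h w < h v then H v w else 0))" by simp
    qed
    also have "\<dots> = (\<Sum>v\<in>D. \<Sum>w\<in>D. if h v < h w then H v w else 0) + (\<Sum>v\<in>D. \<Sum>w\<in>D. if h w < h v then H v w else 0)"
      by (simp add: sum.distrib)
    also have "(\<Sum>v\<in>D. \<Sum>w\<in>D. if h w < h v then H v w else 0) = (\<Sum>v\<in>D. \<Sum>w\<in>D. if h v < h w then H w v else 0)"
      by (rule sum.swap)
    also have "\<dots> = (\<Sum>v\<in>D. \<Sum>w\<in>D. - (if h v < h w then H v w else 0))"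
      using anti by (intro sum.cong refl) (auto split: if_splits)
    finally show ?thesis by (simp add: sum_negf)
  qed
qed

section \<open>Linear maps of coefficient modules and dimension shifting\<close>

definition lin_map :: "(('v, 'k::field) pvec \<Rightarrow> ('v, 'k) pvec) \<Rightarrow> bool" where
  "lin_map \<phi> \<longleftrightarrow> (\<forall>w w'. \<phi> (\<lambda>i. w i + w' i) = (\<lambda>i. \<phi> w i + \<phi> w' i)) \<and>
     (\<forall>c w. \<phi> (\<lambda>i. c * w i) = (\<lambda>i. c * \<phi> w i))"

lemma lin_mapD:
  assumes "lin_map \<phi>"
  shows "\<phi> (\<lambda>i. w i + w' i) = (\<lambda>i. \<phi> w i + \<phi> w' i)" "\<phi> (\<lambda>i. c * w i) = (\<lambda>i. c * \<phi> w i)"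
    "\<phi> (\<lambda>_. 0) = (\<lambda>_. 0)" "\<phi> (\<lambda>i. - w i) = (\<lambda>i. - \<phi> w i)" "\<phi> (\<lambda>i. w i - w' i) = (\<lambda>i. \<phi> w i - \<phi> w' i)"
proof -
  show *: "\<phi> (\<lambda>i. w i + w' i) = (\<lambda>i. \<phi> w i + \<phi> w' i)" "\<phi> (\<lambda>i. c * w i) = (\<lambda>i. c * \<phi> w i)" for w w' c
    using assms by (simp_all add: lin_map_def)
  show "\<phi> (\<lambda>_. 0) = (\<lambda>_. 0)" using *(2)[of 0 "\<lambda>_. 0"] by simp
  show n: "\<phi> (\<lambda>i. - w i) = (\<lambda>i. - \<phi> w i)" for w using *(2)[of "-1" w] by simp
  show "\<phi> (\<lambda>i. w i - w' i) = (\<lambda>i. \<phi> w i - \<phi> w' i)" using *(1)[of w "\<lambda>i. - w' i"] n[of w'] by simp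
qed

lemma lin_map_sum:
  assumes "lin_map \<phi>"
  shows "\<phi> (\<lambda>i. \<Sum>x\<in>S. w x i) = (\<lambda>i. \<Sum>x\<in>S. \<phi> (w x) i)"
  by (induction S rule: infinite_finite_induct) (auto simp: lin_mapD(1,3)[OF assms])

lemma lin_map_boundary:
  assumes "lin_map \<phi>"
  shows "koszul_boundary V h (\<lambda>\<sigma>. \<phi> (f \<sigma>)) = (\<lambda>\<tau>. \<phi> (koszul_boundary V h f \<tau>))"
  unfolding koszul_boundary_def lin_map_sum[OF assms] lin_mapD(2)[OF assms] ..

lemma koszul_boundary_diff:
  "koszul_boundary V h (\<lambda>\<sigma> i. f \<sigma> i - g \<sigma> i) = (\<lambda>\<tau> i. koszul_boundary V h f \<tau> i - koszul_boundary V h g \<tau> i)"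
  by (simp add: koszul_boundary_def right_diff_distrib sum_subtractf)

lemma chains_diff:
  assumes "graded_module V M" "f \<in> kchains V M p j" "g \<in> kchains V M p j"
  shows "(\<lambda>\<sigma> i. f \<sigma> i - g \<sigma> i) \<in> kchains V M p j"
  using chainsD[OF assms(2)] chainsD[OF assms(3)] graded_moduleD(4)[OF assms(1)]
  by (intro chainsI) auto

lemma chains_lin_map:
  assumes "lin_map \<phi>" "\<And>j w. w \<in> F j \<Longrightarrow> \<phi> w \<in> B j" "f \<in> kchains V F p j"
  shows "(\<lambda>\<sigma>. \<phi> (f \<sigma>)) \<in> kchains V B p j"
proof (rule chainsI)
  fix \<sigma> assume "\<not> (\<sigma> \<subseteq> V \<and> card \<sigma> = p)"
  then show "\<phi> (f \<sigma>) = (\<lambda>_. 0)" using chainsD(2)[OF assms(3)] lin_mapD(3)[OF assms(1)] by simp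
qed (use assms(2) chainsD(1)[OF assms(3)] in blast)

lemma chains_lift:
  assumes "lin_map \<phi>" "\<And>j. B j = \<phi> ` F j" "b \<in> kchains V B p j"
  obtains f where "f \<in> kchains V F p j" "b = (\<lambda>\<sigma>. \<phi> (f \<sigma>))"
proof -
  have "\<exists>w. if \<sigma> \<subseteq> V \<and> card \<sigma> = p then w \<in> F (j - int p) \<and> b \<sigma> = \<phi> w else w = (\<lambda>_. 0)" for \<sigma>
  proof (cases "\<sigma> \<subseteq> V \<and> card \<sigma> = p")
    case True
    then have "b \<sigma> \<in> \<phi> ` F (j - int p)" using chainsD(1)[OF assms(3), of \<sigma>] assms(2) by simp
    then show ?thesis using True by auto
  qed auto
  then obtain f where f: "\<And>\<sigma>. if \<sigma> \<subseteq> V \<and> card \<sigma> = p then f \<sigma> \<in> F (j - int p) \<and> b \<sigma> = \<phi> (f \<sigma>) else f \<sigma> = (\<lambda>_. 0)"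
    by metis
  have "f \<in> kchains V F p j" using f by (intro chainsI) (metis (full_types))+
  moreover have "b \<sigma> = \<phi> (f \<sigma>)" for \<sigma>
    using f[of \<sigma>] chainsD(2)[OF assms(3), of \<sigma>] lin_mapD(3)[OF assms(1)] by (auto split: if_splits)
  ultimately show ?thesis using that by blast
qed

text \<open>The connecting map for the exact sequence of A, F and B. Since F has no homology in
  positive degrees, it is an isomorphism except possibly at the bottom, where H_0(A) maps to H_0(F).
  Hypothesis \<open>A0\<close> says that this last map is zero; for a minimal resolution it holds
  because the syzygies lie in the irrelevant ideal times F.\<close>

lemma koszul_shift:
  assumes fin: "finite V" and h: "inj_on h V" and F: "graded_module V F" and phi: "lin_map \<phi>"
    and B: "\<And>j. B j = \<phi> ` F j" and A: "\<And>j. A j = {w \<in> F j. \<phi> w = (\<lambda>_. 0)}"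
    and Fv: "\<And>p. koszul_vanishes V h F (Suc p) j"
    and A0: "\<And>f. f \<in> kchains V A 0 j \<Longrightarrow> \<exists>g\<in>kchains V F 1 j. koszul_boundary V h g = f"
  shows "koszul_vanishes V h B (Suc p) j \<longleftrightarrow> koszul_vanishes V h A p j"
proof
  have AF: "f \<in> kchains V A p j \<longleftrightarrow> f \<in> kchains V F p j \<and> (\<lambda>\<sigma>. \<phi> (f \<sigma>)) = (\<lambda>_ _. 0)" for f p
  proof
    assume f: "f \<in> kchains V A p j"
    have "\<phi> (f \<sigma>) = (\<lambda>_. 0)" for \<sigma>
      using chainsD[OF f, of \<sigma>] A lin_mapD(3)[OF phi] by (cases "\<sigma> \<subseteq> V \<and> card \<sigma> = p") auto
    moreover have "f \<in> kchains V F p j" using chainsD[OF f] A by (intro chainsI) auto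
    ultimately show "f \<in> kchains V F p j \<and> (\<lambda>\<sigma>. \<phi> (f \<sigma>)) = (\<lambda>_ _. 0)" by simp
  next
    assume f: "f \<in> kchains V F p j \<and> (\<lambda>\<sigma>. \<phi> (f \<sigma>)) = (\<lambda>_ _. 0)"
    then have "\<phi> (f \<sigma>) = (\<lambda>_. 0)" for \<sigma> by (metis (full_types))
    then show "f \<in> kchains V A p j" using chainsD[OF conjunct1[OF f]] A by (intro chainsI) auto
  qed
  {
    assume Av: "koszul_vanishes V h A p j"
    show "koszul_vanishes V h B (Suc p) j"
      unfolding koszul_vanishes_def
    proof (intro ballI impI)
      fix z assume z: "z \<in> kchains V B (Suc p) j" "koszul_boundary V h z = (\<lambda>_ _. 0)"
      obtain y where y: "y \<in> kchains V F (Suc p) j" "z = (\<lambda>\<sigma>. \<phi> (y \<sigma>))" using chains_lift[OF phi B z(1)] .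
      have "(\<lambda>\<tau>. \<phi> (koszul_boundary V h y \<tau>)) = (\<lambda>_ _. 0)"
        using z(2) unfolding y(2) lin_map_boundary[OF phi] .
      then have "koszul_boundary V h y \<in> kchains V A p j"
        using koszul_boundary_chains[OF fin F y(1)] AF by blast
      moreover have "koszul_boundary V h (koszul_boundary V h y) = (\<lambda>_ _. 0)"
        by (rule koszul_boundary_boundary[OF fin h y(1)])
      ultimately obtain w where w: "w \<in> kchains V A (Suc p) j" "koszul_boundary V h w = koszul_boundary V h y"
        using Av unfolding koszul_vanishes_def by blast
      have wF: "w \<in> kchains V F (Suc p) j" "(\<lambda>\<sigma>. \<phi> (w \<sigma>)) = (\<lambda>_ _. 0)" using w(1) AF by blast+
      \<comment> \<open>Correcting the lift \<open>y\<close> by a chain of A makes it a cycle of F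
        without changing its image in B.\<close>
      have "koszul_boundary V h (\<lambda>\<sigma> i. y \<sigma> i - w \<sigma> i) = (\<lambda>_ _. 0)"
        unfolding koszul_boundary_diff w(2) by simp
      then obtain u where u: "u \<in> kchains V F (Suc (Suc p)) j" "koszul_boundary V h u = (\<lambda>\<sigma> i. y \<sigma> i - w \<sigma> i)"
        using Fv chains_diff[OF F y(1) wF(1)] unfolding koszul_vanishes_def by blast
      have "koszul_boundary V h (\<lambda>\<sigma>. \<phi> (u \<sigma>)) = (\<lambda>\<sigma> i. \<phi> (y \<sigma>) i - \<phi> (w \<sigma>) i)"
        unfolding lin_map_boundary[OF phi] u(2) lin_mapD(5)[OF phi] ..
      also have "\<dots> = z" using fun_cong[OF wF(2)] by (simp add: y(2))
      finally have "koszul_boundary V h (\<lambda>\<sigma>. \<phi> (u \<sigma>)) = z" .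
      moreover have "(\<lambda>\<sigma>. \<phi> (u \<sigma>)) \<in> kchains V B (Suc (Suc p)) j"
        using chains_lin_map[OF phi _ u(1)] B by blast
      ultimately show "\<exists>g\<in>kchains V B (Suc (Suc p)) j. koszul_boundary V h g = z" by blast
    qed
  }
  {
    assume Bv: "koszul_vanishes V h B (Suc p) j"
    show "koszul_vanishes V h A p j"
      unfolding koszul_vanishes_def
    proof (intro ballI impI)
      fix a assume a: "a \<in> kchains V A p j" "koszul_boundary V h a = (\<lambda>_ _. 0)"
      have aF: "a \<in> kchains V F p j" "(\<lambda>\<sigma>. \<phi> (a \<sigma>)) = (\<lambda>_ _. 0)" using a(1) AF by blast+
      have "\<exists>y\<in>kchains V F (Suc p) j. koszul_boundary V h y = a"
      proof (cases p)
        case 0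
        then show ?thesis using A0 a(1) by simp
      next
        case (Suc q)
        then show ?thesis using Fv[of q] aF(1) a(2) unfolding koszul_vanishes_def by blast
      qed
      then obtain y where y: "y \<in> kchains V F (Suc p) j" "koszul_boundary V h y = a" by blast
      have "koszul_boundary V h (\<lambda>\<sigma>. \<phi> (y \<sigma>)) = (\<lambda>_ _. 0)"
        unfolding lin_map_boundary[OF phi] y(2) by (rule aF(2))
      moreover have "(\<lambda>\<sigma>. \<phi> (y \<sigma>)) \<in> kchains V B (Suc p) j"
        using chains_lin_map[OF phi _ y(1)] B by blast
      ultimately obtain b where b: "b \<in> kchains V B (Suc (Suc p)) j" "koszul_boundary V h b = (\<lambda>\<sigma>. \<phi> (y \<sigma>))"
        using Bv unfolding koszul_vanishes_def by blast
      obtain u where u: "u \<in> kchains V F (Suc (Suc p)) j" "b = (\<lambda>\<sigma>. \<phi> (u \<sigma>))" using chains_lift[OF phi B b(1)] .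
      let ?g = "\<lambda>\<sigma> i. y \<sigma> i - koszul_boundary V h u \<sigma> i"
      have gF: "?g \<in> kchains V F (Suc p) j"
        by (rule chains_diff[OF F y(1) koszul_boundary_chains[OF fin F u(1)]])
      have "(\<lambda>\<tau>. \<phi> (koszul_boundary V h u \<tau>)) = (\<lambda>\<sigma>. \<phi> (y \<sigma>))"
        using b(2) unfolding u(2) lin_map_boundary[OF phi] .
      then have "(\<lambda>\<sigma>. \<phi> (?g \<sigma>)) = (\<lambda>_ _. 0)"
        unfolding lin_mapD(5)[OF phi] by (simp add: fun_eq_iff)
      with gF have gA: "?g \<in> kchains V A (Suc p) j" using AF[of ?g "Suc p"] by simp
      have "koszul_boundary V h ?g = a"
        unfolding koszul_boundary_diff koszul_boundary_boundary[OF fin h u(1)] y(2) by simp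
      then show "\<exists>g\<in>kchains V A (Suc p) j. koszul_boundary V h g = a"
        by (rule bexI[where P = "\<lambda>g. koszul_boundary V h g = a", OF _ gA])
    qed
  }
qed

lemma koszul_vanishes_cong:
  assumes "M (j - int p) = N (j - int p)" "M (j - int (Suc p)) = N (j - int (Suc p))"
  shows "koszul_vanishes V h M p j \<longleftrightarrow> koszul_vanishes V h N p j"
proof -
  have "kchains V M p j = kchains V N p j" "kchains V M (Suc p) j = kchains V N (Suc p) j"
    using assms by (simp_all add: kchains_def)
  then show ?thesis by (simp add: koszul_vanishes_def)
qed

text \<open>This plays the part of Hilbert's syzygy theorem in bounding the homological degrees with
  nonzero Betti numbers.\<close>

lemma koszul_vanishes_above:
  assumes fin: "finite V" and M: "graded_module V M" and p: "card V < p"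
  shows "koszul_vanishes V h M p j"
  unfolding koszul_vanishes_def
proof (intro ballI impI)
  fix f assume f: "f \<in> kchains V M p j"
  have "f = (\<lambda>_ _. 0)"
  proof
    fix \<sigma> show "f \<sigma> = (\<lambda>_. 0)"
      using card_mono[OF fin, of \<sigma>] p by (intro chainsD(2)[OF f]) auto
  qed
  then have "koszul_boundary V h (\<lambda>_ _. 0) = f" by (simp add: koszul_boundary_def)
  moreover have "(\<lambda>_ _. 0) \<in> kchains V M (Suc p) j" using graded_moduleD(1)[OF M] by (intro chainsI) auto
  ultimately show "\<exists>g\<in>kchains V M (Suc p) j. koszul_boundary V h g = f"
    by (rule bexI[where P = "\<lambda>g. koszul_boundary V h g = f"])
qed

text \<open>A chain of degree 0 bounds iff its value lies in the irrelevant ideal times M. The chain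
  comes from a second family N because syzygies are to be bounded inside the larger free
  module.\<close>

lemma koszul_0_boundary_iff:
  assumes fin: "finite V" and M: "graded_module V M" and f: "f \<in> kchains V N 0 j"
  shows "(\<exists>g\<in>kchains V M 1 j. koszul_boundary V h g = f) \<longleftrightarrow>
    (\<exists>u. (\<forall>v\<in>V. u v \<in> M (j - 1)) \<and> f {} = (\<lambda>i. \<Sum>v\<in>V. pvar v * u v i))"
proof
  assume "\<exists>g\<in>kchains V M 1 j. koszul_boundary V h g = f"
  then obtain g where g: "g \<in> kchains V M 1 j" "koszul_boundary V h g = f" by blast
  have "f {} = (\<lambda>i. \<Sum>v\<in>V. pvar v * g {v} i)"
    unfolding g(2)[symmetric] by (simp add: koszul_boundary_def ksign_def)
  moreover have "\<forall>v\<in>V. g {v} \<in> M (j - 1)" using chainsD(1)[OF g(1)] by auto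
  ultimately show "\<exists>u. (\<forall>v\<in>V. u v \<in> M (j - 1)) \<and> f {} = (\<lambda>i. \<Sum>v\<in>V. pvar v * u v i)"
    by (intro exI[of _ "\<lambda>v. g {v}"] conjI)
next
  assume "\<exists>u. (\<forall>v\<in>V. u v \<in> M (j - 1)) \<and> f {} = (\<lambda>i. \<Sum>v\<in>V. pvar v * u v i)"
  then obtain u where u': "(\<forall>v\<in>V. u v \<in> M (j - 1)) \<and> f {} = (\<lambda>i. \<Sum>v\<in>V. pvar v * u v i)" ..
  then have u: "\<And>v. v \<in> V \<Longrightarrow> u v \<in> M (j - 1)" "f {} = (\<lambda>i. \<Sum>v\<in>V. pvar v * u v i)" by simp_all
  define g where "g \<sigma> = (if \<sigma> \<subseteq> V \<and> card \<sigma> = 1 then u (the_elem \<sigma>) else (\<lambda>_. 0))" for \<sigma>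
  have g1: "g {v} = u v" if "v \<in> V" for v using that by (simp add: g_def)
  have g: "g \<in> kchains V M 1 j"
  proof (rule chainsI)
    fix \<sigma> assume "\<sigma> \<subseteq> V" "card \<sigma> = 1"
    then obtain v where "\<sigma> = {v}" "v \<in> V" by (metis card_1_singletonE insert_subset)
    then show "g \<sigma> \<in> M (j - int 1)" using g1 u(1) by simp
  qed (auto simp: g_def)
  have "koszul_boundary V h g \<tau> = f \<tau>" for \<tau>
  proof (cases "\<tau> = {}")
    case True
    have "koszul_boundary V h g {} = (\<lambda>i. \<Sum>v\<in>V. pvar v * u v i)"
      unfolding koszul_boundary_def using g1 by (intro ext) (simp add: ksign_def)
    then show ?thesis using True u(2) by simp
  next
    case False
    have "g (insert v \<tau>) = (\<lambda>_. 0)" if "v \<notin> \<tau>" for v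
    proof -
      have "\<not> (\<exists>x. insert v \<tau> = {x})" using that False by auto
      then have "card (insert v \<tau>) \<noteq> 1" by (metis card_1_singletonE)
      then show ?thesis by (simp add: g_def)
    qed
    then have "koszul_boundary V h g \<tau> = (\<lambda>_. 0)" by (simp add: koszul_boundary_def)
    moreover have "f \<tau> = (\<lambda>_. 0)"
      using fin False finite_subset[of \<tau> V] by (intro chainsD(2)[OF f]) auto
    ultimately show ?thesis by simp
  qed
  then have "koszul_boundary V h g = f" by (rule ext)
  then show "\<exists>g\<in>kchains V M 1 j. koszul_boundary V h g = f"
    by (rule bexI[where P = "\<lambda>g. koszul_boundary V h g = f", OF _ g])
qed

section \<open>Homogeneous polynomials\<close>

lemma mon_deg_superset: "finite S \<Longrightarrow> keys m \<subseteq> S \<Longrightarrow> mon_deg m = (\<Sum>v\<in>S. lookup m v)"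
  unfolding mon_deg_def by (intro sum.mono_neutral_left) (auto simp: in_keys_iff)

lemma mon_deg_add: "mon_deg (a + b) = mon_deg a + mon_deg b"
proof -
  let ?S = "keys a \<union> keys b"
  have "mon_deg (a + b) = (\<Sum>v\<in>?S. lookup (a + b) v)"
    by (intro mon_deg_superset) (auto simp: keys_add_nat)
  also have "\<dots> = (\<Sum>v\<in>?S. lookup a v) + (\<Sum>v\<in>?S. lookup b v)"
    by (simp add: lookup_add sum.distrib)
  also have "\<dots> = mon_deg a + mon_deg b"
    by (simp add: mon_deg_superset[of ?S a] mon_deg_superset[of ?S b])
  finally show ?thesis .
qed

lemma mon_deg_single [simp]: "mon_deg (single v n) = n"
  by (cases "n = 0") (auto simp: mon_deg_def)

lemma mon_deg_0 [simp]: "mon_deg 0 = 0"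
  by (simp add: mon_deg_def)

lemma mon_deg_eq_0: "mon_deg m = 0 \<longleftrightarrow> m = 0"
  by (auto simp: mon_deg_def in_keys_iff intro: poly_mapping_eqI)

lemma homogeneous_0 [simp]: "homogeneous d 0"
  by (simp add: homogeneous_def)

lemma homogeneous_add: "homogeneous d p \<Longrightarrow> homogeneous d q \<Longrightarrow> homogeneous d (p + q)"
  using Poly_Mapping.keys_add[of p q] by (auto simp: homogeneous_def)

lemma homogeneous_uminus: "homogeneous d p \<Longrightarrow> homogeneous d (- p)"
  by (simp add: homogeneous_def in_keys_iff)

lemma homogeneous_mult:
  assumes "homogeneous d p" "homogeneous e q"
  shows "homogeneous (d + e) (p * q)"
  unfolding homogeneous_def
proof
  fix m assume "m \<in> keys (p * q)"
  then obtain a b where "m = a + b" "a \<in> keys p" "b \<in> keys q"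
    using keys_mult[of p q] by blast
  then show "int (mon_deg m) = d + e" using assms by (simp add: homogeneous_def mon_deg_add)
qed

lemma homogeneous_single: "homogeneous (int (mon_deg m)) (single m c)"
  by (auto simp: homogeneous_def split: if_splits)

lemma homogeneous_pvar: "homogeneous 1 (pvar v)"
  using homogeneous_single[of "single v 1" 1] by (simp add: pvar_def)

lemma homogeneous_sum: "(\<And>x. x \<in> S \<Longrightarrow> homogeneous d (f x)) \<Longrightarrow> homogeneous d (sum f S)"
  by (induction S rule: infinite_finite_induct) (auto intro: homogeneous_add)

lemma carrier_add: "p \<in> carrier (poly_ring V) \<Longrightarrow> q \<in> carrier (poly_ring V) \<Longrightarrow> p + q \<in> carrier (poly_ring V)"
  unfolding carrier_poly_ring by (rule mon_ideal_add)

lemma carrier_uminus: "p \<in> carrier (poly_ring V) \<Longrightarrow> - p \<in> carrier (poly_ring V)"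
  unfolding carrier_poly_ring by (rule mon_ideal_uminus)

lemma carrier_mult: "p \<in> carrier (poly_ring V) \<Longrightarrow> q \<in> carrier (poly_ring V) \<Longrightarrow> p * q \<in> carrier (poly_ring V)"
  unfolding carrier_poly_ring using mon_ideal_mult[of p V "\<lambda>_. True" q "\<lambda>_. True"]
  by (rule subsetD[OF mon_ideal_mono, rotated]) simp_all

lemma carrier_0: "0 \<in> carrier (poly_ring V)"
  unfolding carrier_poly_ring by (rule mon_ideal_0)

lemma carrier_1: "1 \<in> carrier (poly_ring V)"
  by (simp add: carrier_poly_ring mon_ideal_def)

lemma carrier_pvar: "v \<in> V \<Longrightarrow> pvar v \<in> carrier (poly_ring V)"
  unfolding carrier_poly_ring pvar_def by (rule mon_ideal_single) auto

definition hom_comp :: "int \<Rightarrow> ('v, 'k::field) mpoly \<Rightarrow> ('v, 'k) mpoly" where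
  "hom_comp d p = (\<Sum>m | m \<in> keys p \<and> int (mon_deg m) = d. single m (lookup p m))"

lemma lookup_hom_comp: "lookup (hom_comp d p) m = (if int (mon_deg m) = d then lookup p m else 0)"
proof -
  let ?K = "{m. m \<in> keys p \<and> int (mon_deg m) = d}"
  have fin: "finite ?K" by (rule finite_subset[OF _ finite_keys[of p]]) auto
  have "lookup (hom_comp d p) m = (\<Sum>n\<in>?K. if n = m then lookup p m else 0)"
    unfolding hom_comp_def lookup_sum by (intro sum.cong) (auto simp: lookup_single when_def)
  also have "\<dots> = (if m \<in> ?K then lookup p m else 0)"
    using fin by (rule sum.delta)
  finally show ?thesis by (auto simp: in_keys_iff)
qed

lemma hom_comp_add: "hom_comp d (p + q) = hom_comp d p + hom_comp d q"
  by (intro poly_mapping_eqI) (simp add: lookup_hom_comp lookup_add)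

lemma hom_comp_0 [simp]: "hom_comp d 0 = 0"
  by (intro poly_mapping_eqI) (simp add: lookup_hom_comp)

lemma hom_comp_sum: "hom_comp d (sum f S) = (\<Sum>x\<in>S. hom_comp d (f x))"
  by (induction S rule: infinite_finite_induct) (auto simp: hom_comp_add)

lemma homogeneous_hom_comp: "homogeneous d (hom_comp d p)"
  by (auto simp: homogeneous_def in_keys_iff lookup_hom_comp split: if_splits)

lemma hom_comp_mon_ideal: "p \<in> mon_ideal V A \<Longrightarrow> hom_comp d p \<in> mon_ideal V A"
  by (auto simp: mon_ideal_def in_keys_iff lookup_hom_comp split: if_splits)

lemma hom_comp_carrier: "p \<in> carrier (poly_ring V) \<Longrightarrow> hom_comp d p \<in> carrier (poly_ring V)"
  unfolding carrier_poly_ring by (rule hom_comp_mon_ideal)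

lemma hom_comp_homogeneous: "homogeneous e p \<Longrightarrow> hom_comp d p = (if d = e then p else 0)"
  by (intro poly_mapping_eqI) (auto simp: lookup_hom_comp homogeneous_def in_keys_iff)

lemma hom_comp_mult:
  assumes "homogeneous e a"
  shows "hom_comp d (a * p) = a * hom_comp (d - e) p"
proof -
  define r where "r = p - hom_comp (d - e) p"
  have r: "int (mon_deg m) \<noteq> d - e" if "m \<in> keys r" for m
    using that by (auto simp: r_def in_keys_iff lookup_minus lookup_hom_comp)
  have "hom_comp d (a * r) = 0"
  proof (rule poly_mapping_eqI)
    fix m
    have "m \<notin> keys (a * r)" if "int (mon_deg m) = d"
    proof
      assume "m \<in> keys (a * r)"
      then obtain b c where "m = b + c" "b \<in> keys a" "c \<in> keys r"
        using keys_mult[of a r] by blast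
      then show False using assms r[of c] that by (auto simp: homogeneous_def mon_deg_add)
    qed
    then show "lookup (hom_comp d (a * r)) m = lookup 0 m"
      by (auto simp: lookup_hom_comp in_keys_iff)
  qed
  moreover have "hom_comp d (a * hom_comp (d - e) p) = a * hom_comp (d - e) p"
    using homogeneous_mult[OF assms homogeneous_hom_comp[of "d - e" p]]
    by (simp add: hom_comp_homogeneous)
  moreover have "a * p = a * hom_comp (d - e) p + a * r" by (simp add: r_def algebra_simps)
  ultimately show ?thesis by (simp add: hom_comp_add)
qed

lemma lookup_mult_0:
  fixes p q :: "('v, 'k::field) mpoly"
  shows "lookup (p * q) 0 = lookup p 0 * lookup q 0"
proof -
  have "a = 0 \<and> b = 0" if "a + b = 0 + (0 :: 'v \<Rightarrow>\<^sub>0 nat)" for a b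
  proof -
    have "mon_deg a + mon_deg b = 0" using that by (metis add.right_neutral mon_deg_0 mon_deg_add)
    then show ?thesis by (simp add: mon_deg_eq_0)
  qed
  note zero = this
  have "lookup (p * q) (0 + 0) = lookup p 0 * lookup q 0"
    by (rule lookup_mult_unique) (rule zero)
  then show ?thesis by simp
qed

text \<open>Every monomial of \<open>p\<close> is divisible by some variable; choosing one for each
  monomial distributes \<open>p\<close> over \<open>V\<close>.\<close>

lemma irrelevant_decomposition:
  fixes p :: "('v, 'k::field) mpoly"
  assumes fin: "finite V" and p: "p \<in> carrier (poly_ring V)" "homogeneous d p" "lookup p 0 = 0"
  shows "\<exists>q. (\<forall>v\<in>V. q v \<in> carrier (poly_ring V) \<and> homogeneous (d - 1) (q v)) \<and> p = (\<Sum>v\<in>V. pvar v * q v)"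
proof -
  let ?J = "{p. \<exists>q. (\<forall>v\<in>V. q v \<in> carrier (poly_ring V) \<and> homogeneous (d - 1) (q v)) \<and> p = (\<Sum>v\<in>V. pvar v * q v)}
    :: ('v, 'k) mpoly set"
  have "(\<Sum>m\<in>keys p. single m (lookup p m)) \<in> ?J"
  proof (rule sum_closed)
    show "0 \<in> ?J" by (rule CollectI, rule exI[of _ "\<lambda>_. 0"]) (simp add: carrier_0)
  next
    fix p p' assume "p \<in> ?J" "p' \<in> ?J"
    then obtain q q' where "\<forall>v\<in>V. q v \<in> carrier (poly_ring V) \<and> homogeneous (d - 1) (q v)" "p = (\<Sum>v\<in>V. pvar v * q v)"
      "\<forall>v\<in>V. q' v \<in> carrier (poly_ring V) \<and> homogeneous (d - 1) (q' v)" "p' = (\<Sum>v\<in>V. pvar v * q' v)" by blast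
    then show "p + p' \<in> ?J"
      by (intro CollectI exI[of _ "\<lambda>v. q v + q' v"])
        (simp add: carrier_add homogeneous_add distrib_left sum.distrib)
  next
    fix m assume m: "m \<in> keys p"
    then have "m \<noteq> 0" using p(3) by (auto simp: in_keys_iff)
    then obtain v where v: "v \<in> keys m" by (metis ex_in_conv keys_eq_empty)
    have mV: "keys m \<subseteq> V" using p(1) m by (auto simp: carrier_poly_ring mon_ideal_def)
    let ?c = "lookup p m" and ?n = "m - single v 1"
    have meq: "m = single v 1 + ?n"
      using v by (intro lookup_le_imp_add) (auto simp: lookup_single when_def in_keys_iff)
    have "keys ?n \<subseteq> V" using mV keys_add_nat[of "single v 1" ?n] meq by auto
    then have c: "single ?n ?c \<in> carrier (poly_ring V)"
      unfolding carrier_poly_ring by (rule mon_ideal_single) simp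
    have "int (mon_deg m) = d" using p(2) m by (simp add: homogeneous_def)
    moreover have "mon_deg m = 1 + mon_deg ?n" using mon_deg_add[of "single v 1" ?n] meq by simp
    ultimately have "int (mon_deg ?n) = d - 1" by simp
    then have h: "homogeneous (d - 1) (single ?n ?c)" using homogeneous_single[of ?n ?c] by simp
    have "(\<Sum>w\<in>V. pvar w * (if w = v then single ?n ?c else 0)) =
        (\<Sum>w\<in>V. if w = v then pvar v * single ?n ?c else 0)"
      by (intro sum.cong) auto
    also have "\<dots> = pvar v * single ?n ?c" using fin v mV by (simp add: subset_iff)
    also have "\<dots> = single m ?c" unfolding pvar_def mult_single meq[symmetric] by simp
    finally show "single m ?c \<in> ?J"
      using c h by (intro CollectI exI[of _ "\<lambda>w. if w = v then single ?n ?c else 0"]) (simp add: carrier_0)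
  qed
  then show ?thesis using poly_eq_sum_single[of p] by simp
qed

section \<open>Free modules have no higher Koszul homology\<close>

definition free_comp :: "'v set \<Rightarrow> int list \<Rightarrow> int \<Rightarrow> ('v, 'k::field) pvec set" where
  "free_comp V ds j = {w. \<forall>i. if i < length ds
     then w i \<in> carrier (poly_ring V) \<and> homogeneous (j - ds ! i) (w i) else w i = 0}"

lemma free_compD:
  assumes "w \<in> free_comp V ds j"
  shows "w i \<in> carrier (poly_ring V)" "i < length ds \<Longrightarrow> homogeneous (j - ds ! i) (w i)"
    "length ds \<le> i \<Longrightarrow> w i = 0"
proof -
  have *: "if i < length ds then w i \<in> carrier (poly_ring V) \<and> homogeneous (j - ds ! i) (w i) else w i = 0"
    using assms by (simp add: free_comp_def)
  then show "w i \<in> carrier (poly_ring V)" using carrier_0 by (auto split: if_splits)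
  show "i < length ds \<Longrightarrow> homogeneous (j - ds ! i) (w i)" "length ds \<le> i \<Longrightarrow> w i = 0"
    using * by simp_all
qed

lemma free_compI:
  assumes "\<And>i. i < length ds \<Longrightarrow> w i \<in> carrier (poly_ring V)"
    "\<And>i. i < length ds \<Longrightarrow> homogeneous (j - ds ! i) (w i)" "\<And>i. length ds \<le> i \<Longrightarrow> w i = 0"
  shows "w \<in> free_comp V ds j"
  using assms by (simp add: free_comp_def)

lemma graded_module_free_comp: "graded_module V (free_comp V ds)"
  unfolding graded_module_def
proof (intro conjI allI impI ballI)
  fix j v and w :: "('a, 'b) pvec" assume v: "v \<in> V" and w: "w \<in> free_comp V ds j"
  show "(\<lambda>i. pvar v * w i) \<in> free_comp V ds (j + 1)"
  proof (rule free_compI)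
    fix i assume "i < length ds"
    then show "homogeneous (j + 1 - ds ! i) (pvar v * w i)"
      using homogeneous_mult[OF homogeneous_pvar free_compD(2)[OF w], of i v] by (simp add: algebra_simps)
  qed (use free_compD[OF w] v in \<open>auto intro: carrier_mult carrier_pvar\<close>)
qed (auto intro!: free_compI intro: carrier_0 carrier_add carrier_uminus homogeneous_add homogeneous_uminus
      dest: free_compD simp: free_compD(3))

lemma pm_diff_add_swap:
  fixes a :: "'v \<Rightarrow>\<^sub>0 nat"
  assumes "w \<in> keys a"
  shows "a - single w 1 + single v 1 = a + single v 1 - single w 1"
    "a - single w 1 + single w 1 = a"
    "insert w (keys (a - single w 1)) = keys a"
  using assms
  by (auto intro!: poly_mapping_eqI simp: lookup_add lookup_minus lookup_single when_def in_keys_iff split: if_splits)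

text \<open>The contracting homotopy works one multidegree at a time: it divides by a variable chosen in the
  support of the multidegree, so it needs no division by scalars.\<close>

lemma koszul_vanishes_free:
  assumes fin: "finite (V :: 'v set)" and h: "inj_on h V"
  shows "koszul_vanishes V h (free_comp V ds :: int \<Rightarrow> ('v, 'k::field) pvec set) (Suc p) j"
  unfolding koszul_vanishes_def
proof (intro ballI impI)
  let ?F = "free_comp V ds :: int \<Rightarrow> ('v, 'k) pvec set"
  fix f assume f: "f \<in> kchains V ?F (Suc p) j" and cyc: "koszul_boundary V h f = (\<lambda>_ _. 0)"
  \<comment> \<open>The homotopy must use the same variable for all terms of one multidegree. The
    set \<open>keys a \<union> \<tau>\<close> is the support of the multidegree of x^a times the
    exterior monomial on \<tau>, and the boundary leaves it unchanged.\<close>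
  define ch :: "'v set \<Rightarrow> 'v" where "ch S = (SOME v. v \<in> S)" for S
  have ch: "ch S \<in> S" if "S \<noteq> {}" for S using that unfolding ch_def by (rule some_in_eq[THEN iffD2])
  define c where "c \<tau> i a = (let v = ch (keys a \<union> \<tau>) in if v \<in> \<tau>
      then ksign h v (\<tau> - {v}) * lookup (f (\<tau> - {v}) i) (a + single v 1) else 0)"
    for \<tau> :: "'v set" and i and a :: "'v \<Rightarrow>\<^sub>0 nat"
  have cE: "\<exists>v\<in>\<tau>. a + single v 1 \<in> keys (f (\<tau> - {v}) i)"
    if "c \<tau> i a \<noteq> 0" for \<tau> i a
    using that by (auto simp: c_def Let_def in_keys_iff split: if_splits)
  define g where "g \<tau> i = (if \<tau> \<subseteq> V then Abs_poly_mapping (c \<tau> i) else 0)" for \<tau> i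
  have g: "lookup (g \<tau> i) a = c \<tau> i a" if "\<tau> \<subseteq> V" for \<tau> i a
  proof -
    \<comment> \<open>Finite support makes \<open>Abs_poly_mapping\<close> return the intended
      coefficients: every exponent arises from a term of \<open>f\<close> by removing one
      variable.\<close>
    have "{a. c \<tau> i a \<noteq> 0} \<subseteq> (\<Union>v\<in>\<tau>. (\<lambda>b. b - single v 1) ` keys (f (\<tau> - {v}) i))"
    proof
      fix a assume "a \<in> {a. c \<tau> i a \<noteq> 0}"
      then obtain v where v: "v \<in> \<tau>" "a + single v 1 \<in> keys (f (\<tau> - {v}) i)"
        using cE by blast
      have "a = (a + single v 1) - single v 1" by simp
      then show "a \<in> (\<Union>v\<in>\<tau>. (\<lambda>b. b - single v 1) ` keys (f (\<tau> - {v}) i))"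
        using v by blast
    qed
    moreover have "finite \<tau>" using that fin by (rule finite_subset)
    ultimately have "finite {a. c \<tau> i a \<noteq> 0}" by (elim finite_subset) auto
    then show ?thesis using that by (simp add: g_def)
  qed
  have fcar: "f \<sigma> i \<in> carrier (poly_ring V)" for \<sigma> i
    using chainsD[OF f, of \<sigma>] free_compD(1)[of "f \<sigma>" V ds _ i] carrier_0
    by (cases "\<sigma> \<subseteq> V \<and> card \<sigma> = Suc p") auto
  have gF: "g \<in> kchains V ?F (Suc (Suc p)) j"
  proof (rule chainsI)
    fix \<tau> assume \<tau>: "\<tau> \<subseteq> V" "card \<tau> = Suc (Suc p)"
    have f\<tau>: "f (\<tau> - {v}) \<in> ?F (j - int (Suc p))" if "v \<in> \<tau>" for v
      using that \<tau> finite_subset[OF \<tau>(1) fin] by (intro chainsD(1)[OF f]) auto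
    show "g \<tau> \<in> ?F (j - int (Suc (Suc p)))"
    proof (rule free_compI)
      fix i assume i: "i < length ds"
      have key: "keys a \<subseteq> V \<and> int (mon_deg a) = j - int (Suc (Suc p)) - ds ! i"
        if a: "a \<in> keys (g \<tau> i)" for a
      proof -
        have "c \<tau> i a \<noteq> 0" using a g[OF \<tau>(1)] by (simp add: in_keys_iff)
        then obtain v where v: "v \<in> \<tau>" "a + single v 1 \<in> keys (f (\<tau> - {v}) i)"
          using cE by blast
        have "keys (a + single v 1) \<subseteq> V"
          using fcar[of "\<tau> - {v}" i] v(2) by (auto simp: carrier_poly_ring mon_ideal_def)
        moreover have "int (mon_deg (a + single v 1)) = j - int (Suc p) - ds ! i"
          using free_compD(2)[OF f\<tau>[OF v(1)] i] v(2) by (simp add: homogeneous_def)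
        ultimately show ?thesis by (simp add: keys_add_nat mon_deg_add)
      qed
      then show "g \<tau> i \<in> carrier (poly_ring V)" by (simp add: carrier_poly_ring mon_ideal_def)
      show "homogeneous (j - int (Suc (Suc p)) - ds ! i) (g \<tau> i)" using key by (simp add: homogeneous_def)
    next
      fix i assume i: "length ds \<le> i"
      have "c \<tau> i a = 0" for a
        using free_compD(3)[OF f\<tau> i] by (auto simp: c_def Let_def)
      then show "g \<tau> i = 0" using g[OF \<tau>(1)] by (intro poly_mapping_eqI) simp
    qed
  next
    fix \<tau> assume \<tau>: "\<not> (\<tau> \<subseteq> V \<and> card \<tau> = Suc (Suc p))"
    show "g \<tau> = (\<lambda>_. 0)"
    proof (cases "\<tau> \<subseteq> V")
      case True
      have f0: "f (\<tau> - {v}) = (\<lambda>_. 0)" if "v \<in> \<tau>" for v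
      proof (rule chainsD(2)[OF f])
        have "card \<tau> = Suc (card (\<tau> - {v}))"
          using card_Suc_Diff1[OF finite_subset[OF True fin] that] by simp
        then show "\<not> (\<tau> - {v} \<subseteq> V \<and> card (\<tau> - {v}) = Suc p)" using \<tau> True by simp
      qed
      have "c \<tau> i a = 0" for i a using f0 by (auto simp: c_def Let_def)
      then have "g \<tau> i = 0" for i using g[OF True] by (intro poly_mapping_eqI) simp
      then show ?thesis by (rule ext)
    qed (simp add: g_def fun_eq_iff)
  qed
  have "koszul_boundary V h g \<sigma> i = f \<sigma> i" for \<sigma> i
  proof (cases "\<sigma> \<subseteq> V")
    case False
    then have "g (insert w \<sigma>) = (\<lambda>_. 0)" for w by (simp add: g_def fun_eq_iff)
    moreover have "f \<sigma> = (\<lambda>_. 0)" using False by (intro chainsD(2)[OF f]) simp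
    ultimately show ?thesis by (simp add: koszul_boundary_def)
  next
    case True
    have fin\<sigma>: "finite \<sigma>" using True fin by (rule finite_subset)
    show ?thesis
    proof (rule poly_mapping_eqI)
      fix a :: "'v \<Rightarrow>\<^sub>0 nat"
      let ?S = "keys a \<union> \<sigma>"
      have bd: "lookup (koszul_boundary V h g \<sigma> i) a = (\<Sum>w\<in>V - \<sigma>. if w \<in> keys a
          then ksign h w \<sigma> * c (insert w \<sigma>) i (a - single w 1) else 0)"
        unfolding koszul_boundary_def lookup_sum
      proof (rule sum.cong[OF refl])
        fix w assume "w \<in> V - \<sigma>"
        then have "insert w \<sigma> \<subseteq> V" using True by simp
        then show "lookup (ksign h w \<sigma> * pvar w * g (insert w \<sigma>) i) a = (if w \<in> keys a
          then ksign h w \<sigma> * c (insert w \<sigma>) i (a - single w 1) else 0)"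
          by (simp add: mult.assoc lookup_ksign_mult lookup_pvar_mult g del: One_nat_def)
      qed
      show "lookup (koszul_boundary V h g \<sigma> i) a = lookup (f \<sigma> i) a"
      proof (cases "?S = {}")
        case S: True
        then have "f \<sigma> = (\<lambda>_. 0)" by (intro chainsD(2)[OF f]) simp
        then show ?thesis unfolding bd using S by auto
      next
        case S: False
        define v where "v = ch ?S"
        have vS: "v \<in> ?S" unfolding v_def using S by (rule ch)
        have cw: "c (insert w \<sigma>) i (a - single w 1) = (if v \<in> insert w \<sigma>
            then ksign h v (insert w \<sigma> - {v}) * lookup (f (insert w \<sigma> - {v}) i)
              (a - single w 1 + single v 1) else 0)"
          if "w \<in> keys a" for w
        proof -
          have "keys (a - single w 1) \<union> insert w \<sigma> = ?S"
            using pm_diff_add_swap(3)[OF that] by blast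
          then show ?thesis by (simp add: c_def Let_def v_def)
        qed
        show ?thesis
        proof (cases "v \<in> \<sigma>")
          case v\<sigma>: False
          then have va: "v \<in> keys a" using vS by simp
          \<comment> \<open>For v outside \<sigma> only the term w = v survives, since the homotopy
            is zero on sets without v.\<close>
          have "lookup (koszul_boundary V h g \<sigma> i) a =
              (\<Sum>w\<in>V - \<sigma>. if w = v then lookup (f \<sigma> i) a else 0)"
            unfolding bd
          proof (rule sum.cong[OF refl])
            fix w assume "w \<in> V - \<sigma>"
            show "(if w \<in> keys a then ksign h w \<sigma> * c (insert w \<sigma>) i (a - single w 1) else 0)
                = (if w = v then lookup (f \<sigma> i) a else 0)"
            proof (cases "w = v")
              case True
              have "insert v \<sigma> - {v} = \<sigma>" using v\<sigma> by blast
              then show ?thesis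
                using True va cw[OF va] pm_diff_add_swap(2)[OF va]
                by (simp add: mult.assoc[symmetric] ksign_square del: One_nat_def)
            next
              case False
              then show ?thesis using cw[of w] v\<sigma> by auto
            qed
          qed
          also have "\<dots> = (if v \<in> V - \<sigma> then lookup (f \<sigma> i) a else 0)"
            using fin by (simp add: sum.delta)
          also have "\<dots> = lookup (f \<sigma> i) a"
          proof (cases "v \<in> V")
            case False
            then have "a \<notin> keys (f \<sigma> i)"
              using va fcar[of \<sigma> i] by (auto simp: carrier_poly_ring mon_ideal_def)
            then show ?thesis using False by (simp add: in_keys_iff)
          qed (use v\<sigma> in simp)
          finally show ?thesis .
        next
          case v\<sigma>: True
          define \<tau> where "\<tau> = \<sigma> - {v}"
          have \<sigma>: "\<sigma> = insert v \<tau>" "v \<notin> \<tau>" and fin\<tau>: "finite \<tau>" and vV: "v \<in> V"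
            using v\<sigma> fin\<sigma> True by (auto simp: \<tau>_def)
          let ?b = "a + single v (1::nat)"
          define X where "X w = (if w \<in> keys a
              then ksign h w \<tau> * lookup (f (insert w \<tau>) i) (?b - single w 1) else 0)" for w
          \<comment> \<open>The cycle condition at \<sigma> without v and exponent
            \<open>?b\<close>: its term for w = v is the wanted coefficient, and the other terms
            reappear, with adjusted signs, in the boundary of \<open>g\<close>.\<close>
          have "0 = lookup (koszul_boundary V h f \<tau> i) ?b" using cyc by simp
          also have "\<dots> = (\<Sum>w\<in>V - \<tau>. if w \<in> keys ?b
              then ksign h w \<tau> * lookup (f (insert w \<tau>) i) (?b - single w 1) else 0)"
            unfolding koszul_boundary_def lookup_sum
            by (rule sum.cong[OF refl])
              (simp add: mult.assoc lookup_ksign_mult lookup_pvar_mult del: One_nat_def)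
          also have "V - \<tau> = insert v (V - \<sigma>)" using \<sigma> vV by blast
          also have "(\<Sum>w\<in>insert v (V - \<sigma>). if w \<in> keys ?b
              then ksign h w \<tau> * lookup (f (insert w \<tau>) i) (?b - single w 1) else 0)
              = ksign h v \<tau> * lookup (f \<sigma> i) a + (\<Sum>w\<in>V - \<sigma>. if w \<in> keys ?b
              then ksign h w \<tau> * lookup (f (insert w \<tau>) i) (?b - single w 1) else 0)"
            using fin \<sigma> by (subst sum.insert) (auto simp: keys_add_nat)
          also have "(\<Sum>w\<in>V - \<sigma>. if w \<in> keys ?b
              then ksign h w \<tau> * lookup (f (insert w \<tau>) i) (?b - single w 1) else 0)
              = sum X (V - \<sigma>)"
            using v\<sigma> by (intro sum.cong refl) (auto simp: X_def keys_add_nat split: if_splits)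
          finally have eq: "ksign h v \<tau> * lookup (f \<sigma> i) a = - sum X (V - \<sigma>)"
            by (simp add: eq_neg_iff_add_eq_0)
          have "lookup (f \<sigma> i) a = ksign h v \<tau> * (ksign h v \<tau> * lookup (f \<sigma> i) a)"
            by (simp add: mult.assoc[symmetric] ksign_square)
          also have "\<dots> = (\<Sum>w\<in>V - \<sigma>. - (ksign h v \<tau> * X w))"
            unfolding eq by (simp add: sum_distrib_left sum_negf)
          also have "\<dots> = lookup (koszul_boundary V h g \<sigma> i) a"
            unfolding bd
          proof (rule sum.cong[OF refl])
            fix w assume w: "w \<in> V - \<sigma>"
            show "- (ksign h v \<tau> * X w) = (if w \<in> keys a
                then ksign h w \<sigma> * c (insert w \<sigma>) i (a - single w 1) else 0)"
            proof (cases "w \<in> keys a")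
              case wa: True
              have neq: "v \<noteq> w" "w \<notin> \<tau>" "w \<in> V" using w \<sigma> by auto
              let ?A = "ksign h v \<tau> :: 'k" and ?B = "ksign h w \<sigma> :: 'k"
                and ?C = "ksign h w \<tau> :: 'k" and ?D = "ksign h v (insert w \<tau>) :: 'k"
              have sw: "?A * ?B = - (?C * ?D)"
                unfolding \<sigma>(1) by (rule ksign_swap[OF h vV neq(3,1) fin\<tau> \<sigma>(2) neq(2)])
              have "?B * ?D = (?A * ?A) * (?B * ?D)" by (simp add: ksign_square)
              also have "\<dots> = ?A * ((?A * ?B) * ?D)" by (simp add: mult.assoc)
              also have "\<dots> = - (?A * ?C * (?D * ?D))" unfolding sw by (simp add: mult.assoc)
              finally have BD: "?B * ?D = - (?A * ?C)" by (simp add: ksign_square)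
              have ins: "insert w \<sigma> - {v} = insert w \<tau>" using neq \<sigma> by blast
              have "ksign h w \<sigma> * c (insert w \<sigma>) i (a - single w 1) =
                  (?B * ?D) * lookup (f (insert w \<tau>) i) (?b - single w 1)"
                using cw[OF wa] v\<sigma> ins pm_diff_add_swap(1)[OF wa, of v]
                by (simp add: mult.assoc del: One_nat_def)
              then show ?thesis unfolding BD using wa by (simp add: X_def mult.assoc)
            qed (simp add: X_def)
          qed
          finally show ?thesis by simp
        qed
      qed
    qed
  qed
  then have "koszul_boundary V h g = f" by (intro ext)
  then show "\<exists>g\<in>kchains V ?F (Suc (Suc p)) j. koszul_boundary V h g = f"
    by (rule bexI[where P = "\<lambda>g. koszul_boundary V h g = f", OF _ gF])
qed

section \<open>Minimal resolutions and Koszul homology\<close>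

definition lmap :: "nat \<Rightarrow> (nat \<Rightarrow> nat \<Rightarrow> ('v, 'k::field) mpoly) \<Rightarrow> ('v, 'k) pvec \<Rightarrow> ('v, 'k) pvec" where
  "lmap b a w = (\<lambda>r. \<Sum>c<b. a r c * w c)"

lemma lin_map_lmap: "lin_map (lmap b a)"
  by (simp add: lin_map_def lmap_def fun_eq_iff distrib_left sum.distrib sum_distrib_left mult.left_commute)

definition free_vecs :: "'v set \<Rightarrow> nat \<Rightarrow> ('v, 'k::field) pvec set" where
  "free_vecs V b = {w. \<forall>i. if i < b then w i \<in> carrier (poly_ring V) else w i = 0}"

lemma free_vecsD:
  assumes "w \<in> free_vecs V b"
  shows "w i \<in> carrier (poly_ring V)" "b \<le> i \<Longrightarrow> w i = 0"
proof -
  have *: "if i < b then w i \<in> carrier (poly_ring V) else w i = 0"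
    using assms by (simp add: free_vecs_def)
  then show "w i \<in> carrier (poly_ring V)" "b \<le> i \<Longrightarrow> w i = 0"
    using carrier_0 by (auto split: if_splits)
qed

lemma free_vecsI:
  "(\<And>i. i < b \<Longrightarrow> w i \<in> carrier (poly_ring V)) \<Longrightarrow> (\<And>i. b \<le> i \<Longrightarrow> w i = 0) \<Longrightarrow> w \<in> free_vecs V b"
  by (simp add: free_vecs_def)

lemma free_comp_subset: "free_comp V ds j \<subseteq> free_vecs V (length ds)"
  by (auto simp: free_comp_def free_vecs_def)

text \<open>The generator degrees of the target of the i-th matrix. The augmentation counts as the
  0-th matrix, with target S in degree 0, and can thus be handled like a differential.\<close>

definition row_shifts :: "(nat \<Rightarrow> int list) \<Rightarrow> nat \<Rightarrow> int list" where
  "row_shifts sh i = (case i of 0 \<Rightarrow> [0] | Suc k \<Rightarrow> sh k)"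

lemma row_shifts_simps [simp]: "row_shifts sh 0 = [0]" "row_shifts sh (Suc i) = sh i"
  by (simp_all add: row_shifts_def)

text \<open>Minimal resolutions with matrices and vectors replaced by functions that are zero out of range.\<close>

definition fun_resolution :: "'v set \<Rightarrow> ('v, 'k::field) mpoly set \<Rightarrow> (nat \<Rightarrow> int list) \<Rightarrow>
    (nat \<Rightarrow> nat \<Rightarrow> nat \<Rightarrow> ('v, 'k) mpoly) \<Rightarrow> bool" where
  "fun_resolution V I sh a \<longleftrightarrow>
     (\<forall>i r c. if r < length (row_shifts sh i) \<and> c < length (sh i)
        then a i r c \<in> carrier (poly_ring V) \<and> homogeneous (sh i ! c - row_shifts sh i ! r) (a i r c)
        else a i r c = 0) \<and>
     I = (\<lambda>w. lmap (length (sh 0)) (a 0) w 0) ` free_vecs V (length (sh 0)) \<and>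
     (\<forall>i. {w \<in> free_vecs V (length (sh i)). lmap (length (sh i)) (a i) w = (\<lambda>_. 0)} =
        lmap (length (sh (Suc i))) (a (Suc i)) ` free_vecs V (length (sh (Suc i)))) \<and>
     (\<forall>i r c. lookup (a (Suc i) r c) 0 = 0)"

lemma free_module_vec: "free_module V b = vec b ` free_vecs V b"
proof (intro equalityI subsetI)
  fix v assume v: "v \<in> free_module V b"
  then have "v = vec b (\<lambda>i. if i < b then v $ i else 0)" by (auto simp: free_module_def)
  moreover have "(\<lambda>i. if i < b then v $ i else 0) \<in> free_vecs V b"
    using v by (auto simp: free_module_def free_vecs_def)
  ultimately show "v \<in> vec b ` free_vecs V b" by blast
qed (auto simp: free_module_def free_vecs_def)

lemma mult_mat_vec_lmap:
  assumes "A \<in> carrier_mat nr nc" "\<And>r c. r < nr \<Longrightarrow> c < nc \<Longrightarrow> a r c = A $$ (r, c)"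
  shows "A *\<^sub>v vec nc w = vec nr (lmap nc a w)"
  using assms by (intro eq_vecI) (auto simp: lmap_def scalar_prod_def lessThan_atLeast0 intro!: sum.cong)

lemma minimal_resolution_iff_fun:
  assumes car: "\<And>i. phi i \<in> carrier_mat (length (row_shifts sh i)) (length (sh i))"
    and a: "\<And>i r c. a i r c = (if r < length (row_shifts sh i) \<and> c < length (sh i) then phi i $$ (r, c) else 0)"
  shows "minimal_graded_free_resolution V I sh phi \<longleftrightarrow> fun_resolution V I sh a"
proof -
  have all_nat: "(\<forall>i. P i) \<longleftrightarrow> P 0 \<and> (\<forall>i. P (Suc i))" for P :: "nat \<Rightarrow> bool"
    by (metis nat.exhaust)
  have 1: "graded_matrix V [0] (sh 0) (phi 0) \<and> (\<forall>i. graded_matrix V (sh i) (sh (Suc i)) (phi (Suc i))) \<longleftrightarrow>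
    (\<forall>i r c. if r < length (row_shifts sh i) \<and> c < length (sh i)
        then a i r c \<in> carrier (poly_ring V) \<and> homogeneous (sh i ! c - row_shifts sh i ! r) (a i r c)
        else a i r c = 0)" (is "_ \<longleftrightarrow> ?R")
  proof -
    have "graded_matrix V [0] (sh 0) (phi 0) \<and> (\<forall>i. graded_matrix V (sh i) (sh (Suc i)) (phi (Suc i))) \<longleftrightarrow>
        (\<forall>i. graded_matrix V (row_shifts sh i) (sh i) (phi i))"
      by (subst (2) all_nat) simp
    also have "\<dots> \<longleftrightarrow> ?R" using car unfolding graded_matrix_def a by auto
    finally show ?thesis .
  qed
  have mv: "phi i *\<^sub>v vec (length (sh i)) w = vec (length (row_shifts sh i)) (lmap (length (sh i)) (a i) w)" for i w
    by (rule mult_mat_vec_lmap[OF car]) (simp add: a)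
  have 2: "(\<lambda>w. (phi 0 *\<^sub>v w) $ 0) ` free_module V (length (sh 0)) =
      (\<lambda>w. lmap (length (sh 0)) (a 0) w 0) ` free_vecs V (length (sh 0))"
    unfolding free_module_vec image_image mv by simp
  have 3: "{w \<in> free_module V (length (sh i)). phi i *\<^sub>v w = 0\<^sub>v (dim_row (phi i))} =
      (\<lambda>w. phi (Suc i) *\<^sub>v w) ` free_module V (length (sh (Suc i))) \<longleftrightarrow>
    {w \<in> free_vecs V (length (sh i)). lmap (length (sh i)) (a i) w = (\<lambda>_. 0)} =
        lmap (length (sh (Suc i))) (a (Suc i)) ` free_vecs V (length (sh (Suc i)))" (is "?L = ?L' \<longleftrightarrow> ?X = ?Y") for i
  proof -
    let ?b = "length (sh i)"
    have "vec (length (row_shifts sh i)) (lmap ?b (a i) w) = 0\<^sub>v (dim_row (phi i)) \<longleftrightarrow> lmap ?b (a i) w = (\<lambda>_. 0)" for w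
    proof
      assume eq: "vec (length (row_shifts sh i)) (lmap ?b (a i) w) = 0\<^sub>v (dim_row (phi i))"
      show "lmap ?b (a i) w = (\<lambda>_. 0)"
      proof
        fix r show "lmap ?b (a i) w r = 0"
        proof (cases "r < length (row_shifts sh i)")
          case True
          then show ?thesis using arg_cong[OF eq, of "\<lambda>v. v $ r"] car[of i] by simp
        next
          case False
          then show ?thesis by (simp add: lmap_def a)
        qed
      qed
    qed (use car[of i] in auto)
    then have ker: "phi i *\<^sub>v vec ?b w = 0\<^sub>v (dim_row (phi i)) \<longleftrightarrow> lmap ?b (a i) w = (\<lambda>_. 0)" for w
      unfolding mv .
    have "?L = vec ?b ` {w \<in> free_vecs V ?b. phi i *\<^sub>v vec ?b w = 0\<^sub>v (dim_row (phi i))}"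
      unfolding free_module_vec by blast
    then have L: "?L = vec ?b ` ?X" unfolding ker .
    have L': "?L' = vec ?b ` ?Y"
      unfolding free_module_vec image_image mv by simp
    \<comment> \<open>Truncation by \<open>vec\<close> is injective on functions vanishing out of
      range, so equality of kernel and image transfers between the two encodings.\<close>
    let ?Z = "{w :: ('a, 'b) pvec. \<forall>r\<ge>?b. w r = 0}"
    have "inj_on (vec ?b) ?Z"
    proof (rule inj_onI, rule ext)
      fix w w' :: "('a, 'b) pvec" and r assume w: "w \<in> ?Z" "w' \<in> ?Z" "vec ?b w = vec ?b w'"
      show "w r = w' r"
      proof (cases "r < ?b")
        case True
        then show ?thesis using arg_cong[OF w(3), of "\<lambda>v. v $ r"] by simp
      qed (use w in simp)
    qed
    moreover have "?X \<subseteq> ?Z" using free_vecsD(2) by auto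
    moreover have "?Y \<subseteq> ?Z" by (auto simp: lmap_def a)
    ultimately show ?thesis unfolding L L' by (rule inj_on_image_eq_iff)
  qed
  have 4: "(\<forall>i. \<forall>r<length (sh i). \<forall>c<length (sh (Suc i)). lookup (phi (Suc i) $$ (r, c)) 0 = 0) \<longleftrightarrow>
      (\<forall>i r c. lookup (a (Suc i) r c) 0 = 0)"
    by (auto simp: a)
  show ?thesis
    unfolding minimal_graded_free_resolution_def graded_free_resolution_def fun_resolution_def 2 3 4
    using 1 by argo
qed

lemma minimal_resolution_fun:
  assumes "minimal_graded_free_resolution V I sh phi"
  obtains a where "fun_resolution V I sh a"
proof -
  have "phi i \<in> carrier_mat (length (row_shifts sh i)) (length (sh i))" for i
    using assms unfolding minimal_graded_free_resolution_def graded_free_resolution_def graded_matrix_def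
    by (cases i) auto
  from minimal_resolution_iff_fun[OF this refl] assms that show ?thesis by blast
qed

lemma fun_minimal_resolution:
  assumes "fun_resolution V I sh a"
  obtains phi where "minimal_graded_free_resolution V I sh phi"
proof -
  let ?phi = "\<lambda>i. mat (length (row_shifts sh i)) (length (sh i)) (\<lambda>(r, c). a i r c)"
  have entries: "if r < length (row_shifts sh i) \<and> c < length (sh i)
        then a i r c \<in> carrier (poly_ring V) \<and> homogeneous (sh i ! c - row_shifts sh i ! r) (a i r c)
        else a i r c = 0" for i r c
    using assms unfolding fun_resolution_def by blast
  have "a i r c = (if r < length (row_shifts sh i) \<and> c < length (sh i) then ?phi i $$ (r, c) else 0)" for i r c
    using entries[where r = r and i = i and c = c] by auto
  from minimal_resolution_iff_fun[of ?phi sh a, OF _ this] assms that[of ?phi] show ?thesis by simp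
qed

text \<open>The ideal is viewed as a submodule of the free module of rank 1, with coordinate 0 as
  its only entry.\<close>

definition ideal_comp :: "('v, 'k::field) mpoly set \<Rightarrow> int \<Rightarrow> ('v, 'k) pvec set" where
  "ideal_comp I j = {w. w 0 \<in> I \<and> homogeneous j (w 0) \<and> (\<forall>i>0. w i = 0)}"

lemma graded_module_image:
  assumes "graded_module V F" "lin_map \<phi>" "\<And>j. B j = \<phi> ` F j"
  shows "graded_module V B"
  unfolding graded_module_def assms(3)
proof (intro conjI allI impI ballI)
  fix j show "(\<lambda>_. 0) \<in> \<phi> ` F j"
    using graded_moduleD(1)[OF assms(1)] lin_mapD(3)[OF assms(2)] by (metis image_eqI)
next
  fix j w w' assume "w \<in> \<phi> ` F j" "w' \<in> \<phi> ` F j"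
  then obtain u u' where u: "u \<in> F j" "w = \<phi> u" "u' \<in> F j" "w' = \<phi> u'" by blast
  have "(\<lambda>i. w i + w' i) = \<phi> (\<lambda>i. u i + u' i)" unfolding u lin_mapD(1)[OF assms(2)] ..
  then show "(\<lambda>i. w i + w' i) \<in> \<phi> ` F j"
    using graded_moduleD(2)[OF assms(1) u(1,3)] by (rule image_eqI)
next
  fix j w assume "w \<in> \<phi> ` F j"
  then obtain u where u: "u \<in> F j" "w = \<phi> u" by blast
  have "(\<lambda>i. - w i) = \<phi> (\<lambda>i. - u i)" unfolding u lin_mapD(4)[OF assms(2)] ..
  then show "(\<lambda>i. - w i) \<in> \<phi> ` F j"
    using graded_moduleD(3)[OF assms(1) u(1)] by (rule image_eqI)
next
  fix j w v assume v: "v \<in> V" and "w \<in> \<phi> ` F j"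
  then obtain u where u: "u \<in> F j" "w = \<phi> u" by blast
  have "(\<lambda>i. pvar v * w i) = \<phi> (\<lambda>i. pvar v * u i)" unfolding u lin_mapD(2)[OF assms(2)] ..
  then show "(\<lambda>i. pvar v * w i) \<in> \<phi> ` F (j + 1)"
    using graded_moduleD(5)[OF assms(1) v u(1)] by (rule image_eqI)
qed

lemma koszul_vanishes_0_iff:
  assumes fin: "finite V" and M: "graded_module V M"
  shows "koszul_vanishes V h M 0 j \<longleftrightarrow>
    (\<forall>w\<in>M j. \<exists>u. (\<forall>v\<in>V. u v \<in> M (j - 1)) \<and> w = (\<lambda>i. \<Sum>v\<in>V. pvar v * u v i))" (is "?L \<longleftrightarrow> (\<forall>w\<in>M j. ?P w)")
proof
  assume L: ?L
  show "\<forall>w\<in>M j. ?P w"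
  proof
    fix w assume w: "w \<in> M j"
    define f where "f \<sigma> = (if \<sigma> = {} then w else (\<lambda>_. 0))" for \<sigma> :: "'a set"
    have f: "f \<in> kchains V M 0 j"
    proof (rule chainsI)
      fix \<sigma> :: "'a set"
      show "\<sigma> \<subseteq> V \<Longrightarrow> card \<sigma> = 0 \<Longrightarrow> f \<sigma> \<in> M (j - int 0)"
        using fin w finite_subset[of \<sigma> V] by (simp add: f_def)
      show "\<not> (\<sigma> \<subseteq> V \<and> card \<sigma> = 0) \<Longrightarrow> f \<sigma> = (\<lambda>_. 0)" by (auto simp: f_def)
    qed
    have "\<exists>g\<in>kchains V M 1 j. koszul_boundary V h g = f"
      using L f koszul_boundary_chains_0[OF fin f] unfolding koszul_vanishes_def by simp
    then show "?P w" unfolding koszul_0_boundary_iff[OF fin M f] by (simp add: f_def)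
  qed
next
  assume R: "\<forall>w\<in>M j. ?P w"
  show ?L
    unfolding koszul_vanishes_def
  proof (intro ballI impI)
    fix f assume f: "f \<in> kchains V M 0 j"
    have "f {} \<in> M j" using chainsD(1)[OF f, of "{}"] by simp
    then show "\<exists>g\<in>kchains V M (Suc 0) j. koszul_boundary V h g = f"
      using R koszul_0_boundary_iff[OF fin M f] by (simp add: One_nat_def[symmetric] del: One_nat_def)
  qed
qed

section \<open>The syzygy modules of a minimal resolution\<close>

locale min_resolution =
  fixes V :: "'v set" and h :: "'v \<Rightarrow> nat" and I :: "('v, 'k::field) mpoly set"
    and sh :: "nat \<Rightarrow> int list" and a :: "nat \<Rightarrow> nat \<Rightarrow> nat \<Rightarrow> ('v, 'k) mpoly"
  assumes fin: "finite V" and h: "inj_on h V" and res: "fun_resolution V I sh a"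
begin

abbreviation "F i \<equiv> free_comp V (sh i) :: int \<Rightarrow> ('v, 'k) pvec set"
abbreviation "\<phi> i \<equiv> lmap (length (sh i)) (a i)"

text \<open>The graded syzygy modules: \<open>B 0\<close> is the ideal and \<open>B (Suc i)\<close>
  the kernel of the i-th map.\<close>

definition B :: "nat \<Rightarrow> int \<Rightarrow> ('v, 'k) pvec set" where
  "B i j = \<phi> i ` F i j"

lemma entry: "a i r c \<in> carrier (poly_ring V)"
  "r < length (row_shifts sh i) \<Longrightarrow> c < length (sh i) \<Longrightarrow> homogeneous (sh i ! c - row_shifts sh i ! r) (a i r c)"
  "length (row_shifts sh i) \<le> r \<Longrightarrow> a i r c = 0"
proof -
  have *: "if r < length (row_shifts sh i) \<and> c < length (sh i)
        then a i r c \<in> carrier (poly_ring V) \<and> homogeneous (sh i ! c - row_shifts sh i ! r) (a i r c)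
        else a i r c = 0"
    using res unfolding fun_resolution_def by blast
  then show "a i r c \<in> carrier (poly_ring V)" using carrier_0 by (auto split: if_splits)
  show "r < length (row_shifts sh i) \<Longrightarrow> c < length (sh i) \<Longrightarrow> homogeneous (sh i ! c - row_shifts sh i ! r) (a i r c)"
    "length (row_shifts sh i) \<le> r \<Longrightarrow> a i r c = 0" using * by auto
qed

lemma entry_0: "lookup (a (Suc i) r c) 0 = 0"
  using res unfolding fun_resolution_def by blast

lemma image_0: "I = (\<lambda>w. \<phi> 0 w 0) ` free_vecs V (length (sh 0))"
  using res unfolding fun_resolution_def by blast

lemma exact: "{w \<in> free_vecs V (length (sh i)). \<phi> i w = (\<lambda>_. 0)} = \<phi> (Suc i) ` free_vecs V (length (sh (Suc i)))"
  using res unfolding fun_resolution_def by blast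

lemma phi_homogeneous:
  assumes w: "w \<in> F i j" and r: "r < length (row_shifts sh i)"
  shows "homogeneous (j - row_shifts sh i ! r) (\<phi> i w r)"
  unfolding lmap_def
proof (rule homogeneous_sum)
  fix c assume "c \<in> {..<length (sh i)}"
  then show "homogeneous (j - row_shifts sh i ! r) (a i r c * w c)"
    using homogeneous_mult[OF entry(2)[OF r, of c] free_compD(2)[OF w, of c]] by simp
qed

text \<open>Exactness of a resolution speaks of ungraded vectors. As the entries are homogeneous,
  the maps commute with taking homogeneous components, which brings preimages into the right
  degree.\<close>

lemma phi_comp:
  assumes w: "w \<in> free_vecs V (length (sh i))"
  obtains w' where "w' \<in> F i j"
    "\<And>r. r < length (row_shifts sh i) \<Longrightarrow> \<phi> i w' r = hom_comp (j - row_shifts sh i ! r) (\<phi> i w r)"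
proof
  let ?w = "\<lambda>c. if c < length (sh i) then hom_comp (j - sh i ! c) (w c) else 0"
  show "?w \<in> F i j"
    using free_vecsD[OF w] by (intro free_compI) (auto intro: hom_comp_carrier homogeneous_hom_comp)
  fix r assume r: "r < length (row_shifts sh i)"
  show "\<phi> i ?w r = hom_comp (j - row_shifts sh i ! r) (\<phi> i w r)"
    unfolding lmap_def hom_comp_sum
  proof (rule sum.cong[OF refl])
    fix c assume c: "c \<in> {..<length (sh i)}"
    then have "hom_comp (j - row_shifts sh i ! r) (a i r c * w c) =
        a i r c * hom_comp (j - row_shifts sh i ! r - (sh i ! c - row_shifts sh i ! r)) (w c)"
      by (intro hom_comp_mult entry(2) r) simp
    then show "a i r c * ?w c = hom_comp (j - row_shifts sh i ! r) (a i r c * w c)" using c by simp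
  qed
qed

lemma B_Suc: "B (Suc i) j = {w \<in> F i j. \<phi> i w = (\<lambda>_. 0)}"
proof (intro equalityI subsetI)
  fix w assume "w \<in> B (Suc i) j"
  then obtain u where u: "u \<in> F (Suc i) j" "w = \<phi> (Suc i) u" by (auto simp: B_def)
  then have "w \<in> \<phi> (Suc i) ` free_vecs V (length (sh (Suc i)))" using free_comp_subset by blast
  then have w: "w \<in> free_vecs V (length (sh i))" "\<phi> i w = (\<lambda>_. 0)" using exact[of i] by blast+
  have "w \<in> F i j"
    using free_vecsD[OF w(1)] phi_homogeneous[OF u(1)] u(2) by (intro free_compI) auto
  then show "w \<in> {w \<in> F i j. \<phi> i w = (\<lambda>_. 0)}" using w(2) by simp
next
  fix w assume "w \<in> {w \<in> F i j. \<phi> i w = (\<lambda>_. 0)}"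
  then have w: "w \<in> F i j" "\<phi> i w = (\<lambda>_. 0)" by auto
  then have "w \<in> {w \<in> free_vecs V (length (sh i)). \<phi> i w = (\<lambda>_. 0)}" using free_comp_subset by blast
  then obtain u where u: "u \<in> free_vecs V (length (sh (Suc i)))" "w = \<phi> (Suc i) u" using exact[of i] by blast
  obtain u' where u': "u' \<in> F (Suc i) j"
    "\<And>r. r < length (row_shifts sh (Suc i)) \<Longrightarrow> \<phi> (Suc i) u' r = hom_comp (j - row_shifts sh (Suc i) ! r) (\<phi> (Suc i) u r)"
    using phi_comp[OF u(1)] by blast
  have "\<phi> (Suc i) u' = w"
  proof
    fix r show "\<phi> (Suc i) u' r = w r"
    proof (cases "r < length (sh i)")
      case True
      then show ?thesis using u'(2)[of r] u(2) hom_comp_homogeneous[OF free_compD(2)[OF w(1) True]] by simp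
    next
      case False
      then show ?thesis using free_compD(3)[OF w(1), of r] entry(3)[of "Suc i" r] by (simp add: lmap_def)
    qed
  qed
  then show "w \<in> B (Suc i) j" using u'(1) by (auto simp: B_def)
qed

lemma B_0: "B 0 j = ideal_comp I j"
proof (intro equalityI subsetI)
  fix w assume "w \<in> B 0 j"
  then obtain u where u: "u \<in> F 0 j" "w = \<phi> 0 u" by (auto simp: B_def)
  have "w 0 \<in> I" unfolding image_0 using u free_comp_subset by blast
  moreover have "homogeneous j (w 0)" using phi_homogeneous[OF u(1), of 0] u(2) by simp
  moreover have "w r = 0" if "r > 0" for r using entry(3)[of 0 r] that u(2) by (simp add: lmap_def)
  ultimately show "w \<in> ideal_comp I j" by (simp add: ideal_comp_def)
next
  fix w assume "w \<in> ideal_comp I j"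
  then have w: "w 0 \<in> I" "homogeneous j (w 0)" "\<And>i. i > 0 \<Longrightarrow> w i = 0" by (auto simp: ideal_comp_def)
  then obtain u where u: "u \<in> free_vecs V (length (sh 0))" "w 0 = \<phi> 0 u 0" using image_0 by blast
  obtain u' where u': "u' \<in> F 0 j"
    "\<And>r. r < length (row_shifts sh 0) \<Longrightarrow> \<phi> 0 u' r = hom_comp (j - row_shifts sh 0 ! r) (\<phi> 0 u r)"
    using phi_comp[OF u(1)] by blast
  have "\<phi> 0 u' = w"
  proof
    fix r show "\<phi> 0 u' r = w r"
    proof (cases "r = 0")
      case True
      then show ?thesis using u'(2)[of 0] u(2) hom_comp_homogeneous[OF w(2)] by simp
    next
      case False
      then show ?thesis using w(3)[of r] entry(3)[of 0 r] by (simp add: lmap_def)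
    qed
  qed
  then show "w \<in> B 0 j" using u'(1) by (auto simp: B_def)
qed

lemma F_no_constant:
  assumes w: "w \<in> F i j" and z: "\<And>c. lookup (w c) 0 = 0"
  shows "\<exists>u. (\<forall>v\<in>V. u v \<in> F i (j - 1)) \<and> w = (\<lambda>c. \<Sum>v\<in>V. pvar v * u v c)"
proof -
  have "\<forall>c\<in>{..<length (sh i)}. \<exists>q. (\<forall>v\<in>V. q v \<in> carrier (poly_ring V) \<and> homogeneous (j - sh i ! c - 1) (q v)) \<and>
      w c = (\<Sum>v\<in>V. pvar v * q v)"
    using irrelevant_decomposition[OF fin free_compD(1)[OF w] free_compD(2)[OF w] z] by simp
  from bchoice[OF this] obtain q where q0: "\<forall>c\<in>{..<length (sh i)}.
      (\<forall>v\<in>V. q c v \<in> carrier (poly_ring V) \<and> homogeneous (j - sh i ! c - 1) (q c v)) \<and>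
      w c = (\<Sum>v\<in>V. pvar v * q c v)" ..
  have q: "\<And>c v. c < length (sh i) \<Longrightarrow> v \<in> V \<Longrightarrow> q c v \<in> carrier (poly_ring V)"
    "\<And>c v. c < length (sh i) \<Longrightarrow> v \<in> V \<Longrightarrow> homogeneous (j - sh i ! c - 1) (q c v)"
    "\<And>c. c < length (sh i) \<Longrightarrow> w c = (\<Sum>v\<in>V. pvar v * q c v)" using q0 by simp_all
  define u where "u v c = (if c < length (sh i) then q c v else 0)" for v c
  have "u v \<in> F i (j - 1)" if "v \<in> V" for v
    using q(1,2)[OF _ that] by (intro free_compI) (auto simp: u_def algebra_simps)
  moreover have "w c = (\<Sum>v\<in>V. pvar v * u v c)" for c
    using q(3)[of c] free_compD(3)[OF w, of c] by (cases "c < length (sh i)") (auto simp: u_def)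
  ultimately have "(\<forall>v\<in>V. u v \<in> F i (j - 1)) \<and> w = (\<lambda>c. \<Sum>v\<in>V. pvar v * u v c)" by blast
  then show ?thesis by (rule exI[of _ u])
qed

lemma graded_module_B: "graded_module V (B i)"
  by (rule graded_module_image[OF graded_module_free_comp lin_map_lmap B_def])

lemma B_Suc_no_constant: "w \<in> B (Suc i) j \<Longrightarrow> lookup (w c) 0 = 0"
  by (auto simp: B_def lmap_def lookup_sum lookup_mult_0 entry_0)

text \<open>Dimension shifting along the sequence of \<open>B (Suc i)\<close>, \<open>F i\<close>
  and \<open>B i\<close>. Minimality enters as the absence of constant terms in
  \<open>B (Suc i)\<close>.\<close>

lemma koszul_step: "koszul_vanishes V h (B i) (Suc p) j \<longleftrightarrow> koszul_vanishes V h (B (Suc i)) p j"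
proof (rule koszul_shift[OF fin h graded_module_free_comp lin_map_lmap B_def B_Suc koszul_vanishes_free[OF fin h]])
  fix f assume f: "f \<in> kchains V (B (Suc i)) 0 j"
  have fB: "f {} \<in> B (Suc i) j" using chainsD(1)[OF f, of "{}"] by simp
  then have "f {} \<in> F i j" using B_Suc by blast
  from F_no_constant[OF this B_Suc_no_constant[OF fB]]
  show "\<exists>g\<in>kchains V (F i) 1 j. koszul_boundary V h g = f"
    unfolding koszul_0_boundary_iff[OF fin graded_module_free_comp f] .
qed

text \<open>Modulo the irrelevant ideal, \<open>B i\<close> keeps one basis vector per generator of
  the i-th free module, as minimality excludes relations with a constant term.\<close>

lemma koszul_0: "koszul_vanishes V h (B i) 0 j \<longleftrightarrow> j \<notin> set (sh i)"
proof
  assume "koszul_vanishes V h (B i) 0 j"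
  then have all: "\<And>w. w \<in> B i j \<Longrightarrow> \<exists>u. (\<forall>v\<in>V. u v \<in> B i (j - 1)) \<and> w = (\<lambda>r. \<Sum>v\<in>V. pvar v * u v r)"
    unfolding koszul_vanishes_0_iff[OF fin graded_module_B] by blast
  show "j \<notin> set (sh i)"
  proof
    assume "j \<in> set (sh i)"
    then obtain b where b: "b < length (sh i)" "sh i ! b = j" by (auto simp: in_set_conv_nth)
    define e where "e c = (if c = b then 1 else 0 :: ('v, 'k) mpoly)" for c
    have "homogeneous 0 (1 :: ('v, 'k) mpoly)" by (simp add: homogeneous_def)
    then have e: "e \<in> F i j"
      using b by (intro free_compI) (auto simp: e_def carrier_0 carrier_1)
    then have "\<phi> i e \<in> B i j" by (simp add: B_def)
    from all[OF this] obtain u where u0: "(\<forall>v\<in>V. u v \<in> B i (j - 1)) \<and> \<phi> i e = (\<lambda>r. \<Sum>v\<in>V. pvar v * u v r)" ..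
    then have "\<forall>v\<in>V. \<exists>y. y \<in> F i (j - 1) \<and> u v = \<phi> i y" by (auto simp: B_def)
    from bchoice[OF this] obtain y where "\<forall>v\<in>V. y v \<in> F i (j - 1) \<and> u v = \<phi> i (y v)" ..
    then have y: "\<And>v. v \<in> V \<Longrightarrow> y v \<in> F i (j - 1)" "\<And>v. v \<in> V \<Longrightarrow> u v = \<phi> i (y v)" by simp_all
    \<comment> \<open>If the image of the basis vector \<open>e\<close> were a combination of
      variables times elements of \<open>B i\<close>, lifting these elements gives \<open>s\<close>
      such that \<open>e - s\<close> is a syzygy whose b-th entry has constant term 1.\<close>
    define s where "s c = (\<Sum>v\<in>V. pvar v * y v c)" for c
    have py: "(\<lambda>c. pvar v * y v c) \<in> F i j" if "v \<in> V" for v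
      using graded_moduleD(5)[OF graded_module_free_comp that y(1)[OF that]] by simp
    have s: "s \<in> F i j"
      using graded_module_sum[OF graded_module_free_comp, of V "\<lambda>v c. pvar v * y v c" V "sh i" j] py
      unfolding s_def by blast
    have "\<phi> i s = (\<lambda>r. \<Sum>v\<in>V. \<phi> i (\<lambda>c. pvar v * y v c) r)"
      unfolding s_def by (rule lin_map_sum[OF lin_map_lmap])
    also have "\<dots> = (\<lambda>r. \<Sum>v\<in>V. pvar v * u v r)"
      using y(2) by (intro ext sum.cong refl) (simp add: lin_mapD(2)[OF lin_map_lmap])
    finally have "\<phi> i s = \<phi> i e" using u0 by simp
    then have "\<phi> i (\<lambda>c. e c - s c) = (\<lambda>_. 0)" by (simp add: lin_mapD(5)[OF lin_map_lmap])
    moreover have "(\<lambda>c. e c - s c) \<in> F i j" by (rule graded_moduleD(4)[OF graded_module_free_comp e s])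
    ultimately have "(\<lambda>c. e c - s c) \<in> B (Suc i) j" unfolding B_Suc by simp
    from B_Suc_no_constant[OF this, of b] have "lookup (e b - s b) 0 = 0" .
    moreover have "lookup (s b) 0 = 0"
      by (simp add: s_def lookup_sum lookup_pvar_mult)
    ultimately show False by (simp add: e_def lookup_minus)
  qed
next
  assume j: "j \<notin> set (sh i)"
  show "koszul_vanishes V h (B i) 0 j"
    unfolding koszul_vanishes_0_iff[OF fin graded_module_B]
  proof
    fix w assume "w \<in> B i j"
    then obtain y where y: "y \<in> F i j" "w = \<phi> i y" by (auto simp: B_def)
    have "lookup (y c) 0 = 0" for c
    proof (cases "c < length (sh i)")
      case True
      then have "j - sh i ! c \<noteq> 0" using j by auto
      moreover have "int (mon_deg m) = j - sh i ! c" if "m \<in> keys (y c)" for m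
        using free_compD(2)[OF y(1) True] that by (simp add: homogeneous_def)
      ultimately have "0 \<notin> keys (y c)" by fastforce
      then show ?thesis by (simp add: in_keys_iff)
    next
      case False
      then show ?thesis using free_compD(3)[OF y(1), of c] by simp
    qed
    from F_no_constant[OF y(1) this]
    obtain q where "(\<forall>v\<in>V. q v \<in> F i (j - 1)) \<and> y = (\<lambda>c. \<Sum>v\<in>V. pvar v * q v c)" ..
    then have q: "\<And>v. v \<in> V \<Longrightarrow> q v \<in> F i (j - 1)" "y = (\<lambda>c. \<Sum>v\<in>V. pvar v * q v c)" by simp_all
    have "w = (\<lambda>r. \<Sum>v\<in>V. \<phi> i (\<lambda>c. pvar v * q v c) r)"
      unfolding y(2) q(2) by (rule lin_map_sum[OF lin_map_lmap])
    then have "w = (\<lambda>r. \<Sum>v\<in>V. pvar v * \<phi> i (q v) r)" by (simp add: lin_mapD(2)[OF lin_map_lmap])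
    moreover have "\<forall>v\<in>V. \<phi> i (q v) \<in> B i (j - 1)" using q(1) by (auto simp: B_def)
    ultimately show "\<exists>u. (\<forall>v\<in>V. u v \<in> B i (j - 1)) \<and> w = (\<lambda>r. \<Sum>v\<in>V. pvar v * u v r)"
      by (intro exI[of _ "\<lambda>v. \<phi> i (q v)"] conjI)
  qed
qed

text \<open>Shifting i times reduces Tor_i of the ideal to the minimal generators of its i-th syzygy
  module.\<close>

lemma shift_iff_koszul: "j \<in> set (sh i) \<longleftrightarrow> \<not> koszul_vanishes V h (ideal_comp I) i j"
proof -
  have "koszul_vanishes V h (B k) (i + p) j \<longleftrightarrow> koszul_vanishes V h (B (k + i)) p j" for k p
    by (induction i arbitrary: k) (simp_all add: koszul_step)
  from this[of 0 0] have "koszul_vanishes V h (B 0) i j \<longleftrightarrow> j \<notin> set (sh i)" by (simp add: koszul_0)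
  moreover have "B 0 = ideal_comp I" using B_0 by (intro ext) simp
  ultimately show ?thesis by simp
qed

end

section \<open>Existence of minimal resolutions\<close>

text \<open>Dickson's lemma, by slicing along the new coordinate v. The finite basis B for the old
  coordinates can fail for \<open>a\<close> only if \<open>e a v\<close> lies below the bound
  \<open>m\<close> on the values of B at v; the finitely many slices below \<open>m\<close> have
  finite bases by induction.\<close>

lemma dickson:
  fixes e :: "'a \<Rightarrow> 'v \<Rightarrow> nat"
  assumes "finite V"
  shows "\<exists>B\<subseteq>A. finite B \<and> (\<forall>a\<in>A. \<exists>b\<in>B. \<forall>v\<in>V. e b v \<le> e a v)"
  using assms
proof (induction V arbitrary: A rule: finite_induct)
  case empty
  show ?case
  proof (cases "A = {}")
    case False
    then obtain a where "a \<in> A" by blast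
    then show ?thesis by (intro exI[of _ "{a}"]) auto
  qed auto
next
  case (insert v V)
  obtain B where B: "B \<subseteq> A" "finite B" "\<And>a. a \<in> A \<Longrightarrow> \<exists>b\<in>B. \<forall>v\<in>V. e b v \<le> e a v"
    using insert.IH[of A] by blast
  have "\<forall>k. \<exists>C. C \<subseteq> {a \<in> A. e a v = k} \<and> finite C \<and> (\<forall>a\<in>{a \<in> A. e a v = k}. \<exists>b\<in>C. \<forall>v\<in>V. e b v \<le> e a v)"
    using insert.IH by blast
  from choice[OF this] obtain C where C0: "\<forall>k. C k \<subseteq> {a \<in> A. e a v = k} \<and> finite (C k) \<and>
      (\<forall>a\<in>{a \<in> A. e a v = k}. \<exists>b\<in>C k. \<forall>v\<in>V. e b v \<le> e a v)" ..
  define m where "m = (\<Sum>b\<in>B. e b v)"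
  let ?D = "B \<union> (\<Union>k<m. C k)"
  have "\<exists>b\<in>?D. \<forall>x\<in>insert v V. e b x \<le> e a x" if a: "a \<in> A" for a
  proof -
    obtain b where b: "b \<in> B" "\<forall>v\<in>V. e b v \<le> e a v" using B(3)[OF a] by blast
    show ?thesis
    proof (cases "e b v \<le> e a v")
      case True
      then show ?thesis using b by (intro bexI[of _ b]) auto
    next
      case False
      moreover have "e b v \<le> m" unfolding m_def using b(1) B(2) by (intro member_le_sum) auto
      ultimately have k: "e a v < m" by simp
      have "a \<in> {a' \<in> A. e a' v = e a v}" using a by simp
      then obtain b' where b': "b' \<in> C (e a v)" "\<forall>x\<in>V. e b' x \<le> e a x" using C0 by blast
      have "e b' v = e a v" using b'(1) C0 by blast
      then show ?thesis using b' k by (intro bexI[of _ b']) auto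
    qed
  qed
  moreover have "?D \<subseteq> A" "finite ?D" using B C0 by auto
  ultimately show ?case by blast
qed

section \<open>Graded submodules of free modules and their generators\<close>

definition graded_sub :: "'v set \<Rightarrow> int list \<Rightarrow> ('v, 'k::field) pvec set \<Rightarrow> bool" where
  "graded_sub V ds N \<longleftrightarrow> N \<subseteq> free_vecs V (length ds) \<and> (\<lambda>_. 0) \<in> N \<and>
     (\<forall>w\<in>N. \<forall>w'\<in>N. (\<lambda>i. w i + w' i) \<in> N) \<and>
     (\<forall>w\<in>N. \<forall>p\<in>carrier (poly_ring V). (\<lambda>i. p * w i) \<in> N) \<and>
     (\<forall>w\<in>N. \<forall>j. (\<lambda>i. if i < length ds then hom_comp (j - ds ! i) (w i) else 0) \<in> N)"

lemma graded_subD: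
  assumes "graded_sub V ds N"
  shows "w \<in> N \<Longrightarrow> w \<in> free_vecs V (length ds)" "(\<lambda>_. 0) \<in> N"
    "w \<in> N \<Longrightarrow> w' \<in> N \<Longrightarrow> (\<lambda>i. w i + w' i) \<in> N"
    "w \<in> N \<Longrightarrow> p \<in> carrier (poly_ring V) \<Longrightarrow> (\<lambda>i. p * w i) \<in> N"
    "w \<in> N \<Longrightarrow> (\<lambda>i. if i < length ds then hom_comp (j - ds ! i) (w i) else 0) \<in> N"
  using assms unfolding graded_sub_def by (auto simp only:)

definition fam_span :: "'v set \<Rightarrow> 'i set \<Rightarrow> ('i \<Rightarrow> ('v, 'k::field) pvec) \<Rightarrow> ('v, 'k) pvec set" where
  "fam_span V K g = {w. \<exists>c. (\<forall>k\<in>K. c k \<in> carrier (poly_ring V)) \<and> w = (\<lambda>i. \<Sum>k\<in>K. c k * g k i)}"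

lemma fam_spanI: "(\<And>k. k \<in> K \<Longrightarrow> c k \<in> carrier (poly_ring V)) \<Longrightarrow> (\<lambda>i. \<Sum>k\<in>K. c k * g k i) \<in> fam_span V K g"
  unfolding fam_span_def by (rule CollectI, rule exI[of _ c]) simp

lemma fam_span_0: "(\<lambda>_. 0) \<in> fam_span V K g"
  using fam_spanI[of K "\<lambda>_. 0" V g, OF carrier_0] by simp

lemma fam_span_E:
  assumes "w \<in> fam_span V K g"
  obtains c where "\<forall>k\<in>K. c k \<in> carrier (poly_ring V)" "w = (\<lambda>i. \<Sum>k\<in>K. c k * g k i)"
  using assms unfolding fam_span_def by blast

lemma fam_span_add_mult:
  assumes fin: "finite K" and w: "w \<in> fam_span V K g" and k: "k \<in> K" and p: "p \<in> carrier (poly_ring V)"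
  shows "(\<lambda>i. w i + p * g k i) \<in> fam_span V K g"
proof -
  obtain c where c: "\<forall>k\<in>K. c k \<in> carrier (poly_ring V)" "w = (\<lambda>i. \<Sum>k\<in>K. c k * g k i)"
    using w by (rule fam_span_E)
  let ?c = "\<lambda>l. c l + (if l = k then p else 0)"
  have "(\<lambda>i. \<Sum>l\<in>K. ?c l * g l i) = (\<lambda>i. w i + p * g k i)"
  proof
    fix i
    have "(\<Sum>l\<in>K. ?c l * g l i) = (\<Sum>l\<in>K. c l * g l i) + (\<Sum>l\<in>K. if l = k then p * g k i else 0)"
      unfolding sum.distrib[symmetric] by (intro sum.cong) (auto simp: distrib_right)
    also have "(\<Sum>l\<in>K. if l = k then p * g k i else 0) = p * g k i" using fin k by simp
    finally show "(\<Sum>l\<in>K. ?c l * g l i) = w i + p * g k i" by (simp add: c(2))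
  qed
  moreover have "(\<lambda>i. \<Sum>l\<in>K. ?c l * g l i) \<in> fam_span V K g"
    using c(1) p by (intro fam_spanI) (auto intro: carrier_add carrier_0)
  ultimately show ?thesis by simp
qed

lemma carrier_single: "keys m \<subseteq> V \<Longrightarrow> single m c \<in> carrier (poly_ring V)"
  unfolding carrier_poly_ring by (rule mon_ideal_single) auto

text \<open>Noetherianity by division with a finite Groebner basis. Leading terms are taken at the
  last nonzero coordinate, with the \<open>W\<close>-largest exponent there. Dickson's lemma,
  applied to the leading exponents at each coordinate, supplies the basis, which is indexed by
  coordinate and leading exponent.\<close>

lemma graded_sub_finitely_generated:
  fixes N :: "('v, 'k::field) pvec set"
  assumes fin: "finite V" and N: "graded_sub V ds N"
  obtains K :: "(nat \<times> ('v \<Rightarrow>\<^sub>0 nat)) set" and g e where "finite K"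
    "\<And>k. k \<in> K \<Longrightarrow> g k \<in> N \<and> g k \<in> free_comp V ds (e k)" "N \<subseteq> fam_span V K g"
proof -
  obtain W :: "('v \<Rightarrow>\<^sub>0 nat) \<Rightarrow> nat" where W: "\<And>a b. W (a + b) = W a * W b" "\<And>a. 0 < W a"
    "\<And>a b. \<lbrakk>keys a \<subseteq> V; keys b \<subseteq> V; W a = W b\<rbrakk> \<Longrightarrow> a = b"
    by (rule monomial_weight_exists[OF fin]) blast
  define e where "e k = int (mon_deg (snd k)) + ds ! fst k" for k :: "nat \<times> ('v \<Rightarrow>\<^sub>0 nat)"
  define lead where "lead w i \<alpha> \<longleftrightarrow> (\<forall>k>i. w k = 0) \<and> \<alpha> \<in> keys (w i) \<and>
    (\<forall>m\<in>keys (w i). W m \<le> W \<alpha>)" for w :: "('v, 'k) pvec" and i \<alpha>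
  define L where "L i = {\<alpha>. \<exists>w\<in>N. w \<in> free_comp V ds (e (i, \<alpha>)) \<and> lead w i \<alpha>}" for i
  have keysV: "keys m \<subseteq> V" if "w \<in> N" "m \<in> keys (w i)" for w m i
    using free_vecsD(1)[OF graded_subD(1)[OF N that(1)], of i] that(2)
    by (auto simp: carrier_poly_ring mon_ideal_def)
  have leadL: "\<alpha> \<in> L i" if w: "w \<in> N" "lead w i \<alpha>" and i: "i < length ds" for w i \<alpha>
  proof -
    \<comment> \<open>The homogeneous component containing the leading term has the same leading
      term, so the generators can be taken homogeneous.\<close>
    let ?w = "\<lambda>k. if k < length ds then hom_comp (e (i, \<alpha>) - ds ! k) (w k) else 0"
    have "?w \<in> N" by (rule graded_subD(5)[OF N w(1)])
    moreover have "?w \<in> free_comp V ds (e (i, \<alpha>))"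
      using free_vecsD(1)[OF graded_subD(1)[OF N w(1)]]
      by (intro free_compI) (auto intro: hom_comp_carrier homogeneous_hom_comp)
    moreover have "lead ?w i \<alpha>"
      using w(2) i by (auto simp: lead_def in_keys_iff lookup_hom_comp e_def split: if_splits)
    ultimately show ?thesis unfolding L_def by blast
  qed
  have "\<forall>i. \<exists>B. B \<subseteq> L i \<and> finite B \<and> (\<forall>\<alpha>\<in>L i. \<exists>\<beta>\<in>B. \<forall>v\<in>V. lookup \<beta> v \<le> lookup \<alpha> v)"
    using dickson[OF fin, of _ lookup] by blast
  from choice[OF this] obtain B where B0: "\<forall>i. B i \<subseteq> L i \<and> finite (B i) \<and>
      (\<forall>\<alpha>\<in>L i. \<exists>\<beta>\<in>B i. \<forall>v\<in>V. lookup \<beta> v \<le> lookup \<alpha> v)" ..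
  define K where "K = Sigma {..<length ds} B"
  have finK: "finite K" unfolding K_def using B0 by (intro finite_SigmaI) auto
  have "\<forall>k\<in>K. \<exists>w. w \<in> N \<and> w \<in> free_comp V ds (e k) \<and> lead w (fst k) (snd k)"
    using B0 unfolding K_def L_def by fastforce
  from bchoice[OF this] obtain g where g0: "\<forall>k\<in>K. g k \<in> N \<and> g k \<in> free_comp V ds (e k) \<and> lead (g k) (fst k) (snd k)" ..
  have span: "\<forall>w\<in>N. (\<forall>k\<ge>i. w k = 0) \<longrightarrow> w \<in> fam_span V K g" if "i \<le> length ds" for i
    using that
  proof (induction i)
    case 0
    show ?case
    proof (intro ballI impI)
      fix w assume "w \<in> N" "\<forall>k\<ge>0. w k = 0"
      then have "w = (\<lambda>_. 0)" by auto
      then show "w \<in> fam_span V K g" using fam_span_0 by metis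
    qed
  next
    case (Suc i)
    \<comment> \<open>Division terminates because each step lowers the bound \<open>n\<close> on the
      values of \<open>W\<close> at the i-th entry; once this entry is 0, the outer induction takes
      over.\<close>
    have "\<forall>w\<in>N. (\<forall>k\<ge>Suc i. w k = 0) \<longrightarrow> (\<forall>m\<in>keys (w i). W m < n) \<longrightarrow> w \<in> fam_span V K g" for n
    proof (induction n)
      case 0
      show ?case
      proof (intro ballI impI)
        fix w assume w: "w \<in> N" "\<forall>k\<ge>Suc i. w k = 0" "\<forall>m\<in>keys (w i). W m < 0"
        then have "w i = 0" by (auto simp: in_keys_iff intro: poly_mapping_eqI)
        then have "\<forall>k\<ge>i. w k = 0" using w(2) by (metis le_antisym not_less_eq_eq)
        then show "w \<in> fam_span V K g" using Suc w(1) by simp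
      qed
    next
      case (Suc n)
      note IHn = Suc.IH
      show ?case
      proof (intro ballI impI)
        fix w assume w: "w \<in> N" "\<forall>k\<ge>Suc i. w k = 0" "\<forall>m\<in>keys (w i). W m < Suc n"
        show "w \<in> fam_span V K g"
        proof (cases "\<exists>\<alpha>\<in>keys (w i). W \<alpha> = n")
          case False
          then have "\<forall>m\<in>keys (w i). W m < n" using w(3) by (auto simp: less_Suc_eq)
          then show ?thesis using IHn w by blast
        next
          case True
          then obtain \<alpha> where \<alpha>: "\<alpha> \<in> keys (w i)" "W \<alpha> = n" by blast
          have i: "i < length ds" using \<open>Suc i \<le> length ds\<close> by simp
          have "lead w i \<alpha>" using w \<alpha> by (auto simp: lead_def)
          then have "\<alpha> \<in> L i" using leadL w(1) i by blast
          then obtain \<beta> where \<beta>: "\<beta> \<in> B i" "\<forall>v\<in>V. lookup \<beta> v \<le> lookup \<alpha> v"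
            using B0 by blast
          have kK: "(i, \<beta>) \<in> K" using \<beta>(1) i by (simp add: K_def)
          let ?g = "g (i, \<beta>)"
          have g: "?g \<in> N" "\<forall>k>i. ?g k = 0" "\<beta> \<in> keys (?g i)"
            "\<forall>m\<in>keys (?g i). W m \<le> W \<beta>"
            using g0 kK by (auto simp: lead_def)
          have \<alpha>V: "keys \<alpha> \<subseteq> V" and \<beta>V: "keys \<beta> \<subseteq> V"
            using keysV[OF w(1) \<alpha>(1)] keysV[OF g(1,3)] by auto
          have ab: "\<alpha> = \<beta> + (\<alpha> - \<beta>)"
          proof (rule lookup_le_imp_add)
            fix v show "lookup \<beta> v \<le> lookup \<alpha> v"
            proof (cases "v \<in> V")
              case False
              then have "v \<notin> keys \<beta>" using \<beta>V by blast
              then show ?thesis by (simp add: in_keys_iff)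
            qed (use \<beta>(2) in blast)
          qed
          define \<delta> where "\<delta> = \<alpha> - \<beta>"
          have ab': "\<alpha> = \<beta> + \<delta>" unfolding \<delta>_def by (rule ab)
          have \<delta>V: "keys \<delta> \<subseteq> V" using \<alpha>V keys_add_nat[of \<beta> \<delta>] ab' by auto
          define q where "q = single \<delta> (lookup (w i) \<alpha> / lookup (?g i) \<beta>)"
          have q: "q \<in> carrier (poly_ring V)" unfolding q_def using \<delta>V by (rule carrier_single)
          let ?w = "\<lambda>k. w k + (- q) * ?g k"
          have wN: "?w \<in> N"
            using graded_subD(3)[OF N w(1) graded_subD(4)[OF N g(1) carrier_uminus[OF q]]] .
          have "W m < n" if m: "m \<in> keys (?w i)" for m
          proof -
            have lk: "lookup (?w i) m = lookup (w i) m - lookup (?g i * q) m"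
              by (simp add: lookup_minus mult.commute)
            have "m \<noteq> \<alpha>"
            proof
              assume "m = \<alpha>"
              then have "lookup (?g i * q) m = lookup (?g i) \<beta> * (lookup (w i) \<alpha> / lookup (?g i) \<beta>)"
                unfolding ab' q_def by (simp only: lookup_mult_single)
              also have "\<dots> = lookup (w i) \<alpha>" using g(3) by (simp add: in_keys_iff)
              finally show False using m lk \<open>m = \<alpha>\<close> by (simp add: in_keys_iff)
            qed
            moreover have "W m \<le> n \<and> keys m \<subseteq> V"
            proof (cases "m \<in> keys (w i)")
              case True
              then show ?thesis using w(3) keysV[OF w(1)] by (auto simp: less_Suc_eq_le)
            next
              case False
              then have "m \<in> keys (?g i * q)" using m lk by (simp add: in_keys_iff)
              then obtain \<gamma> where \<gamma>: "m = \<gamma> + \<delta>" "\<gamma> \<in> keys (?g i)"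
                using keys_mult[of "?g i" q] by (auto simp: q_def split: if_splits)
              have "W m \<le> W \<beta> * W \<delta>" using \<gamma> g(4) by (simp add: W(1))
              also have "\<dots> = n" using \<alpha>(2) ab' W(1) by metis
              finally show ?thesis using \<gamma> keysV[OF g(1)] \<delta>V by (auto simp: keys_add_nat)
            qed
            \<comment> \<open>\<open>W\<close> is injective on exponents in \<open>V\<close>, so
              \<open>\<alpha>\<close> was the only exponent with value n.\<close>
            ultimately show ?thesis using W(3)[of m \<alpha>] \<alpha>(2) \<alpha>V by (auto simp: le_less)
          qed
          then have "\<forall>m\<in>keys (?w i). W m < n" by (rule ballI)
          moreover have "\<forall>k\<ge>Suc i. ?w k = 0" using w(2) g(2) by (simp add: Suc_le_eq)
          ultimately have "?w \<in> fam_span V K g" by (intro bspec[OF IHn wN, THEN mp, THEN mp])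
          from fam_span_add_mult[OF finK this kK q] show ?thesis by simp
        qed
      qed
    qed
    note inner = this
    show ?case
    proof (intro ballI impI)
      fix w assume w: "w \<in> N" "\<forall>k\<ge>Suc i. w k = 0"
      have "\<forall>m\<in>keys (w i). W m < Suc (\<Sum>m\<in>keys (w i). W m)"
        by (auto simp: less_Suc_eq_le intro: member_le_sum)
      then show "w \<in> fam_span V K g" using inner w by blast
    qed
  qed
  have "N \<subseteq> fam_span V K g"
  proof
    fix w assume w: "w \<in> N"
    have "\<forall>k\<ge>length ds. w k = 0" using free_vecsD(2)[OF graded_subD(1)[OF N w]] by blast
    then show "w \<in> fam_span V K g" using span w by blast
  qed
  then show ?thesis using that[of K g e] finK g0 by blast
qed

text \<open>A generating subfamily of least size admits no relation with an invertible coefficient,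
  since that would make a generator redundant. A relation whose coefficient at \<open>b\<close> has
  nonzero constant term is reduced to this case by passing to its component in degree
  \<open>e b\<close>, where the coefficient at \<open>b\<close> is a scalar.\<close>

lemma minimal_generators:
  fixes N :: "('v, 'k::field) pvec set"
  assumes fin: "finite V" and N: "graded_sub V ds N"
  obtains K :: "(nat \<times> ('v \<Rightarrow>\<^sub>0 nat)) set" and g e where "finite K"
    "\<And>k. k \<in> K \<Longrightarrow> g k \<in> N \<and> g k \<in> free_comp V ds (e k)" "N \<subseteq> fam_span V K g"
    "\<forall>z. (\<forall>k\<in>K. z k \<in> carrier (poly_ring V)) \<longrightarrow> (\<forall>i. (\<Sum>k\<in>K. z k * g k i) = 0) \<longrightarrow>
      (\<forall>k\<in>K. lookup (z k) 0 = 0)"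
proof -
  obtain K0 :: "(nat \<times> ('v \<Rightarrow>\<^sub>0 nat)) set" and g e where K0: "finite K0"
    "\<And>k. k \<in> K0 \<Longrightarrow> g k \<in> N \<and> g k \<in> free_comp V ds (e k)" "N \<subseteq> fam_span V K0 g"
    using graded_sub_finitely_generated[OF fin N] by metis
  have "\<exists>K. (K \<subseteq> K0 \<and> N \<subseteq> fam_span V K g) \<and>
      (\<forall>K'. K' \<subseteq> K0 \<and> N \<subseteq> fam_span V K' g \<longrightarrow> card K \<le> card K')"
    by (rule ex_has_least_nat[of "\<lambda>K. K \<subseteq> K0 \<and> N \<subseteq> fam_span V K g" K0 card]) (simp add: K0(3))
  then obtain K where K': "(K \<subseteq> K0 \<and> N \<subseteq> fam_span V K g) \<and>
      (\<forall>K'. K' \<subseteq> K0 \<and> N \<subseteq> fam_span V K' g \<longrightarrow> card K \<le> card K')" ..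
  then have K: "K \<subseteq> K0" "N \<subseteq> fam_span V K g"
    and Kmin: "\<And>K'. K' \<subseteq> K0 \<Longrightarrow> N \<subseteq> fam_span V K' g \<Longrightarrow> card K \<le> card K'" by simp_all
  have finK: "finite K" using K(1) K0(1) by (rule finite_subset)
  have "lookup (z b) 0 = 0"
    if z: "\<And>k. k \<in> K \<Longrightarrow> z k \<in> carrier (poly_ring V)" "\<And>i. (\<Sum>k\<in>K. z k * g k i) = 0" and b: "b \<in> K" for z b
  proof (rule ccontr)
    define c where "c = lookup (z b) 0"
    assume "lookup (z b) 0 \<noteq> 0"
    then have c: "c \<noteq> 0" by (simp add: c_def)
    define y where "y k = hom_comp (e b - e k) (z k)" for k
    have y: "y k \<in> carrier (poly_ring V)" if "k \<in> K" for k
      unfolding y_def using z(1)[OF that] by (rule hom_comp_carrier)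
    have yb: "y b = single 0 c"
      by (rule poly_mapping_eqI) (auto simp: y_def lookup_hom_comp lookup_single when_def c_def mon_deg_eq_0)
    have y0: "(\<Sum>k\<in>K. y k * g k i) = 0" for i
    proof (cases "i < length ds")
      case True
      have "(\<Sum>k\<in>K. y k * g k i) = (\<Sum>k\<in>K. hom_comp (e b - ds ! i) (g k i * z k))"
      proof (rule sum.cong[OF refl])
        fix k assume "k \<in> K"
        then have "homogeneous (e k - ds ! i) (g k i)" using K0(2) K(1) True by (blast intro: free_compD(2))
        from hom_comp_mult[OF this, of "e b - ds ! i" "z k"]
        show "y k * g k i = hom_comp (e b - ds ! i) (g k i * z k)" by (simp add: y_def mult.commute)
      qed
      also have "\<dots> = hom_comp (e b - ds ! i) (\<Sum>k\<in>K. z k * g k i)"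
        unfolding hom_comp_sum by (simp add: mult.commute)
      finally show ?thesis using z(2) by simp
    next
      case False
      have "g k i = 0" if "k \<in> K" for k
      proof (rule free_compD(3))
        show "g k \<in> free_comp V ds (e k)" using K0(2)[of k] K(1) that by blast
      qed (use False in simp)
      then show ?thesis by simp
    qed
    let ?K = "K - {b}" and ?d = "single 0 (inverse c) :: ('v, 'k) mpoly"
    have gb: "g b i = (\<Sum>k\<in>?K. - (?d * y k) * g k i)" for i
    proof -
      have "y b * g b i + (\<Sum>k\<in>?K. y k * g k i) = 0"
        using y0[of i] sum.remove[OF finK b, of "\<lambda>k. y k * g k i"] by simp
      then have "?d * (y b * g b i + (\<Sum>k\<in>?K. y k * g k i)) = 0" by simp
      moreover have "?d * y b = 1" unfolding yb mult_single using c by simp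
      ultimately have "g b i + ?d * (\<Sum>k\<in>?K. y k * g k i) = 0"
        by (simp add: distrib_left mult.assoc[symmetric])
      then have "g b i = - (?d * (\<Sum>k\<in>?K. y k * g k i))" by (simp add: eq_neg_iff_add_eq_0)
      then show ?thesis by (simp add: sum_distrib_left sum_negf mult.assoc)
    qed
    have "N \<subseteq> fam_span V ?K g"
    proof
      fix w assume "w \<in> N"
      then obtain a where a: "\<forall>k\<in>K. a k \<in> carrier (poly_ring V)" "w = (\<lambda>i. \<Sum>k\<in>K. a k * g k i)"
        using K(2) by (blast elim: fam_span_E)
      let ?a = "\<lambda>k. a k + a b * (- (?d * y k))"
      have "w = (\<lambda>i. \<Sum>k\<in>?K. ?a k * g k i)"
      proof
        fix i
        have "w i = a b * g b i + (\<Sum>k\<in>?K. a k * g k i)"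
          unfolding a(2) using sum.remove[OF finK b, of "\<lambda>k. a k * g k i"] by simp
        also have "a b * g b i = (\<Sum>k\<in>?K. a b * (- (?d * y k)) * g k i)"
          unfolding gb sum_distrib_left by (simp add: mult.assoc)
        finally show "w i = (\<Sum>k\<in>?K. ?a k * g k i)"
          by (simp only: distrib_right sum.distrib add.commute)
      qed
      moreover have "?d \<in> carrier (poly_ring V)" by (rule carrier_single) simp
      then have "?a k \<in> carrier (poly_ring V)" if "k \<in> ?K" for k
        using a(1) b y that by (intro carrier_add carrier_mult carrier_uminus) auto
      ultimately show "w \<in> fam_span V ?K g" using fam_spanI[of ?K ?a V g] by simp
    qed
    then have "card K \<le> card ?K" using K(1) by (intro Kmin) auto
    moreover have "card ?K < card K" using finK b by (rule card_Diff1_less)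
    ultimately show False by simp
  qed
  note nc = this
  show ?thesis
  proof (rule that[OF finK _ K(2)])
    show "g k \<in> N \<and> g k \<in> free_comp V ds (e k)" if "k \<in> K" for k using that K(1) K0(2) by blast
    show "\<forall>z. (\<forall>k\<in>K. z k \<in> carrier (poly_ring V)) \<longrightarrow> (\<forall>i. (\<Sum>k\<in>K. z k * g k i) = 0) \<longrightarrow>
        (\<forall>k\<in>K. lookup (z k) 0 = 0)"
      by (intro allI impI ballI nc) simp_all
  qed
qed

section \<open>Construction of a minimal resolution\<close>

definition lmap_kernel :: "'v set \<Rightarrow> int list \<Rightarrow> (nat \<Rightarrow> nat \<Rightarrow> ('v, 'k::field) mpoly) \<Rightarrow> ('v, 'k) pvec set" where
  "lmap_kernel V es A = {w \<in> free_vecs V (length es). lmap (length es) A w = (\<lambda>_. 0)}"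

definition graded_entries :: "'v set \<Rightarrow> int list \<Rightarrow> int list \<Rightarrow> (nat \<Rightarrow> nat \<Rightarrow> ('v, 'k::field) mpoly) \<Rightarrow> bool" where
  "graded_entries V ds es A \<longleftrightarrow> (\<forall>r c. if r < length ds \<and> c < length es
     then A r c \<in> carrier (poly_ring V) \<and> homogeneous (es ! c - ds ! r) (A r c) else A r c = 0)"

lemma graded_sub_kernel:
  fixes A :: "nat \<Rightarrow> nat \<Rightarrow> ('v, 'k::field) mpoly"
  assumes A: "graded_entries V ds es A"
  shows "graded_sub V es (lmap_kernel V es A)"
  unfolding graded_sub_def
proof (intro conjI ballI allI)
  show "lmap_kernel V es A \<subseteq> free_vecs V (length es)" by (auto simp: lmap_kernel_def)
  show "(\<lambda>_. 0) \<in> lmap_kernel V es A"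
    by (simp add: lmap_kernel_def lin_mapD(3)[OF lin_map_lmap] free_vecs_def carrier_0)
next
  fix w w' :: "('v, 'k) pvec" assume w: "w \<in> lmap_kernel V es A" "w' \<in> lmap_kernel V es A"
  have "(\<lambda>i. w i + w' i) \<in> free_vecs V (length es)"
    using w by (intro free_vecsI) (auto simp: lmap_kernel_def free_vecsD intro: carrier_add)
  then show "(\<lambda>i. w i + w' i) \<in> lmap_kernel V es A"
    using w by (simp add: lmap_kernel_def lin_mapD(1)[OF lin_map_lmap])
next
  fix w :: "('v, 'k) pvec" and p :: "('v, 'k) mpoly" assume w: "w \<in> lmap_kernel V es A" "p \<in> carrier (poly_ring V)"
  have "(\<lambda>i. p * w i) \<in> free_vecs V (length es)"
    using w by (intro free_vecsI) (auto simp: lmap_kernel_def free_vecsD intro: carrier_mult)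
  then show "(\<lambda>i. p * w i) \<in> lmap_kernel V es A"
    using w by (simp add: lmap_kernel_def lin_mapD(2)[OF lin_map_lmap])
next
  fix w :: "('v, 'k) pvec" and j assume w: "w \<in> lmap_kernel V es A"
  let ?w = "\<lambda>i. if i < length es then hom_comp (j - es ! i) (w i) else 0"
  have "?w \<in> free_vecs V (length es)"
    using w by (intro free_vecsI) (auto simp: lmap_kernel_def free_vecsD intro: hom_comp_carrier)
  moreover have "lmap (length es) A ?w r = 0" for r
  proof (cases "r < length ds")
    case True
    have "lmap (length es) A ?w r = (\<Sum>c<length es. hom_comp (j - ds ! r) (A r c * w c))"
      unfolding lmap_def
    proof (rule sum.cong[OF refl])
      fix c assume c: "c \<in> {..<length es}"
      then have "homogeneous (es ! c - ds ! r) (A r c)" using A True unfolding graded_entries_def by (metis lessThan_iff)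
      from hom_comp_mult[OF this, of "j - ds ! r" "w c"] c
      show "A r c * ?w c = hom_comp (j - ds ! r) (A r c * w c)" by simp
    qed
    also have "\<dots> = hom_comp (j - ds ! r) (lmap (length es) A w r)" by (simp add: lmap_def hom_comp_sum)
    finally show ?thesis using w by (simp add: lmap_kernel_def)
  next
    case False
    then have "A r c = 0" for c using A unfolding graded_entries_def by metis
    then show ?thesis by (simp add: lmap_def)
  qed
  ultimately show "?w \<in> lmap_kernel V es A" by (simp add: lmap_kernel_def fun_eq_iff)
qed

text \<open>The last conclusion is minimality one step ahead: the columns of the next matrix lie in
  the kernel and thus have no constant terms.\<close>

lemma resolution_step:
  fixes N :: "('v, 'k::field) pvec set"
  assumes fin: "finite V" and N: "graded_sub V ds N"
  shows "\<exists>es A. graded_entries V ds es A \<and> N = lmap (length es) A ` free_vecs V (length es) \<and>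
    (\<forall>z\<in>lmap_kernel V es A. \<forall>k. lookup (z k) 0 = 0)"
proof -
  obtain K :: "(nat \<times> ('v \<Rightarrow>\<^sub>0 nat)) set" and g e where K: "finite K"
    "\<And>k. k \<in> K \<Longrightarrow> g k \<in> N \<and> g k \<in> free_comp V ds (e k)" "N \<subseteq> fam_span V K g"
    and Kmin: "\<forall>z. (\<forall>k\<in>K. z k \<in> carrier (poly_ring V)) \<longrightarrow> (\<forall>i. (\<Sum>k\<in>K. z k * g k i) = 0) \<longrightarrow>
      (\<forall>k\<in>K. lookup (z k) 0 = 0)"
    by (rule minimal_generators[OF fin N]) blast
  obtain f where f: "bij_betw f {..<card K} K"
    using ex_bij_betw_nat_finite[OF K(1)] by (auto simp: lessThan_atLeast0)
  define fi where "fi = inv_into {..<card K} f"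
  have fi: "fi k < card K" "f (fi k) = k" if "k \<in> K" for k
    using f that unfolding fi_def by (auto simp: bij_betw_def f_inv_into_f inv_into_into[of k f "{..<card K}", simplified])
  have fK: "f c \<in> K" if "c < card K" for c using f that by (auto simp: bij_betw_def)
  define es where "es = map (\<lambda>c. e (f c)) [0..<card K]"
  have es: "length es = card K" "\<And>c. c < card K \<Longrightarrow> es ! c = e (f c)" by (simp_all add: es_def)
  define A where "A r c = (if r < length ds \<and> c < card K then g (f c) r else 0)" for r c
  have gA: "g (f c) r = A r c" if "c < card K" for r c
    using that free_compD(3)[of "g (f c)" V ds "e (f c)" r] K(2)[OF fK[OF that]] by (auto simp: A_def)
  have lm: "lmap (length es) A z = (\<lambda>r. \<Sum>k\<in>K. z (fi k) * g k r)" for z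
  proof
    fix r
    have "(\<Sum>k\<in>K. z (fi k) * g k r) = (\<Sum>c<card K. z (fi (f c)) * g (f c) r)"
      by (rule sum.reindex_bij_betw[OF f, symmetric])
    also have "\<dots> = (\<Sum>c<card K. A r c * z c)"
    proof (rule sum.cong[OF refl])
      fix c assume "c \<in> {..<card K}"
      then have "fi (f c) = c" using f unfolding fi_def by (simp add: bij_betw_def)
      then show "z (fi (f c)) * g (f c) r = A r c * z c"
        using gA \<open>c \<in> {..<card K}\<close> by (simp add: mult.commute)
    qed
    finally show "lmap (length es) A z r = (\<Sum>k\<in>K. z (fi k) * g k r)" by (simp add: lmap_def es)
  qed
  have "graded_entries V ds es A"
    unfolding graded_entries_def
  proof (intro allI)
    fix r c
    have "A r c \<in> carrier (poly_ring V) \<and> homogeneous (es ! c - ds ! r) (A r c)" if "r < length ds" "c < card K"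
      using that free_compD(1,2)[of "g (f c)" V ds "e (f c)" r] K(2)[OF fK[OF that(2)]] es(2)
      by (simp add: A_def)
    then show "if r < length ds \<and> c < length es then A r c \<in> carrier (poly_ring V) \<and>
        homogeneous (es ! c - ds ! r) (A r c) else A r c = 0"
      by (auto simp: es(1)) (auto simp: A_def)
  qed
  moreover have "N = lmap (length es) A ` free_vecs V (length es)"
  proof (intro equalityI subsetI)
    fix w assume "w \<in> N"
    then have "w \<in> fam_span V K g" using K(3) by blast
    then obtain c where c: "\<forall>k\<in>K. c k \<in> carrier (poly_ring V)" "w = (\<lambda>i. \<Sum>k\<in>K. c k * g k i)"
      by (rule fam_span_E)
    let ?z = "\<lambda>i. if i < card K then c (f i) else 0"
    have "?z \<in> free_vecs V (length es)" using c(1) fK by (intro free_vecsI) (auto simp: es)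
    moreover have "w = lmap (length es) A ?z"
      unfolding lm c(2) using fi by (intro ext sum.cong) auto
    ultimately show "w \<in> lmap (length es) A ` free_vecs V (length es)" by blast
  next
    fix w assume "w \<in> lmap (length es) A ` free_vecs V (length es)"
    then obtain z where z: "z \<in> free_vecs V (length es)" "w = lmap (length es) A z" by blast
    have "(\<lambda>r. \<Sum>k\<in>S. z (fi k) * g k r) \<in> N" if "S \<subseteq> K" for S
    proof -
      have "finite S" using that K(1) by (rule finite_subset)
      then show ?thesis using that
      proof (induction S rule: finite_induct)
        case empty
        then show ?case using graded_subD(2)[OF N] by simp
      next
        case (insert k S)
        then have "(\<lambda>r. z (fi k) * g k r) \<in> N"
          using K(2)[of k] free_vecsD(1)[OF z(1)] by (intro graded_subD(4)[OF N]) auto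
        from graded_subD(3)[OF N this] insert show ?case by simp
      qed
    qed
    then show "w \<in> N" unfolding z(2) lm by blast
  qed
  moreover have "lookup (z c) 0 = 0" if z: "z \<in> lmap_kernel V es A" for z c
  proof (cases "c < card K")
    case True
    have z': "z \<in> free_vecs V (length es)" "lmap (length es) A z = (\<lambda>_. 0)" using z by (auto simp: lmap_kernel_def)
    have "lookup (z (fi (f c))) 0 = 0"
    proof (rule Kmin[rule_format, of "\<lambda>k. z (fi k)"])
      show "z (fi k) \<in> carrier (poly_ring V)" for k by (rule free_vecsD(1)[OF z'(1)])
      show "(\<Sum>k\<in>K. z (fi k) * g k i) = 0" for i using fun_cong[OF z'(2), of i] unfolding lm .
      show "f c \<in> K" by (rule fK[OF True])
    qed
    moreover have "fi (f c) = c" using f True unfolding fi_def by (simp add: bij_betw_def)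
    ultimately show ?thesis by simp
  next
    case False
    have "z c = 0" using z False by (intro free_vecsD(2)[of z V "length es"]) (auto simp: lmap_kernel_def es)
    then show ?thesis by simp
  qed
  ultimately show ?thesis by blast
qed

lemma fun_resolution_exists:
  fixes I :: "('v, 'k::field) mpoly set"
  assumes fin: "finite V" and I: "graded_sub V [0] {w. w 0 \<in> I \<and> (\<forall>i>0. w i = 0)}"
  obtains sh a where "fun_resolution V I sh a"
proof -
  let ?N0 = "{w. w 0 \<in> I \<and> (\<forall>i>0. w i = 0)} :: ('v, 'k) pvec set"
  \<comment> \<open>A state is one matrix with its row and column degrees. The clause for
    \<open>n = 0\<close> fixes the augmentation; \<open>nxt\<close> records exactness between
    consecutive states.\<close>
  define good where "good n s \<longleftrightarrow> (case s of (ds, es, A) \<Rightarrow> graded_entries V ds es A \<and>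
      (\<forall>z\<in>lmap_kernel V es A. \<forall>k. lookup (z k) 0 = 0) \<and>
      (n = 0 \<longrightarrow> ds = [0] \<and> ?N0 = lmap (length es) A ` free_vecs V (length es)))"
    for n :: nat and s :: "int list \<times> int list \<times> (nat \<Rightarrow> nat \<Rightarrow> ('v, 'k) mpoly)"
  define nxt where "nxt s s' \<longleftrightarrow> (case s of (ds, es, A) \<Rightarrow> case s' of (ds', es', A') \<Rightarrow>
      ds' = es \<and> lmap_kernel V es A = lmap (length es') A' ` free_vecs V (length es'))"
    for s s' :: "int list \<times> int list \<times> (nat \<Rightarrow> nat \<Rightarrow> ('v, 'k) mpoly)"
  have "\<exists>s. \<forall>n. good n (s n) \<and> nxt (s n) (s (Suc n))"
  proof (rule dependent_nat_choice)
    obtain es A where "graded_entries V [0] es A" "?N0 = lmap (length es) A ` free_vecs V (length es)"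
      "\<forall>z\<in>lmap_kernel V es A. \<forall>k. lookup (z k) 0 = 0" using resolution_step[OF fin I] by blast
    then have "good 0 ([0], es, A)" by (simp add: good_def)
    then show "\<exists>s. good 0 s" by blast
  next
    fix s n assume s: "good n s"
    obtain ds es A where [simp]: "s = (ds, es, A)" by (cases s)
    have "graded_entries V ds es A" using s by (simp add: good_def)
    then have "graded_sub V es (lmap_kernel V es A)" by (rule graded_sub_kernel)
    then obtain es' A' where "graded_entries V es es' A'"
      "lmap_kernel V es A = lmap (length es') A' ` free_vecs V (length es')"
      "\<forall>z\<in>lmap_kernel V es' A'. \<forall>k. lookup (z k) 0 = 0" using resolution_step[OF fin] by blast
    then have "good (Suc n) (es, es', A') \<and> nxt s (es, es', A')" by (simp add: good_def nxt_def)
    then show "\<exists>s'. good (Suc n) s' \<and> nxt s s'" by blast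
  qed
  then obtain s where s: "\<And>n. good n (s n)" "\<And>n. nxt (s n) (s (Suc n))" by blast
  define ds where "ds n = fst (s n)" for n
  define sh where "sh n = fst (snd (s n))" for n
  define a where "a n = snd (snd (s n))" for n
  have sn: "s n = (ds n, sh n, a n)" for n by (simp add: ds_def sh_def a_def)
  have ent: "graded_entries V (ds n) (sh n) (a n)"
    and ker0: "\<And>z k. z \<in> lmap_kernel V (sh n) (a n) \<Longrightarrow> lookup (z k) 0 = 0" for n
    using s(1)[of n] by (auto simp: good_def sn)
  have ds0: "ds 0 = [0]" and N0: "?N0 = lmap (length (sh 0)) (a 0) ` free_vecs V (length (sh 0))"
    using s(1)[of 0] by (auto simp: good_def sn)
  have dsS: "ds (Suc n) = sh n"
    and ker: "lmap_kernel V (sh n) (a n) = lmap (length (sh (Suc n))) (a (Suc n)) ` free_vecs V (length (sh (Suc n)))" for n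
    using s(2)[of n] by (auto simp: nxt_def sn)
  have rs: "row_shifts sh n = ds n" for n using ds0 dsS by (cases n) auto
  have "fun_resolution V I sh a"
    unfolding fun_resolution_def
  proof (intro conjI allI)
    fix i r c
    show "if r < length (row_shifts sh i) \<and> c < length (sh i)
        then a i r c \<in> carrier (poly_ring V) \<and> homogeneous (sh i ! c - row_shifts sh i ! r) (a i r c)
        else a i r c = 0"
      using ent[of i] unfolding graded_entries_def rs by blast
  next
    have "I = (\<lambda>w. w 0) ` ?N0"
    proof (intro equalityI subsetI)
      fix p assume "p \<in> I"
      then show "p \<in> (\<lambda>w. w 0) ` ?N0" by (intro image_eqI[of _ _ "\<lambda>i. if i = 0 then p else 0"]) auto
    qed auto
    then show "I = (\<lambda>w. lmap (length (sh 0)) (a 0) w 0) ` free_vecs V (length (sh 0))"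
      unfolding N0 image_image .
  next
    fix i show "{w \<in> free_vecs V (length (sh i)). lmap (length (sh i)) (a i) w = (\<lambda>_. 0)} =
        lmap (length (sh (Suc i))) (a (Suc i)) ` free_vecs V (length (sh (Suc i)))"
      using ker[of i] by (simp add: lmap_kernel_def)
  next
    fix i r c
    show "lookup (a (Suc i) r c) 0 = 0"
    proof (cases "c < length (sh (Suc i))")
      case True
      \<comment> \<open>The unit vector singles out the c-th column, which thereby lies in the
        kernel of the preceding matrix.\<close>
      let ?e = "\<lambda>k. if k = c then 1 else 0 :: ('v, 'k) mpoly"
      have "?e \<in> free_vecs V (length (sh (Suc i)))"
        using True by (intro free_vecsI) (auto simp: carrier_0 carrier_1)
      then have "lmap (length (sh (Suc i))) (a (Suc i)) ?e \<in> lmap_kernel V (sh i) (a i)" unfolding ker by blast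
      from ker0[OF this, of r] have "lookup (lmap (length (sh (Suc i))) (a (Suc i)) ?e r) 0 = 0" .
      moreover have "lmap (length (sh (Suc i))) (a (Suc i)) ?e r = (\<Sum>k<length (sh (Suc i)). if k = c then a (Suc i) r c else 0)"
        unfolding lmap_def by (intro sum.cong) auto
      ultimately show ?thesis using True by simp
    next
      case False
      then have "a (Suc i) r c = 0" using ent[of "Suc i"] unfolding graded_entries_def by metis
      then show ?thesis by simp
    qed
  qed
  then show ?thesis by (rule that)
qed

section \<open>Regularity of truncations\<close>

lemma graded_sub_mon_ideal:
  assumes A: "\<And>m n. A m \<Longrightarrow> A (m + n)"
  shows "graded_sub V [0] {w. w 0 \<in> (mon_ideal V A :: ('v, 'k::field) mpoly set) \<and> (\<forall>i>0. w i = 0)}"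
proof -
  have mult: "p * q \<in> mon_ideal V A" if "p \<in> carrier (poly_ring V)" "q \<in> mon_ideal V A" for p q :: "('v, 'k) mpoly"
    using ideal.I_l_closed[OF ideal_mon_ideal[of A V] that(2,1)] A by simp
  show ?thesis
    unfolding graded_sub_def
  proof (intro conjI ballI allI subsetI)
    fix w :: "('v, 'k) pvec" assume w: "w \<in> {w. w 0 \<in> mon_ideal V A \<and> (\<forall>i>0. w i = 0)}"
    then show "w \<in> free_vecs V (length [0::int])"
      using mon_ideal_carrier[of V A] by (intro free_vecsI) auto
  qed (auto simp: mon_ideal_0 intro: mon_ideal_add mult hom_comp_mon_ideal)
qed

lemma graded_module_ideal_comp:
  assumes A: "\<And>m n. A m \<Longrightarrow> A (m + n)"
  shows "graded_module V (ideal_comp (mon_ideal V A :: ('v, 'k::field) mpoly set))"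
proof -
  have mult: "pvar v * q \<in> mon_ideal V A" if "v \<in> V" "q \<in> mon_ideal V A" for v and q :: "('v, 'k) mpoly"
    using ideal.I_l_closed[OF ideal_mon_ideal[of A V] that(2) carrier_pvar[OF that(1)]] A by simp
  show ?thesis
    unfolding graded_module_def
  proof (intro conjI allI impI ballI)
    fix j v and w :: "('v, 'k) pvec"
    assume v: "v \<in> V" and w: "w \<in> ideal_comp (mon_ideal V A) j"
    have "homogeneous (j + 1) (pvar v * w 0)"
      using homogeneous_mult[OF homogeneous_pvar[of v], of j "w 0"] w by (simp add: ideal_comp_def add.commute)
    then show "(\<lambda>i. pvar v * w i) \<in> ideal_comp (mon_ideal V A) (j + 1)"
      using v w mult by (simp add: ideal_comp_def)
  qed (auto simp: ideal_comp_def mon_ideal_0 mon_ideal_add mon_ideal_uminus homogeneous_add homogeneous_uminus)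
qed

text \<open>Existence makes the choice in \<open>min_res_shifts\<close> a genuine minimal
  resolution; the Koszul criterion then holds for it as for any other.\<close>

lemma min_res_shifts_iff_koszul:
  fixes I :: "('v, 'k::field) mpoly set"
  assumes fin: "finite V" and h: "inj_on h V" and I: "graded_sub V [0] {w. w 0 \<in> I \<and> (\<forall>i>0. w i = 0)}"
  shows "j \<in> set (min_res_shifts V I i) \<longleftrightarrow> \<not> koszul_vanishes V h (ideal_comp I) i j"
proof -
  obtain sh0 a0 where "fun_resolution V I sh0 a0" by (rule fun_resolution_exists[OF fin I])
  then obtain phi0 where "minimal_graded_free_resolution V I sh0 phi0" by (rule fun_minimal_resolution)
  then have "\<exists>sh phi. minimal_graded_free_resolution V I sh phi" by blast
  then have "\<exists>phi. minimal_graded_free_resolution V I (min_res_shifts V I) phi"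
    unfolding min_res_shifts_def by (rule someI_ex)
  then obtain phi where "minimal_graded_free_resolution V I (min_res_shifts V I) phi" ..
  then obtain a where a: "fun_resolution V I (min_res_shifts V I) a" by (rule minimal_resolution_fun)
  interpret min_resolution V h I "min_res_shifts V I" a
    using fin h a by unfold_locales
  show ?thesis by (rule shift_iff_koszul)
qed

definition koszul_slopes :: "'v set \<Rightarrow> ('v \<Rightarrow> nat) \<Rightarrow> ('v, 'k::field) mpoly set \<Rightarrow> int set" where
  "koszul_slopes V h I = {j - int i | i j. \<not> koszul_vanishes V h (ideal_comp I) i j}"

lemma regularity_eq_Max:
  assumes "finite V" "inj_on h V" "graded_sub V [0] {w. w 0 \<in> I \<and> (\<forall>i>0. w i = 0)}"
  shows "regularity V I = Max (koszul_slopes V h I)"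
proof -
  have "graded_betti V I i j \<noteq> 0 \<longleftrightarrow> \<not> koszul_vanishes V h (ideal_comp I) i j" for i j
    unfolding graded_betti_def min_res_shifts_iff_koszul[OF assms, symmetric] by (simp add: count_list_0_iff)
  then show ?thesis by (simp add: regularity_def koszul_slopes_def)
qed

text \<open>Finiteness makes \<open>Max\<close> meaningful: homological degrees are bounded by
  \<open>card V\<close>, and each contributes the entries of a single list.\<close>

lemma finite_koszul_slopes:
  assumes fin: "finite V" and h: "inj_on h V" and I: "graded_sub V [0] {w. w 0 \<in> I \<and> (\<forall>i>0. w i = 0)}"
    and M: "graded_module V (ideal_comp I)"
  shows "finite (koszul_slopes V h I)"
proof (rule finite_subset)
  show "koszul_slopes V h I \<subseteq> (\<Union>i\<le>card V. (\<lambda>j. j - int i) ` set (min_res_shifts V I i))"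
  proof
    fix x assume "x \<in> koszul_slopes V h I"
    then obtain i j where ij: "x = j - int i" "\<not> koszul_vanishes V h (ideal_comp I) i j"
      by (auto simp: koszul_slopes_def)
    then have "i \<le> card V" using koszul_vanishes_above[OF fin M, of i h j] by (meson not_le)
    moreover have "j \<in> set (min_res_shifts V I i)" using ij(2) min_res_shifts_iff_koszul[OF fin h I] by blast
    ultimately show "x \<in> (\<Union>i\<le>card V. (\<lambda>j. j - int i) ` set (min_res_shifts V I i))" using ij(1) by blast
  qed
qed auto

text \<open>Koszul homology in homological degree \<open>i\<close> and internal degree \<open>j\<close> involves only the components of
  degrees \<open>j - i\<close> and \<open>j - i - 1\<close>, so truncation at \<open>d\<close> does not affect it for \<open>j - i > d\<close>.\<close>

lemma regularity_truncation:
  assumes fin: "finite (V :: 'v set)"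
    and A: "\<And>m n. A m \<Longrightarrow> A (m + n)" and B: "\<And>m n. B m \<Longrightarrow> B (m + n)"
    and trunc: "\<And>m. keys m \<subseteq> V \<Longrightarrow> B m \<longleftrightarrow> A m \<and> d \<le> mon_deg m"
    and m0: "keys m0 \<subseteq> V" "A m0" "mon_deg m0 = d"
    and min: "\<And>m v. m0 = m + single v 1 \<Longrightarrow> \<not> A m"
  shows "regularity V (mon_ideal V A :: ('v, 'k::field) mpoly set) = regularity V (mon_ideal V B :: ('v, 'k) mpoly set)"
proof -
  obtain h :: "'v \<Rightarrow> nat" where h: "inj_on h V" using finite_imp_inj_to_nat_seg[OF fin] by blast
  let ?I = "mon_ideal V A :: ('v, 'k) mpoly set" and ?J = "mon_ideal V B :: ('v, 'k) mpoly set"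
  note gI = graded_module_ideal_comp[of A V, OF A, where ?'k = 'k]
    and gJ = graded_module_ideal_comp[of B V, OF B, where ?'k = 'k]
  note sI = graded_sub_mon_ideal[of A V, OF A, where ?'k = 'k]
    and sJ = graded_sub_mon_ideal[of B V, OF B, where ?'k = 'k]
  have comp_eq: "ideal_comp ?I j = ideal_comp ?J j" if j: "int d \<le> j" for j
  proof -
    have "p \<in> ?I \<longleftrightarrow> p \<in> ?J" if "homogeneous j p" for p
    proof -
      have "d \<le> mon_deg m" if "m \<in> keys p" for m
        using \<open>homogeneous j p\<close> that j by (auto simp: homogeneous_def)
      then show ?thesis using trunc by (auto simp: mon_ideal_def)
    qed
    then show ?thesis by (auto simp: ideal_comp_def)
  qed
  have above: "x \<in> koszul_slopes V h ?I \<longleftrightarrow> x \<in> koszul_slopes V h ?J" if x: "int d < x" for x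
  proof -
    have "koszul_vanishes V h (ideal_comp ?I) i j \<longleftrightarrow> koszul_vanishes V h (ideal_comp ?J) i j" if "x = j - int i" for i j
      using x that by (intro koszul_vanishes_cong comp_eq) auto
    then show ?thesis unfolding koszul_slopes_def by blast
  qed
  \<comment> \<open>\<open>m0\<close> is a minimal generator of both ideals, so d occurs in both
    sets. The slopes below d, where the sets may differ, therefore do not affect the maxima.\<close>
  have gen: "int d \<in> koszul_slopes V h (mon_ideal V C :: ('v, 'k) mpoly set)"
    if C: "\<And>m. keys m \<subseteq> V \<Longrightarrow> C m \<Longrightarrow> A m" "C m0"
      and g: "graded_module V (ideal_comp (mon_ideal V C :: ('v, 'k) mpoly set))" for C
  proof -
    let ?w = "\<lambda>i. if i = 0 then single m0 1 else 0 :: ('v, 'k) mpoly"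
    have w: "?w \<in> ideal_comp (mon_ideal V C) (int d)"
      using m0 C(2) homogeneous_single[of m0 "1 :: 'k"] by (simp add: ideal_comp_def mon_ideal_single)
    have "\<not> koszul_vanishes V h (ideal_comp (mon_ideal V C :: ('v, 'k) mpoly set)) 0 (int d)"
    proof
      assume "koszul_vanishes V h (ideal_comp (mon_ideal V C :: ('v, 'k) mpoly set)) 0 (int d)"
      from this[unfolded koszul_vanishes_0_iff[OF fin g], THEN bspec, OF w]
      obtain u where u: "(\<forall>v\<in>V. u v \<in> ideal_comp (mon_ideal V C) (int d - 1)) \<and> ?w = (\<lambda>i. \<Sum>v\<in>V. pvar v * u v i)" ..
      then have "?w 0 = (\<Sum>v\<in>V. pvar v * u v 0)" by metis
      \<comment> \<open>The coefficient of \<open>m0\<close> has to come from some x_v times an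
        element of the ideal, which would place \<open>m0\<close> divided by x_v among the exponents
        satisfying \<open>A\<close>.\<close>
      then have "(\<Sum>v\<in>V. lookup (pvar v * u v 0) m0) = 1"
        unfolding lookup_sum[symmetric] by (metis lookup_single_eq)
      then have "(\<Sum>v\<in>V. lookup (pvar v * u v 0) m0) \<noteq> 0" by simp
      then obtain v where v: "v \<in> V" "lookup (pvar v * u v 0) m0 \<noteq> 0"
        by (rule sum.not_neutral_contains_not_neutral)
      then have vm: "v \<in> keys m0"
        "lookup (u v 0) (m0 - single v 1) \<noteq> 0"
        by (auto simp: lookup_pvar_mult simp del: One_nat_def split: if_splits)
      have "u v 0 \<in> mon_ideal V C" using u v(1) by (auto simp: ideal_comp_def)
      then have "A (m0 - single v 1)"
        using vm(2) C(1) by (auto simp: mon_ideal_def in_keys_iff)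
      then show False using min pm_diff_add_swap(2)[OF vm(1)] by metis
    qed
    then show ?thesis unfolding koszul_slopes_def by force
  qed
  have dI: "int d \<in> koszul_slopes V h ?I" using m0 by (intro gen gI)
  have dJ: "int d \<in> koszul_slopes V h ?J"
    using trunc trunc[OF m0(1)] m0 by (intro gen gJ) auto
  have fI: "finite (koszul_slopes V h ?I)" and fJ: "finite (koszul_slopes V h ?J)"
    using finite_koszul_slopes[OF fin h sI gI] finite_koszul_slopes[OF fin h sJ gJ] by auto
  have "Max (koszul_slopes V h ?I) = Max (koszul_slopes V h ?J)"
  proof (rule antisym)
    show "Max (koszul_slopes V h ?I) \<le> Max (koszul_slopes V h ?J)"
    proof (rule Max.boundedI[OF fI])
      show "koszul_slopes V h ?I \<noteq> {}" using dI by blast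
      show "x \<le> Max (koszul_slopes V h ?J)" if "x \<in> koszul_slopes V h ?I" for x
        using that above[of x] Max_ge[OF fJ, of x] Max_ge[OF fJ dJ] by (cases "int d < x") auto
    qed
    show "Max (koszul_slopes V h ?J) \<le> Max (koszul_slopes V h ?I)"
    proof (rule Max.boundedI[OF fJ])
      show "koszul_slopes V h ?J \<noteq> {}" using dJ by blast
      show "x \<le> Max (koszul_slopes V h ?I)" if "x \<in> koszul_slopes V h ?J" for x
        using that above[of x] Max_ge[OF fI, of x] Max_ge[OF fI dI] by (cases "int d < x") auto
    qed
  qed
  then show ?thesis using regularity_eq_Max[OF fin h sI] regularity_eq_Max[OF fin h sJ] by simp
qed

section \<open>Powers of the edge ideal as truncations\<close>

lemma packs_edges_bounds:
  assumes G: "simple_graph G" and p: "packs (edge_items G) m s"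
  shows "2 * s \<le> sum m (verts G)" "vertex_cover G c \<Longrightarrow> s \<le> sum m c"
proof -
  have fin: "finite (verts G)" using G by (simp add: simple_graph_def)
  show "2 * s \<le> sum m (verts G)"
    using p
  proof (induction rule: packs.induct)
    case (item m t S k t')
    have "S \<subseteq> verts G" "card S = 2" "k = 1" using item.hyps(2) G by (auto simp: edge_items_def simple_graph_def)
    then show ?case using sum_of_bool_subset[OF fin, of S m] item.IH item.hyps(3) by simp
  qed simp
  show "s \<le> sum m c" if c: "vertex_cover G c"
    using p
  proof (induction rule: packs.induct)
    case (item m t S k t')
    have S: "S \<in> edges G" "k = 1" using item.hyps(2) by (auto simp: edge_items_def)
    have fc: "finite c" by (rule vertex_cover_finite[OF G c])
    have "S \<inter> c \<noteq> {}" using S(1) c by (simp add: vertex_cover_def)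
    then have "0 < card (c \<inter> S)" using fc by (simp add: card_gt_0_iff Int_commute)
    then show ?case using item.IH item.hyps(3) S(2) fc by (simp add: sum.distrib)
  qed simp
qed

theorem theorem3p5:
  fixes n r :: nat
    and Cs Bs :: "'v sgraph list"
    and G' G :: "'v sgraph"
    and I :: "('v, 'k::field) mpoly set"
  assumes "n \<ge> 1" and "r \<ge> 1"
    and "length Cs = r"
    and "\<forall>C\<in>set Cs. cycle_graph (2 * n + 1) C"
    and "clique_sum_list Cs G'"
    and "\<forall>B\<in>set Bs. bipartite_graph B"
    and "clique_sum_list (G' # Bs) G"
    and "I = edge_ideal G"
    and "\<forall>C\<in>set Cs. graph_nbhd G C = verts G"
  shows "\<forall>s\<ge>1. regularity (verts G) (symbolic_power (poly_ring (verts G)) I s)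
             = regularity (verts G) (ideal_power (poly_ring (verts G)) I s)"
proof (intro allI impI)
  fix s :: nat assume s: "1 \<le> s"
  note dl = clique_sum_list_dual[OF assms(4-7)]
  have G: "simple_graph G" by (rule dl(1))
  have fin: "finite (verts G)" using G by (simp add: simple_graph_def)
  \<comment> \<open>Since r is positive there is a cycle, hence an edge; the generator in degree 2s
    at which the truncation is anchored is built from it.\<close>
  have "Cs \<noteq> []" using assms(2,3) by auto
  then have C: "hd Cs \<in> set Cs" by simp
  obtain x where x: "cyclic_list (2 * n + 1) x (hd Cs)" using cycle_graph_cyclic_list assms(4) C by blast
  have "{x 0, x (Suc 0)} \<in> edges G" using cyclic_list_edgeI[OF x, of 0] dl(2)[OF C] by blast
  then obtain u v where uv: "{u, v} \<in> edges G" by blast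
  have neq: "u \<noteq> v" and uvV: "u \<in> verts G" "v \<in> verts G" using uv G by (auto simp: simple_graph_def)
  let ?A = "\<lambda>m. \<forall>c. vertex_cover G c \<longrightarrow> s \<le> sum (lookup m) c"
  let ?B = "\<lambda>m. packs (edge_items G) (lookup m) s"
  let ?m0 = "single u s + single v s"
  have m0: "lookup ?m0 y = (if y = u \<or> y = v then s else 0)" for y
    using neq by (auto simp: lookup_add lookup_single when_def)
  have deg: "mon_deg m = sum (lookup m) (verts G)" if "keys m \<subseteq> verts G" for m
    using mon_deg_superset[OF fin that] .
  have "regularity (verts G) (mon_ideal (verts G) ?A :: ('v, 'k) mpoly set) =
      regularity (verts G) (mon_ideal (verts G) ?B :: ('v, 'k) mpoly set)"
  proof (rule regularity_truncation[OF fin, where d = "2 * s" and ?m0.0 = ?m0])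
    show "?A (m + n)" if "?A m" for m n
      using that by (simp add: lookup_add sum.distrib trans_le_add1)
    show "?B (m + n)" if "?B m" for m n
      using packs_add_left[OF that, of "lookup n"] by (rule packs_mono_weight) (simp add: lookup_add)
    \<comment> \<open>The bound on covers and degree at least 2s yield an edge packing of value s.
      The converse is weak duality: an edge uses two units of degree and meets every cover.\<close>
    show "?B m \<longleftrightarrow> ?A m \<and> 2 * s \<le> mon_deg m" if "keys m \<subseteq> verts G" for m
      using cover_weight_packs_edges[OF assms(4-7,9), of s "lookup m"]
        packs_edges_bounds[OF G, of "lookup m" s] deg[OF that] by auto
    show "keys ?m0 \<subseteq> verts G" using uvV by (auto simp: keys_add_nat)
    show "mon_deg ?m0 = 2 * s" by (simp add: mon_deg_add)
    show "?A ?m0"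
    proof (intro allI impI)
      fix c assume c: "vertex_cover G c"
      have "{u, v} \<inter> c \<noteq> {}" using c uv unfolding vertex_cover_def by (metis (lifting))
      then obtain y where y: "y \<in> c" "y = u \<or> y = v" by blast
      then have "s = lookup ?m0 y" unfolding m0 by simp
      also have "\<dots> \<le> sum (lookup ?m0) c"
        using y(1) vertex_cover_finite[OF G c] by (intro member_le_sum) auto
      finally show "s \<le> sum (lookup ?m0) c" .
    qed
    show "\<not> ?A m" if m: "?m0 = m + single w 1" for m w
    proof
      assume A: "?A m"
      have lm: "lookup m y + (if y = w then 1 else 0) = (if y = u \<or> y = v then s else 0)" for y
      proof -
        have "lookup ?m0 y = lookup m y + (if y = w then 1 else 0)"
          unfolding m by (auto simp: lookup_add lookup_single when_def)
        then show ?thesis unfolding m0 by (rule sym)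
      qed
      have w: "w = u \<or> w = v" using lm[of w] by (auto split: if_splits)
      \<comment> \<open>The end of the edge opposite to \<open>w\<close>. The cover omitting only
        \<open>z\<close> sees just the exponent at \<open>w\<close>, which has dropped to s -
        1.\<close>
      define z where "z = (if w = u then v else u)"
      have uvz: "{u, v} = {w, z}" and zw: "z \<noteq> w" using w neq by (auto simp: z_def)
      have z: "lookup m y = 0" if "y \<noteq> w" "y \<noteq> z" for y
      proof -
        have "y \<notin> {u, v}" unfolding uvz using that by simp
        then show ?thesis using lm[of y] that by simp
      qed
      have "sum (lookup m) (verts G - {z}) = sum (lookup m) {w}"
        using z zw w uvV fin by (intro sum.mono_neutral_right) auto
      also have "\<dots> < s" using lm[of w] w s by (auto split: if_splits)
      finally show False using A vertex_cover_minus[OF G, of z] by (simp add: not_less[symmetric])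
    qed
  qed
  then show "regularity (verts G) (symbolic_power (poly_ring (verts G)) I s)
      = regularity (verts G) (ideal_power (poly_ring (verts G)) I s)"
    unfolding assms(8) symbolic_power_edge_ideal[OF G] ideal_power_edge_ideal[OF G] .
qed

end
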